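(* There exists an absolute constant $c>0$ such that for all integers $g,k\geq 0$ there are infinitely many integers $n$ for which there is an $n$-vertex $(g,k)$-planar graph with treewidth at least $c\sqrt{(g+1)(k+1)n}$ and layered treewidth at least $c\,(g+1)(k+1)$.
   Context: Graphs are finite and simple. The Euler genus of the orientable surface with $h$ handles is $2h$; the Euler genus of the non-orientable surface with $c$ cross-caps is $c$. A graph is $(g,k)$-planar if it can be drawn (vertices as distinct points, edges as curves, in the usual sense) in a surface of Euler genus at most $g$ with at most $k$ crossings on each edge. Treewidth is the usual one: the minimum, over all tree-decompositions, of (maximum bag size) $-1$. A layering of a graph $G$ is a partition $(V_0,V_1,\dots,V_t)$ of $V(G)$ such that for every edge $vw\in E(G)$, if $v\in V_i$ and $w\in V_j$, then $|i-j|\leq 1$; each $V_i$ is called a layer. The layered width of a tree-decomposition $(B_x:x\in V(T))$ of $G$ is the minimum integer $\ell$ such that, for some layering $(V_0,V_1,\dots,V_t)$ of $G$, each bag $B_x$ contains at most $\ell$ vertices in each layer $V_i$. The layered treewidth of $G$ is the minimum layered width of a tree-decomposition of $G$. *)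

theory Defs
  imports "HOL-Analysis.Analysis"
begin

section \<open>Finite simple graphs and trees\<close>

text \<open>
  A graph is given by its vertex set and its set of edges, each edge being a two-element set of
  vertices.
\<close>

definition simple_graph :: "'a set \<Rightarrow> 'a set set \<Rightarrow> bool" where
  "simple_graph V E \<longleftrightarrow> finite V \<and> (\<forall>e\<in>E. e \<subseteq> V \<and> card e = 2)"

text \<open>The subgraph induced by \<open>U\<close> is nonempty and connected.\<close>

definition induces_connected :: "'a set \<Rightarrow> 'a set set \<Rightarrow> bool" where
  "induces_connected U E \<longleftrightarrow>
     U \<noteq> {} \<and> (\<forall>u\<in>U. \<forall>v\<in>U. (u, v) \<in> {(x, y). x \<in> U \<and> y \<in> U \<and> {x, y} \<in> E}\<^sup>*)"

definition is_cycle :: "'a set set \<Rightarrow> 'a list \<Rightarrow> bool" where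
  "is_cycle E xs \<longleftrightarrow> length xs \<ge> 3 \<and> distinct xs \<and>
     (\<forall>i<length xs. {xs ! i, xs ! (Suc i mod length xs)} \<in> E)"

definition is_tree :: "'a set \<Rightarrow> 'a set set \<Rightarrow> bool" where
  "is_tree V E \<longleftrightarrow> simple_graph V E \<and> induces_connected V E \<and> (\<nexists>xs. is_cycle E xs)"


section \<open>Treewidth and layered treewidth\<close>

definition tree_decomposition ::
    "'a set \<Rightarrow> 'a set set \<Rightarrow> 'b set \<Rightarrow> 'b set set \<Rightarrow> ('b \<Rightarrow> 'a set) \<Rightarrow> bool" where
  "tree_decomposition V E N F B \<longleftrightarrow>
     is_tree N F \<and>
     (\<forall>x\<in>N. B x \<subseteq> V) \<and>
     (\<forall>e\<in>E. \<exists>x\<in>N. e \<subseteq> B x) \<and>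
     (\<forall>v\<in>V. induces_connected {x\<in>N. v \<in> B x} F)"

definition decomposition_width :: "'b set \<Rightarrow> ('b \<Rightarrow> 'a set) \<Rightarrow> int" where
  "decomposition_width N B = int (Max ((\<lambda>x. card (B x)) ` N)) - 1"

text \<open>
  Trees are finite, so it suffices to consider decompositions indexed by trees on natural numbers.
  The infimum below is attained, as the widths are integers bounded below by \<open>-1\<close>.
\<close>

definition treewidth :: "'a set \<Rightarrow> 'a set set \<Rightarrow> int" where
  "treewidth V E =
     Inf {decomposition_width N B | (N :: nat set) F B. tree_decomposition V E N F B}"

text \<open>Layers are allowed to be empty; deleting empty layers from a layering gives a layering.\<close>

definition layering :: "'a set \<Rightarrow> 'a set set \<Rightarrow> nat \<Rightarrow> (nat \<Rightarrow> 'a set) \<Rightarrow> bool" where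
  "layering V E t L \<longleftrightarrow>
     (\<Union>i\<le>t. L i) = V \<and> disjoint_family_on L {..t} \<and>
     (\<forall>v w i j. {v, w} \<in> E \<longrightarrow> i \<le> t \<longrightarrow> j \<le> t \<longrightarrow> v \<in> L i \<longrightarrow> w \<in> L j \<longrightarrow>
        \<bar>int i - int j\<bar> \<le> 1)"

definition layered_width ::
    "'a set \<Rightarrow> 'a set set \<Rightarrow> 'b set \<Rightarrow> ('b \<Rightarrow> 'a set) \<Rightarrow> nat" where
  "layered_width V E N B =
     (LEAST l. \<exists>t L. layering V E t L \<and> (\<forall>x\<in>N. \<forall>i\<le>t. card (B x \<inter> L i) \<le> l))"

definition layered_treewidth :: "'a set \<Rightarrow> 'a set set \<Rightarrow> nat" where
  "layered_treewidth V E =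
     Inf {layered_width V E N B | (N :: nat set) F B. tree_decomposition V E N F B}"


section \<open>Surfaces and Euler genus\<close>

definition quotient_topology :: "'a topology \<Rightarrow> ('a \<times> 'a) set \<Rightarrow> 'a set topology" where
  "quotient_topology X r =
     topology (\<lambda>U. U \<subseteq> topspace X // r \<and> openin X {x \<in> topspace X. r `` {x} \<in> U})"

text \<open>
  The sphere is the one-point compactification of the complex plane.  From it we remove the open
  unit discs around \<open>0, 4, \<dots>, 4 (m - 1)\<close>, whose closures are pairwise disjoint.
\<close>

definition hole_centre :: "nat \<Rightarrow> complex" where
  "hole_centre i = of_nat (4 * i)"

definition holed_sphere :: "nat \<Rightarrow> complex option topology" where
  "holed_sphere m =
     subtopology (Alexandroff_compactification euclidean)
       (- (\<Union>i<m. Some ` ball (hole_centre i) 1))"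

text \<open>
  A handle is attached by gluing together the boundary circles of two holes.  Both circles inherit
  the same sense of rotation from the plane, so the gluing map has to reverse it for the result to
  be orientable; hence the complex conjugate (without it, one would obtain a twisted handle).
\<close>

definition handle_rel :: "nat \<Rightarrow> (complex option \<times> complex option) set" where
  "handle_rel h =
     {(p, q). p \<in> topspace (holed_sphere (2 * h)) \<and> q \<in> topspace (holed_sphere (2 * h)) \<and>
        (p = q \<or>
         (\<exists>i<h. \<exists>z. cmod z = 1 \<and>
            {p, q} = {Some (hole_centre (2 * i) + z), Some (hole_centre (2 * i + 1) + cnj z)}))}"

definition sphere_with_handles :: "nat \<Rightarrow> complex option set topology" where
  "sphere_with_handles h = quotient_topology (holed_sphere (2 * h)) (handle_rel h)"

text \<open>
  A cross-cap is attached by identifying antipodal points of the boundary circle of one hole.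
\<close>

definition crosscap_rel :: "nat \<Rightarrow> (complex option \<times> complex option) set" where
  "crosscap_rel c =
     {(p, q). p \<in> topspace (holed_sphere c) \<and> q \<in> topspace (holed_sphere c) \<and>
        (p = q \<or>
         (\<exists>i<c. \<exists>z. cmod z = 1 \<and>
            {p, q} = {Some (hole_centre i + z), Some (hole_centre i - z)}))}"

definition sphere_with_crosscaps :: "nat \<Rightarrow> complex option set topology" where
  "sphere_with_crosscaps c = quotient_topology (holed_sphere c) (crosscap_rel c)"

definition surface_of_euler_genus :: "'a topology \<Rightarrow> nat \<Rightarrow> bool" where
  "surface_of_euler_genus X g \<longleftrightarrow>
     (\<exists>h. g = 2 * h \<and> X homeomorphic_space sphere_with_handles h) \<or>
     (\<exists>c\<ge>1. g = c \<and> X homeomorphic_space sphere_with_crosscaps c)"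


section \<open>Drawings with few crossings per edge\<close>

text \<open>
  Vertices are distinct points, and an edge is a simple curve joining its two ends whose interior
  contains no vertex; no interior point lies on three edges.
\<close>

definition drawing ::
    "'s topology \<Rightarrow> 'a set \<Rightarrow> 'a set set \<Rightarrow> ('a \<Rightarrow> 's) \<Rightarrow> ('a set \<Rightarrow> real \<Rightarrow> 's) \<Rightarrow> bool" where
  "drawing X V E pos \<gamma> \<longleftrightarrow>
     pos ` V \<subseteq> topspace X \<and> inj_on pos V \<and>
     (\<forall>e\<in>E. pathin X (\<gamma> e) \<and> inj_on (\<gamma> e) {0..1} \<and> {\<gamma> e 0, \<gamma> e 1} = pos ` e \<and>
        \<gamma> e ` {0<..<1} \<inter> pos ` V = {}) \<and>
     (\<forall>e1\<in>E. \<forall>e2\<in>E. \<forall>e3\<in>E. distinct [e1, e2, e3] \<longrightarrow>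
        \<gamma> e1 ` {0<..<1} \<inter> \<gamma> e2 ` {0<..<1} \<inter> \<gamma> e3 ` {0<..<1} = {})"

text \<open>
  Every common interior point of two edges counts as a crossing.  Points where two edges merely
  touch are thus counted too; they can be removed by a local perturbation.
\<close>

definition crossings :: "'a set set \<Rightarrow> ('a set \<Rightarrow> real \<Rightarrow> 's) \<Rightarrow> 'a set \<Rightarrow> 's set" where
  "crossings E \<gamma> e = {p \<in> \<gamma> e ` {0<..<1}. \<exists>f\<in>E - {e}. p \<in> \<gamma> f ` {0<..<1}}"

text \<open>
  Every surface has a homeomorphic copy on the point type \<^typ>\<open>complex option set\<close>, so fixing this
  type is no restriction.
\<close>

definition gk_planar :: "nat \<Rightarrow> nat \<Rightarrow> 'a set \<Rightarrow> 'a set set \<Rightarrow> bool" where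
  "gk_planar g k V E \<longleftrightarrow>
     simple_graph V E \<and>
     (\<exists>(X :: complex option set topology) g' pos \<gamma>.
        surface_of_euler_genus X g' \<and> g' \<le> g \<and> drawing X V E pos \<gamma> \<and>
        (\<forall>e\<in>E. finite (crossings E \<gamma> e) \<and> card (crossings E \<gamma> e) \<le> k))"


section \<open>Basic facts about the definitions\<close>

lemma openin_quotient_topology:
  "openin (quotient_topology X r) U \<longleftrightarrow>
     U \<subseteq> topspace X // r \<and> openin X {x \<in> topspace X. r `` {x} \<in> U}"
proof -
  let ?P = "\<lambda>U. U \<subseteq> topspace X // r \<and> openin X {x \<in> topspace X. r `` {x} \<in> U}"
  have "istopology ?P"
    unfolding istopology_def
  proof (intro conjI allI impI)
    fix S T assume "?P S" "?P T"
    moreover have "{x \<in> topspace X. r `` {x} \<in> S \<inter> T} =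
        {x \<in> topspace X. r `` {x} \<in> S} \<inter> {x \<in> topspace X. r `` {x} \<in> T}"
      by auto
    ultimately show "S \<inter> T \<subseteq> topspace X // r"
      and "openin X {x \<in> topspace X. r `` {x} \<in> S \<inter> T}"
      by auto
  next
    fix K assume K: "\<forall>S\<in>K. ?P S"
    then show "\<Union>K \<subseteq> topspace X // r" by auto
    have "{x \<in> topspace X. r `` {x} \<in> \<Union>K} = (\<Union>S\<in>K. {x \<in> topspace X. r `` {x} \<in> S})"
      by auto
    then show "openin X {x \<in> topspace X. r `` {x} \<in> \<Union>K}"
      using K by auto
  qed
  then show ?thesis
    by (simp add: quotient_topology_def topology_inverse')
qed

lemma topspace_quotient_topology [simp]: "topspace (quotient_topology X r) = topspace X // r"
proof
  show "topspace (quotient_topology X r) \<subseteq> topspace X // r"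
    using openin_quotient_topology openin_topspace by metis
  have "{x \<in> topspace X. r `` {x} \<in> topspace X // r} = topspace X"
    by (auto simp: quotientI)
  then have "openin (quotient_topology X r) (topspace X // r)"
    by (simp add: openin_quotient_topology)
  then show "topspace X // r \<subseteq> topspace (quotient_topology X r)"
    by (rule openin_subset)
qed

lemma quotient_map_quotient_topology:
  "quotient_map X (quotient_topology X r) (\<lambda>x. r `` {x})"
  unfolding quotient_map_def by (auto simp: openin_quotient_topology quotient_def)

lemma topspace_holed_sphere:
  "topspace (holed_sphere m) = - (\<Union>i<m. Some ` ball (hole_centre i) 1)"
proof -
  have "topspace (Alexandroff_compactification (euclidean :: complex topology)) = UNIV"
    by (simp add: UNIV_option_conv)
  then show ?thesis
    by (simp add: holed_sphere_def topspace_subtopology del: topspace_Alexandroff_compactification)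
qed

lemma hole_centre_dist:
  assumes "i \<noteq> j" shows "dist (hole_centre i) (hole_centre j) \<ge> 4"
proof -
  have "hole_centre i - hole_centre j = of_real (4 * real_of_int (int i - int j))"
    by (simp add: hole_centre_def)
  then have "dist (hole_centre i) (hole_centre j) = \<bar>4 * real_of_int (int i - int j)\<bar>"
    by (simp only: dist_norm norm_of_real)
  moreover have "\<bar>int i - int j\<bar> \<ge> 1"
    using assms by linarith
  then have "\<bar>real_of_int (int i - int j)\<bar> \<ge> 1"
    by linarith
  ultimately show ?thesis by (simp only: abs_mult) simp
qed

lemma hole_boundaries_disjoint:
  assumes "hole_centre i + z = hole_centre j + w" "cmod z = 1" "cmod w = 1"
  shows "i = j \<and> z = w"
proof (cases "i = j")
  case False
  have "hole_centre i - hole_centre j = w - z"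
    using assms(1) by (simp add: algebra_simps)
  then have "dist (hole_centre i) (hole_centre j) \<le> 2"
    using assms norm_triangle_ineq4[of w z] by (simp add: dist_norm)
  with hole_centre_dist[OF False] show ?thesis by linarith
qed (use assms in auto)

lemma equiv_handle_rel: "equiv (topspace (holed_sphere (2 * h))) (handle_rel h)"
proof (rule equivI)
  show "handle_rel h \<subseteq> topspace (holed_sphere (2 * h)) \<times> topspace (holed_sphere (2 * h))"
    by (auto simp: handle_rel_def)
  show "refl_on (topspace (holed_sphere (2 * h))) (handle_rel h)"
    by (auto simp: refl_on_def handle_rel_def)
  show "sym (handle_rel h)"
    by (auto simp: sym_def handle_rel_def doubleton_eq_iff; blast)
  show "trans (handle_rel h)"
  proof (rule transI)
    have shared: "i = j \<and> z = w"
      if "cmod z = 1" "cmod w = 1"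
        "{Some (hole_centre (2 * i) + z), Some (hole_centre (2 * i + 1) + cnj z)} \<inter>
         {Some (hole_centre (2 * j) + w), Some (hole_centre (2 * j + 1) + cnj w)} \<noteq> {}"
      for i j z w
    proof -
      have parity: "2 * i \<noteq> 2 * j + 1" "2 * i + 1 \<noteq> 2 * j" by presburger+
      have "hole_centre (2 * i) + z = hole_centre (2 * j) + w \<or>
          hole_centre (2 * i) + z = hole_centre (2 * j + 1) + cnj w \<or>
          hole_centre (2 * i + 1) + cnj z = hole_centre (2 * j) + w \<or>
          hole_centre (2 * i + 1) + cnj z = hole_centre (2 * j + 1) + cnj w"
        using that(3) by (simp add: Int_insert_left split: if_splits) (elim disjE; simp)
      moreover have "cmod (cnj z) = 1" "cmod (cnj w) = 1"
        using that(1,2) by simp_all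
      moreover have "z = w" if "cnj z = cnj w" using that by simp
      ultimately show ?thesis
        using that(1,2) parity hole_boundaries_disjoint
        by (metis add_right_cancel mult_cancel1 zero_neq_numeral)
    qed
    fix p q s assume *: "(p, q) \<in> handle_rel h" "(q, s) \<in> handle_rel h"
    show "(p, s) \<in> handle_rel h"
    proof (cases "p = q \<or> q = s")
      case True then show ?thesis using * by auto
    next
      case False
      then obtain i z j w where
        1: "cmod z = 1" "{p, q} = {Some (hole_centre (2 * i) + z), Some (hole_centre (2 * i + 1) + cnj z)}"
        and 2: "cmod w = 1" "{q, s} = {Some (hole_centre (2 * j) + w), Some (hole_centre (2 * j + 1) + cnj w)}"
        using * unfolding handle_rel_def by auto
      have "q \<in> {p, q} \<inter> {q, s}" by simp
      then have "i = j \<and> z = w"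
        using shared[OF 1(1) 2(1)] unfolding 1(2) 2(2) by blast
      then have "{p, q} = {q, s}" using 1 2 by simp
      then have "p = s" by (auto simp: doubleton_eq_iff)
      then show ?thesis using * by (auto simp: handle_rel_def)
    qed
  qed
qed

lemma equiv_crosscap_rel: "equiv (topspace (holed_sphere c)) (crosscap_rel c)"
proof (rule equivI)
  show "crosscap_rel c \<subseteq> topspace (holed_sphere c) \<times> topspace (holed_sphere c)"
    by (auto simp: crosscap_rel_def)
  show "refl_on (topspace (holed_sphere c)) (crosscap_rel c)"
    by (auto simp: refl_on_def crosscap_rel_def)
  show "sym (crosscap_rel c)"
    by (auto simp: sym_def crosscap_rel_def doubleton_eq_iff; blast)
  show "trans (crosscap_rel c)"
  proof (rule transI)
    have shared: "i = j \<and> (z = w \<or> z = - w)"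
      if "cmod z = 1" "cmod w = 1"
        "{Some (hole_centre i + z), Some (hole_centre i - z)} \<inter>
         {Some (hole_centre j + w), Some (hole_centre j - w)} \<noteq> {}"
      for i j z w
    proof -
      have "hole_centre i + z = hole_centre j + w \<or>
          hole_centre i + z = hole_centre j + (- w) \<or>
          hole_centre i + (- z) = hole_centre j + w \<or>
          hole_centre i + (- z) = hole_centre j + (- w)"
        using that(3) by (simp add: Int_insert_left split: if_splits) (elim disjE; simp)
      moreover have "cmod (- z) = 1" "cmod (- w) = 1"
        using that(1,2) by simp_all
      ultimately show ?thesis
        using that(1,2) hole_boundaries_disjoint by (metis minus_minus)
    qed
    fix p q s assume *: "(p, q) \<in> crosscap_rel c" "(q, s) \<in> crosscap_rel c"
    show "(p, s) \<in> crosscap_rel c"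
    proof (cases "p = q \<or> q = s")
      case True then show ?thesis using * by auto
    next
      case False
      then obtain i z j w where
        1: "cmod z = 1" "{p, q} = {Some (hole_centre i + z), Some (hole_centre i - z)}"
        and 2: "cmod w = 1" "{q, s} = {Some (hole_centre j + w), Some (hole_centre j - w)}"
        using * unfolding crosscap_rel_def by auto
      have "q \<in> {p, q} \<inter> {q, s}" by simp
      then have "i = j \<and> (z = w \<or> z = - w)"
        using shared[OF 1(1) 2(1)] unfolding 1(2) 2(2) by blast
      then have "{p, q} = {q, s}"
        unfolding 1(2) 2(2) by (elim conjE disjE) (simp_all add: insert_commute)
      then have "p = s" by (auto simp: doubleton_eq_iff)
      then show ?thesis using * by (auto simp: crosscap_rel_def)
    qed
  qed
qed

lemma tree_decomposition_single_bag:
  assumes "simple_graph V E"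
  shows "tree_decomposition V E {x} {} (\<lambda>_. V)"
proof -
  have ind: "induces_connected {x} {}"
    by (simp add: induces_connected_def)
  have "\<not> is_cycle {} xs" for xs :: "'b list"
    unfolding is_cycle_def by (cases xs) auto
  then have "is_tree {x} {}"
    using ind by (simp add: is_tree_def simple_graph_def)
  moreover have "{y \<in> {x}. v \<in> V} = {x}" if "v \<in> V" for v
    using that by simp
  ultimately show ?thesis
    using assms ind by (simp add: tree_decomposition_def simple_graph_def)
qed

lemma treewidth_attained:
  assumes "simple_graph V E"
  shows "\<exists>(N :: nat set) F B. tree_decomposition V E N F B \<and> treewidth V E = decomposition_width N B"
proof -
  define W where
    "W = {decomposition_width N B | (N :: nat set) F B. tree_decomposition V E N F B}"
  have "decomposition_width {0 :: nat} (\<lambda>_. V) \<in> W"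
    unfolding W_def using tree_decomposition_single_bag[OF assms, of "0 :: nat"] by blast
  then have "W \<noteq> {}"
    by blast
  then obtain w where w: "w \<in> W" "w < Inf W + 1"
    using cInf_lessD[of W "Inf W + 1"] by auto
  have "bdd_below W"
    by (rule bdd_belowI[of _ "-1"]) (auto simp: W_def decomposition_width_def)
  then have "Inf W \<le> w"
    by (rule cInf_lower[OF w(1)])
  then have "Inf W = w"
    using w(2) by linarith
  then have "treewidth V E = w"
    by (simp only: treewidth_def W_def)
  then show ?thesis
    using w(1) unfolding W_def by blast
qed

end

theory Submission
  imports Defs
begin

text \<open>
  The graph is drawn as \<open>N\<close> strands of \<open>Q\<close> parallel lines (the rows), crossed by short vertical columns.
  A cross-cap through which an interval of strands is sent reverses the order of that interval without
  creating crossings, so a single cross-cap makes any two given strands adjacent; a block of \<open>Q\<close> columns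
  then joins these two strands.  Hence \<open>c \<le> g\<close> cross-caps suffice to join the strands along an arbitrary graph
  with \<open>N\<close> vertices and \<open>c\<close> edges, and for \<open>c\<close> of order \<open>N\<close> this graph can be chosen to be an expander.
  Inside a block only one in \<open>m\<close> of the intersections of rows and columns is a vertex, where \<open>m\<close> is of order \<open>k\<close>,
  so an edge has at most \<open>k\<close> crossings, there are \<open>n = O (N Q\<^sup>2 / m)\<close> vertices, and the intersections can be
  chosen such that all large sets of rows of a block remain connected through its columns.  Deleting \<open>\<epsilon> N Q\<close> vertices destroys
  at most \<open>\<epsilon> N Q\<close> rows and columns, and then more than half of the rows still belong to one connected
  subgraph.  These subgraphs form a haven, which gives treewidth at least
  \<open>\<epsilon> N Q\<close>, of order \<open>sqrt ((g + 1) (k + 1) n)\<close>.  The bound on the layered treewidth follows, since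
  treewidth is \<open>O (sqrt (\<ell> n))\<close> for graphs of layered treewidth \<open>\<ell>\<close>; that argument is carried out directly for havens.
\<close>

section \<open>Trees and havens\<close>

text \<open>With a vertex at every intersection, about \<open>N * Q^2\<close> vertices would carry a
  haven of order \<open>N * Q\<close>, that is \<open>sqrt (N * n)\<close>; the factor
  \<open>k + 1\<close> is gained by thinning the vertices by \<open>m\<close> without lowering that
  order. The obstacle is that a regular thinning disconnects: if column \<open>t\<close> met the
  rows of residue \<open>t mod m\<close> in every band, a block would fall into \<open>m\<close>
  unrelated grids. Shifting the pattern of the odd bands from window to window cures this, since
  every even residue then meets every odd residue in \<open>r = q / m\<close> columns. Rows of equal
  parity and different residues still share no column, which is why the argument inside a block has
  to control both parities. Cross-caps are preferred to handles because they are available for odd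
  Euler genus too. All curves are given by coordinates in the plane, with one canonical
  representative for each pair of identified points, so that injectivity and disjointness on the
  quotient become statements about real numbers. The constants are not optimized;
  \<open>1 / 2 ^ 60\<close> absorbs the losses of all steps.\<close>

lemma tree_has_leaf:
  assumes "is_tree N F" "card N \<ge> 2"
  obtains x y where "x \<in> N" "y \<in> N" "x \<noteq> y" "{x, y} \<in> F" "\<And>z. {x, z} \<in> F \<Longrightarrow> z = y"
proof -
  define path where "path xs \<longleftrightarrow> distinct xs \<and> xs \<noteq> [] \<and> set xs \<subseteq> N \<and>
    (\<forall>i. Suc i < length xs \<longrightarrow> {xs ! i, xs ! Suc i} \<in> F)" for xs
  have fin: "finite N" and edge: "\<And>e. e \<in> F \<Longrightarrow> e \<subseteq> N \<and> card e = 2"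
    and conn: "induces_connected N F" and acyclic: "\<And>xs. \<not> is_cycle F xs"
    using assms unfolding is_tree_def simple_graph_def by blast+
  have noloop: "a \<noteq> b" if "{a, b} \<in> F" for a b
    using edge[OF that] by auto
  obtain u v where uv: "u \<in> N" "v \<in> N" "u \<noteq> v"
    using assms(2) by (metis card_le_Suc0_iff_eq fin not_less_eq_eq numeral_2_eq_2)
  then have "(u, v) \<in> {(x, y). x \<in> N \<and> y \<in> N \<and> {x, y} \<in> F}\<^sup>*"
    using conn by (auto simp: induces_connected_def)
  then obtain w where w: "w \<in> N" "{u, w} \<in> F"
    using uv by (cases rule: converse_rtranclE) auto
  have "path [u, w]"
    using uv w noloop[OF w(2)] by (auto simp: path_def less_Suc_eq)
  moreover have "\<forall>xs. path xs \<longrightarrow> length xs < Suc (card N)"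
    by (auto simp: path_def less_Suc_eq_le) (metis card_mono distinct_card fin)
  ultimately obtain xs where xs: "path xs" "\<And>ys. path ys \<Longrightarrow> length ys \<le> length xs"
    using ex_has_greatest_nat[of path "[u, w]" length "Suc (card N)"] by auto
  have len: "length xs \<ge> 2"
    using xs(2)[OF \<open>path [u, w]\<close>] by simp
  then obtain x y zs where xs_eq: "xs = x # y # zs"
    by (cases xs; cases "tl xs") auto
  have xy: "{x, y} \<in> F"
    using xs(1) xs_eq by (auto simp: path_def)
  \<comment> \<open>\<open>x\<close> ends a longest path: a neighbour off the path would prolong it,
    and one at position \<open>j \<ge> 2\<close> would close a cycle with the first
    \<open>j + 1\<close> vertices.\<close>
  have "z = y" if z: "{x, z} \<in> F" for z
  proof (rule ccontr)
    assume "z \<noteq> y"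
    have "z \<in> N" "z \<noteq> x" using edge[OF z] noloop[OF z] by auto
    show False
    proof (cases "z \<in> set xs")
      case False
      have "path (z # xs)"
        using xs(1) False \<open>z \<in> N\<close> z unfolding path_def
        by (auto simp: xs_eq nth_Cons insert_commute split: nat.splits)
      then show False using xs(2)[of "z # xs"] by simp
    next
      case True
      then obtain j where j: "j < length xs" "xs ! j = z"
        by (auto simp: in_set_conv_nth)
      have "j \<noteq> 0" "j \<noteq> 1"
        using j \<open>z \<noteq> x\<close> \<open>z \<noteq> y\<close> xs_eq by (auto intro: ccontr)
      then have "j \<ge> 2" by simp
      have "is_cycle F (take (Suc j) xs)"
        unfolding is_cycle_def
      proof (intro conjI allI impI)
        show "3 \<le> length (take (Suc j) xs)" using j \<open>j \<ge> 2\<close> by simp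
        show "distinct (take (Suc j) xs)" using xs(1) by (simp add: path_def)
        fix i assume i: "i < length (take (Suc j) xs)"
        have l: "length (take (Suc j) xs) = Suc j" using j by simp
        show "{take (Suc j) xs ! i, take (Suc j) xs ! (Suc i mod length (take (Suc j) xs))} \<in> F"
        proof (cases "i = j")
          case True
          have "take (Suc j) xs ! j = z" "take (Suc j) xs ! 0 = x" using j xs_eq by (simp_all only: nth_take lessI zero_less_Suc nth_Cons_0)
          then show ?thesis using True z unfolding l by (simp add: insert_commute del: take_Suc_Cons)
        next
          case False
          then have "i < j" using i l by simp
          then show ?thesis using xs(1) j by (simp add: l path_def)
        qed
      qed
      then show False using acyclic by blast
    qed
  qed
  moreover have "x \<in> N" "y \<in> N" using edge[OF xy] by auto
  ultimately show ?thesis using that xy noloop[OF xy] by blast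
qed

text \<open>A walk between other vertices enters and leaves the leaf \<open>x\<close> through
  \<open>y\<close>, so its visits to \<open>x\<close> can be cut out.\<close>

lemma induces_connected_remove_leaf:
  assumes conn: "induces_connected S F" and ne: "S \<noteq> {x}"
    and leaf: "\<And>z. {x, z} \<in> F \<Longrightarrow> z = y"
  shows "induces_connected (S - {x}) {e \<in> F. x \<notin> e}"
proof -
  let ?r = "{(a, b). a \<in> S \<and> b \<in> S \<and> {a, b} \<in> F}"
  let ?r' = "{(a, b). a \<in> S - {x} \<and> b \<in> S - {x} \<and> {a, b} \<in> {e \<in> F. x \<notin> e}}"
  \<comment> \<open>The second conjunct covers the moment when the walk stands on \<open>x\<close>:
    the shortened walk then waits at \<open>y\<close>.\<close>
  have "(u, b) \<in> ?r\<^sup>* \<Longrightarrow> u \<noteq> x \<Longrightarrow> (b \<noteq> x \<longrightarrow> (u, b) \<in> ?r'\<^sup>*) \<and> (b = x \<longrightarrow> (u, y) \<in> ?r'\<^sup>*)" for u b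
  proof (induction rule: rtrancl_induct)
    case base
    then show ?case by auto
  next
    case (step b c)
    then have bc: "b \<in> S" "c \<in> S" "{b, c} \<in> F" by auto
    consider "b \<noteq> x" "c \<noteq> x" | "b \<noteq> x" "c = x" | "b = x" by blast
    then show ?case
    proof cases
      case 1
      then have "(b, c) \<in> ?r'" using bc by auto
      then show ?thesis using 1 step by (meson rtrancl.rtrancl_into_rtrancl)
    next
      case 2
      then have "b = y" using leaf bc by (simp add: insert_commute)
      then show ?thesis using 2 step by auto
    next
      case 3
      then have "c = y" using leaf bc by auto
      then show ?thesis using 3 step leaf bc by auto
    qed
  qed
  then have "\<forall>u\<in>S - {x}. \<forall>v\<in>S - {x}. (u, v) \<in> ?r'\<^sup>*"
    using conn unfolding induces_connected_def by fastforce
  moreover have "S - {x} \<noteq> {}"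
    using conn ne by (auto simp: induces_connected_def)
  ultimately show ?thesis unfolding induces_connected_def by blast
qed

lemma leaf_neighbour_in_connected:
  assumes "induces_connected S F" "x \<in> S" "S \<noteq> {x}" "\<And>z. {x, z} \<in> F \<Longrightarrow> z = y"
  shows "y \<in> S"
proof -
  obtain v where "v \<in> S" "v \<noteq> x" using assms by auto
  then have "(x, v) \<in> {(a, b). a \<in> S \<and> b \<in> S \<and> {a, b} \<in> F}\<^sup>*"
    using assms by (auto simp: induces_connected_def)
  then show ?thesis
    using \<open>v \<noteq> x\<close> assms(4) by (cases rule: converse_rtranclE) auto
qed

text \<open>Induction on the tree by deleting a leaf \<open>x\<close> with neighbour
  \<open>y\<close>. If \<open>{x}\<close> is a member, \<open>x\<close> works; otherwise every
  member containing \<open>x\<close> also contains \<open>y\<close>, so pairwise intersections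
  survive the deletion.\<close>

lemma subtrees_Helly:
  assumes "is_tree N F" "\<And>S. S \<in> \<C> \<Longrightarrow> S \<subseteq> N \<and> induces_connected S F"
    and "\<And>S T. S \<in> \<C> \<Longrightarrow> T \<in> \<C> \<Longrightarrow> S \<inter> T \<noteq> {}"
  shows "\<exists>x\<in>N. \<forall>S\<in>\<C>. x \<in> S"
  using assms
proof (induction "card N" arbitrary: N F \<C> rule: less_induct)
  case less
  note tree = less.prems(1) and sub = less.prems(2) and meet = less.prems(3)
  have fin: "finite N" and "N \<noteq> {}"
    using tree by (auto simp: is_tree_def simple_graph_def induces_connected_def)
  show ?case
  proof (cases "card N \<ge> 2")
    case False
    then have "card N = 1" using fin \<open>N \<noteq> {}\<close> by (metis One_nat_def Suc_leI card_gt_0_iff le_antisym not_less_eq_eq numeral_2_eq_2)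
    then obtain x where "N = {x}" using card_1_singletonE by blast
    then show ?thesis using sub by (auto simp: induces_connected_def)
  next
    case True
    obtain x y where xy: "x \<in> N" "y \<in> N" "x \<noteq> y" "{x, y} \<in> F" and leaf: "\<And>z. {x, z} \<in> F \<Longrightarrow> z = y"
      using tree_has_leaf[OF tree True] by blast
    show ?thesis
    proof (cases "{x} \<in> \<C>")
      case True
      then show ?thesis using meet[OF True] xy(1) by auto
    next
      case False
      let ?N = "N - {x}" and ?F = "{e \<in> F. x \<notin> e}" and ?C = "(\<lambda>S. S - {x}) ` \<C>"
      have "is_tree ?N ?F"
        unfolding is_tree_def
      proof (intro conjI)
        show "simple_graph ?N ?F"
          using tree by (auto simp: is_tree_def simple_graph_def)
        show "induces_connected ?N ?F"
        proof (rule induces_connected_remove_leaf[OF _ _ leaf])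
          show "induces_connected N F" using tree by (simp add: is_tree_def)
          show "N \<noteq> {x}" using xy by blast
        qed
        show "\<nexists>xs. is_cycle ?F xs"
          using tree unfolding is_tree_def is_cycle_def by blast
      qed
      moreover have "card ?N < card N"
        using xy fin by (meson card_Diff1_less)
      moreover have "S \<subseteq> ?N \<and> induces_connected S ?F" if "S \<in> ?C" for S
        using that sub False induces_connected_remove_leaf[OF _ _ leaf] by fastforce
      moreover have "S \<inter> T \<noteq> {}" if "S \<in> ?C" "T \<in> ?C" for S T
      proof -
        obtain S' T' where ST: "S = S' - {x}" "T = T' - {x}" "S' \<in> \<C>" "T' \<in> \<C>" using \<open>S \<in> ?C\<close> \<open>T \<in> ?C\<close> by blast
        have "y \<in> S'" if "x \<in> S'" "S' \<in> \<C>" for S'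
          by (rule leaf_neighbour_in_connected[of S' F x y]) (use that sub leaf False in auto)
        then show ?thesis using ST meet[OF ST(3,4)] xy(3) by blast
      qed
      ultimately obtain z where "z \<in> ?N" "\<forall>S\<in>?C. z \<in> S"
        using less.hyps[of ?N ?F ?C] by blast
      then show ?thesis by auto
    qed
  qed
qed

text \<open>The nodes whose bags meet a connected set form a subtree, because adjacent vertices
  share a bag; a common vertex of two sets lies in some bag, so these subtrees pairwise intersect
  and the Helly property applies.\<close>

lemma bag_meets_bramble:
  assumes td: "tree_decomposition V E N F B"
    and sub: "\<And>C. C \<in> \<C> \<Longrightarrow> C \<subseteq> V \<and> induces_connected C E"
    and meet: "\<And>C D. C \<in> \<C> \<Longrightarrow> D \<in> \<C> \<Longrightarrow> C \<inter> D \<noteq> {}"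
  shows "\<exists>x\<in>N. \<forall>C\<in>\<C>. B x \<inter> C \<noteq> {}"
proof -
  define T where "T C = {x \<in> N. B x \<inter> C \<noteq> {}}" for C
  have tree: "is_tree N F" and edge: "\<And>e. e \<in> E \<Longrightarrow> \<exists>x\<in>N. e \<subseteq> B x"
    and vert: "\<And>v. v \<in> V \<Longrightarrow> induces_connected {x\<in>N. v \<in> B x} F"
    using td by (auto simp: tree_decomposition_def)
  have "T C \<subseteq> N \<and> induces_connected (T C) F" if C: "C \<in> \<C>" for C
  proof
    show "T C \<subseteq> N" by (auto simp: T_def)
    let ?r = "{(x, y). x \<in> T C \<and> y \<in> T C \<and> {x, y} \<in> F}"
    have same: "(x, z) \<in> ?r\<^sup>*" if "x \<in> N" "z \<in> N" "v \<in> B x" "v \<in> B z" "v \<in> C" for x z v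
    proof -
      have "(x, z) \<in> {(x', y). x' \<in> {x\<in>N. v \<in> B x} \<and> y \<in> {x\<in>N. v \<in> B x} \<and> {x', y} \<in> F}\<^sup>*"
      proof -
        have "v \<in> V" "x \<in> {x\<in>N. v \<in> B x}" "z \<in> {x\<in>N. v \<in> B x}" using sub[OF C] that by auto
        then show ?thesis using vert[of v] unfolding induces_connected_def by blast
      qed
      moreover have "{(x', y). x' \<in> {x\<in>N. v \<in> B x} \<and> y \<in> {x\<in>N. v \<in> B x} \<and> {x', y} \<in> F} \<subseteq> ?r"
        using that by (auto simp: T_def)
      ultimately show ?thesis using rtrancl_mono by blast
    qed
    have reach: "(v, b) \<in> {(x, y). x \<in> C \<and> y \<in> C \<and> {x, y} \<in> E}\<^sup>* \<Longrightarrow>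
        \<forall>z\<in>N. b \<in> B z \<longrightarrow> (x, z) \<in> ?r\<^sup>*" if "x \<in> N" "v \<in> B x" "v \<in> C" for x v b
    proof (induction rule: rtrancl_induct)
      case base
      then show ?case using same that by blast
    next
      case (step b c)
      then obtain z' where z': "z' \<in> N" "{b, c} \<subseteq> B z'" using edge by blast
      have "(x, z') \<in> ?r\<^sup>*" using step z' by auto
      moreover have "(z', z) \<in> ?r\<^sup>*" if "z \<in> N" "c \<in> B z" for z
        using same[of z' z c] z' that step by auto
      ultimately show ?case by (meson rtrancl_trans)
    qed
    have "(x, z) \<in> ?r\<^sup>*" if "x \<in> T C" "z \<in> T C" for x z
    proof -
      have "x \<in> N" "z \<in> N" "B x \<inter> C \<noteq> {}" "B z \<inter> C \<noteq> {}" using that by (auto simp: T_def)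
      then obtain v w where "v \<in> B x" "v \<in> C" "w \<in> B z" "w \<in> C" "x \<in> N" "z \<in> N"
        by blast
      then show ?thesis
        using reach[of x v w] sub[OF C] by (auto simp: induces_connected_def)
    qed
    moreover have "T C \<noteq> {}"
    proof -
      obtain v where v: "v \<in> C" "v \<in> V" using sub[OF C] by (auto simp: induces_connected_def)
      then obtain x where "x \<in> N" "v \<in> B x" using vert[of v] by (auto simp: induces_connected_def)
      then show ?thesis using v by (auto simp: T_def)
    qed
    ultimately show "induces_connected (T C) F" by (auto simp: induces_connected_def)
  qed
  moreover have "T C \<inter> T D \<noteq> {}" if CD: "C \<in> \<C>" "D \<in> \<C>" for C D
  proof -
    obtain v where v: "v \<in> C" "v \<in> D" using meet[OF CD] by auto
    then have "v \<in> V" using sub CD by blast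
    then obtain x where "x \<in> N" "v \<in> B x"
      using vert[of v] by (auto simp: induces_connected_def)
    then show ?thesis using v by (auto simp: T_def)
  qed
  ultimately have "\<exists>x\<in>N. \<forall>S\<in>T ` \<C>. x \<in> S"
    by (intro subtrees_Helly[OF tree]) blast+
  then show ?thesis by (auto simp: T_def)
qed

text \<open>A variant of the usual haven: \<open>C X\<close> is any connected set avoiding
  \<open>X\<close>, and the values intersect instead of merely touching, so they form a bramble as
  they are.\<close>

definition haven :: "'a set \<Rightarrow> 'a set set \<Rightarrow> nat \<Rightarrow> ('a set \<Rightarrow> 'a set) \<Rightarrow> bool" where
  "haven V E s C \<longleftrightarrow>
     (\<forall>X\<subseteq>V. card X \<le> s \<longrightarrow> C X \<subseteq> V - X \<and> induces_connected (C X) E) \<and>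
     (\<forall>X\<subseteq>V. \<forall>Y\<subseteq>V. card X \<le> s \<longrightarrow> card Y \<le> s \<longrightarrow> C X \<inter> C Y \<noteq> {})"

text \<open>Some bag meets every \<open>C X\<close>. With at most \<open>s\<close> vertices it could
  itself be taken for \<open>X\<close>, which \<open>C X\<close> avoids; so it has more than
  \<open>s\<close>, and this compensates for the \<open>- 1\<close> in the width.\<close>

lemma haven_treewidth:
  assumes G: "simple_graph V E" and hv: "haven V E s C"
  shows "int s \<le> treewidth V E"
proof -
  obtain N :: "nat set" and F B where td: "tree_decomposition V E N F B"
    and tw: "treewidth V E = decomposition_width N B"
    using treewidth_attained[OF G] by blast
  have "\<exists>x\<in>N. \<forall>D\<in>C ` {X. X \<subseteq> V \<and> card X \<le> s}. B x \<inter> D \<noteq> {}"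
  proof (rule bag_meets_bramble[OF td])
    show "D \<subseteq> V \<and> induces_connected D E" if "D \<in> C ` {X. X \<subseteq> V \<and> card X \<le> s}" for D
      using that hv unfolding haven_def by blast
    show "D1 \<inter> D2 \<noteq> {}" if "D1 \<in> C ` {X. X \<subseteq> V \<and> card X \<le> s}" "D2 \<in> C ` {X. X \<subseteq> V \<and> card X \<le> s}" for D1 D2
      using that hv unfolding haven_def by blast
  qed
  then obtain x where "x \<in> N" and hit: "\<forall>D\<in>C ` {X. X \<subseteq> V \<and> card X \<le> s}. B x \<inter> D \<noteq> {}" ..
  then have x: "x \<in> N" "\<And>X. X \<subseteq> V \<Longrightarrow> card X \<le> s \<Longrightarrow> B x \<inter> C X \<noteq> {}"
    by simp_all
  have "B x \<subseteq> V" and finN: "finite N"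
    using td x by (auto simp: tree_decomposition_def is_tree_def simple_graph_def)
  have "s < card (B x)"
  proof (rule ccontr)
    assume "\<not> s < card (B x)"
    then have "C (B x) \<subseteq> V - B x" "B x \<inter> C (B x) \<noteq> {}"
      using x(2)[OF \<open>B x \<subseteq> V\<close>] hv \<open>B x \<subseteq> V\<close> by (simp_all add: haven_def)
    then show False by blast
  qed
  also have "\<dots> \<le> Max ((\<lambda>x. card (B x)) ` N)"
    using x finN by simp
  finally show ?thesis using tw by (simp add: decomposition_width_def)
qed

section \<open>From havens to layered treewidth\<close>

lemma layered_treewidth_attained:
  assumes "simple_graph V E"
  obtains N :: "nat set" and F B t L where "tree_decomposition V E N F B" "layering V E t L"
    "\<And>x i. x \<in> N \<Longrightarrow> i \<le> t \<Longrightarrow> card (B x \<inter> L i) \<le> layered_treewidth V E"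
proof -
  let ?W = "{layered_width V E N B | (N :: nat set) F B. tree_decomposition V E N F B}"
  have "layered_width V E {0 :: nat} (\<lambda>_. V) \<in> ?W"
    using tree_decomposition_single_bag[OF assms, of "0 :: nat"] by blast
  then have "Inf ?W \<in> ?W" by (intro Inf_nat_def1) blast
  then obtain N :: "nat set" and F B where td: "tree_decomposition V E N F B"
    and lw: "layered_treewidth V E = layered_width V E N B"
    unfolding layered_treewidth_def by blast
  have "layering V E 0 (\<lambda>_. V)"
    by (auto simp: layering_def disjoint_family_on_def)
  moreover have "card (B x \<inter> V) \<le> card V" for x
    using assms by (simp add: simple_graph_def card_mono)
  ultimately have "\<exists>t L. layering V E t L \<and> (\<forall>x\<in>N. \<forall>i\<le>t. card (B x \<inter> L i) \<le> card V)"
    by blast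
  then have "\<exists>t L. layering V E t L \<and> (\<forall>x\<in>N. \<forall>i\<le>t. card (B x \<inter> L i) \<le> layered_width V E N B)"
    unfolding layered_width_def by (rule LeastI[where P = "\<lambda>l. \<exists>t L. layering V E t L \<and> (\<forall>x\<in>N. \<forall>i\<le>t. card (B x \<inter> L i) \<le> l)"])
  then show ?thesis using that td lw by metis
qed

lemma connected_constant:
  assumes "induces_connected C E" "\<And>u v. u \<in> C \<Longrightarrow> v \<in> C \<Longrightarrow> {u, v} \<in> E \<Longrightarrow> f u = f v"
    and "u \<in> C" "v \<in> C"
  shows "f u = f v"
proof -
  have "(u, v) \<in> {(x, y). x \<in> C \<and> y \<in> C \<and> {x, y} \<in> E}\<^sup>*"
    using assms by (auto simp: induces_connected_def)
  then show ?thesis by (induction rule: rtrancl_induct) (use assms(2) in auto)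
qed

lemma small_residue_class:
  fixes f :: "'a \<Rightarrow> nat"
  assumes "finite V" "p > 0"
  obtains \<rho> where "\<rho> < p" "p * card {v \<in> V. f v mod p = \<rho>} \<le> card V"
proof (rule ccontr)
  assume neg: "\<not> thesis"
  then have ex: "\<nexists>\<rho>. \<rho> < p \<and> p * card {v \<in> V. f v mod p = \<rho>} \<le> card V"
    using that by blast
  have *: "card V < p * card {v \<in> V. f v mod p = \<rho>}" if \<rho>: "\<rho> < p" for \<rho>
    using ex \<rho> by (auto simp: not_le)
  have "(\<Union>\<rho><p. {v \<in> V. f v mod p = \<rho>}) = V" using assms by auto
  moreover have "card (\<Union>\<rho><p. {v \<in> V. f v mod p = \<rho>}) = (\<Sum>\<rho><p. card {v \<in> V. f v mod p = \<rho>})"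
    by (rule card_UN_disjoint) (use assms in auto)
  ultimately have "card V = (\<Sum>\<rho><p. card {v \<in> V. f v mod p = \<rho>})" by simp
  then have "p * card V = (\<Sum>\<rho><p. p * card {v \<in> V. f v mod p = \<rho>})"
    by (simp add: sum_distrib_left)
  moreover have "(\<Sum>\<rho><p. p * card {v \<in> V. f v mod p = \<rho>}) > (\<Sum>\<rho><p. card V)"
    using * assms(2) by (intro sum_strict_mono) auto
  ultimately show False by simp
qed

text \<open>
  Deleting every \<open>p\<close>-th layer confines the connected sets of the haven to a band of \<open>p - 1\<close> layers,
  in which each bag has few vertices.
\<close>

lemma haven_layers:
  assumes G: "simple_graph V E" and hv: "haven V E s C" and "p > 0"
  obtains d where "p * d \<le> card V" "s < d + (p - 1) * layered_treewidth V E"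
proof -
  define lw where "lw = layered_treewidth V E"
  obtain N :: "nat set" and F B t L where td: "tree_decomposition V E N F B"
    and lay: "layering V E t L" and small: "\<And>x i. x \<in> N \<Longrightarrow> i \<le> t \<Longrightarrow> card (B x \<inter> L i) \<le> lw"
    using layered_treewidth_attained[OF G] unfolding lw_def by metis
  have finV: "finite V" using G by (simp add: simple_graph_def)
  have "\<exists>i\<le>t. v \<in> L i" if "v \<in> V" for v
    using lay that by (auto simp: layering_def)
  then obtain lev where lev: "\<And>v. v \<in> V \<Longrightarrow> lev v \<le> t \<and> v \<in> L (lev v)"
    by metis
  have lev_edge: "lev u \<le> Suc (lev v)" if "{u, v} \<in> E" "u \<in> V" "v \<in> V" for u v
  proof -
    have "\<bar>int (lev u) - int (lev v)\<bar> \<le> 1"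
      using lay lev[OF that(2)] lev[OF that(3)] that(1) unfolding layering_def by blast
    then show ?thesis by linarith
  qed
  obtain \<rho> where \<rho>: "\<rho> < p" "p * card {v \<in> V. lev v mod p = \<rho>} \<le> card V"
    using small_residue_class[OF finV \<open>p > 0\<close>] by blast
  define S where "S = {v \<in> V. lev v mod p = \<rho>}"
  \<comment> \<open>The shift moves the deleted layers, those of residue \<open>\<rho>\<close>, to
    multiples of \<open>p\<close>, so that \<open>div p\<close> numbers the bands between
    them.\<close>
  define sh where "sh v = lev v + (p - \<rho>)" for v
  define band where "band v = sh v div p" for v
  have finS: "finite S" and SV: "S \<subseteq> V" using finV by (auto simp: S_def)
  have off: "sh v mod p \<noteq> 0" if "v \<in> V - S" for v
  proof
    assume "sh v mod p = 0"
    then have "int p dvd int (lev v) + (int p - int \<rho>)"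
      using \<rho>(1) by (metis dvd_eq_mod_eq_0 int_dvd_int_iff less_imp_le of_nat_add of_nat_diff sh_def)
    then have "int p dvd (int (lev v) + (int p - int \<rho>)) - int p" by (rule dvd_diff) simp
    then have "int p dvd int (lev v) - int \<rho>" by (simp add: algebra_simps)
    then have "int (lev v) mod int p = int \<rho> mod int p" by (simp add: mod_eq_dvd_iff)
    then have "lev v mod p = \<rho>" using \<rho>(1) by (metis mod_less nat_int of_nat_mod)
    then show False using that by (auto simp: S_def)
  qed
  have band_edge: "band u = band v" if "{u, v} \<in> E" "u \<in> V - S" "v \<in> V - S" for u v
  proof -
    have step: "n div p = Suc n div p" if "Suc n mod p \<noteq> 0" for n
      using that by (simp add: div_Suc)
    have "lev u \<le> Suc (lev v)" "lev v \<le> Suc (lev u)"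
      using lev_edge[of u v] lev_edge[of v u] that by (auto simp: insert_commute)
    then have "sh u = sh v \<or> sh u = Suc (sh v) \<or> sh v = Suc (sh u)"
      by (auto simp: sh_def)
    then show ?thesis
      using off that step unfolding band_def by metis
  qed
  have C_band: "band u = band v"
    if "S \<subseteq> X" "X \<subseteq> V" "card X \<le> s" "u \<in> C X" "v \<in> C X" for X u v
  proof (rule connected_constant[of "C X" E])
    have CX: "C X \<subseteq> V - X" and "induces_connected (C X) E" using hv that by (auto simp: haven_def)
    then show "induces_connected (C X) E" by blast
    show "band a = band b" if "a \<in> C X" "b \<in> C X" "{a, b} \<in> E" for a b
      using band_edge CX that \<open>S \<subseteq> X\<close> by blast
  qed (use that in auto)
  have "s < card S + (p - 1) * lw"
  proof (rule ccontr)
    assume neg: "\<not> s < card S + (p - 1) * lw"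
    \<comment> \<open>Only sets \<open>X\<close> that contain all deleted layers are used: for these
      \<open>C X\<close> stays in one band.\<close>
    let ?\<C> = "C ` {X. S \<subseteq> X \<and> X \<subseteq> V \<and> card X \<le> s}"
    have "\<exists>x\<in>N. \<forall>D\<in>?\<C>. B x \<inter> D \<noteq> {}"
    proof (rule bag_meets_bramble[OF td])
      show "D \<subseteq> V \<and> induces_connected D E" if "D \<in> ?\<C>" for D
        using that hv unfolding haven_def by blast
      show "D1 \<inter> D2 \<noteq> {}" if "D1 \<in> ?\<C>" "D2 \<in> ?\<C>" for D1 D2
        using that hv unfolding haven_def by blast
    qed
    then obtain x where "x \<in> N" and hit: "\<forall>D\<in>?\<C>. B x \<inter> D \<noteq> {}" ..
    then have x: "x \<in> N" "\<And>X. S \<subseteq> X \<Longrightarrow> X \<subseteq> V \<Longrightarrow> card X \<le> s \<Longrightarrow> B x \<inter> C X \<noteq> {}"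
      by simp_all
    have "card S \<le> s" using neg by simp
    then have "induces_connected (C S) E" using hv SV by (auto simp: haven_def)
    then obtain v0 where v0: "v0 \<in> C S" by (auto simp: induces_connected_def)
    \<comment> \<open>\<open>C S\<close> selects the band \<open>D\<close>. As \<open>X\<close> adds
      to \<open>S\<close> only the part of the bag inside this band, it still has at most
      \<open>s\<close> vertices. Now \<open>C X\<close> meets \<open>C S\<close>, so it lies in
      \<open>D\<close>; avoiding \<open>X\<close>, it misses the bag.\<close>
    define D where "D = {v \<in> V - S. band v = band v0}"
    define X where "X = S \<union> (B x \<inter> D)"
    have "B x \<inter> D \<subseteq> (\<Union>i\<in>{1..<p}. B x \<inter> L (p * band v0 + i - (p - \<rho>)) \<inter> {v. p * band v0 + i - (p - \<rho>) \<le> t})"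
    proof
      fix v assume v: "v \<in> B x \<inter> D"
      then have vV: "v \<in> V - S" "sh v div p = band v0" by (auto simp: D_def band_def)
      then have "sh v = p * band v0 + sh v mod p" by (metis mult_div_mod_eq)
      moreover have "lev v = sh v - (p - \<rho>)" by (simp add: sh_def)
      ultimately have "lev v = p * band v0 + sh v mod p - (p - \<rho>)" by metis
      moreover have "sh v mod p \<in> {1..<p}" using off[OF vV(1)] \<open>p > 0\<close> by simp
      ultimately show "v \<in> (\<Union>i\<in>{1..<p}. B x \<inter> L (p * band v0 + i - (p - \<rho>)) \<inter> {v. p * band v0 + i - (p - \<rho>) \<le> t})"
        using lev[of v] vV(1) v by (intro UN_I[of "sh v mod p"]) auto
    qed
    moreover have finB: "finite (B x)"
      using td x finV by (auto simp: tree_decomposition_def intro: finite_subset)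
    ultimately have "card (B x \<inter> D) \<le> card (\<Union>i\<in>{1..<p}. B x \<inter> L (p * band v0 + i - (p - \<rho>)) \<inter> {v. p * band v0 + i - (p - \<rho>) \<le> t})"
      by (intro card_mono) auto
    also have "\<dots> \<le> (\<Sum>i\<in>{1..<p}. card (B x \<inter> L (p * band v0 + i - (p - \<rho>)) \<inter> {v. p * band v0 + i - (p - \<rho>) \<le> t}))"
      by (rule card_UN_le) simp
    also have "\<dots> \<le> (\<Sum>i\<in>{1..<p}. lw)"
      by (rule sum_mono) (use small x(1) in \<open>auto simp: Int_def\<close>)
    also have "\<dots> = (p - 1) * lw" by simp
    finally have "card X \<le> s"
      using neg card_Un_le[of S "B x \<inter> D"] by (simp add: X_def)
    moreover have XV: "X \<subseteq> V" "S \<subseteq> X" using SV by (auto simp: X_def D_def)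
    ultimately have CX: "C X \<subseteq> V - X" "C X \<inter> C S \<noteq> {}"
      using hv SV \<open>card S \<le> s\<close> by (auto simp: haven_def)
    then obtain v1 where v1: "v1 \<in> C X" "v1 \<in> C S" by blast
    have "C X \<subseteq> D"
    proof
      fix v assume v: "v \<in> C X"
      have "band v = band v1" using C_band[of X v v1] XV \<open>card X \<le> s\<close> v v1 by blast
      also have "\<dots> = band v0" using C_band[of S v1 v0] SV \<open>card S \<le> s\<close> v0 v1 by blast
      finally show "v \<in> D" using v CX XV by (auto simp: D_def)
    qed
    then have "B x \<inter> C X = {}" using CX by (auto simp: X_def)
    then show False using x(2)[OF XV(2,1) \<open>card X \<le> s\<close>] by blast
  qed
  then show ?thesis using that[of "card S"] \<rho>(2) by (simp add: S_def lw_def)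
qed

lemma haven_layered_treewidth:
  assumes G: "simple_graph V E" and hv: "haven V E s C" and "s > 0"
  shows "real s ^ 2 \<le> 4 * real (card V) * real (layered_treewidth V E)"
proof -
  define n where "n = card V"
  \<comment> \<open>As \<open>p\<close> is at least \<open>2 n / s\<close>, the deleted layers have
    at most \<open>s / 2\<close> vertices, so \<open>s / 2\<close> is less than \<open>p - 1\<close>
    times the layered treewidth, and \<open>p - 1\<close> is at most \<open>2 n / s\<close>.\<close>
  define p where "p = nat \<lceil>2 * real n / real s\<rceil>"
  have "V \<noteq> {}" using hv unfolding haven_def induces_connected_def by force
  then have "n > 0" using G by (auto simp: n_def simple_graph_def card_gt_0_iff)
  then have pos: "2 * real n / real s > 0" using \<open>s > 0\<close> by simp
  then have p: "p > 0" "real p \<ge> 2 * real n / real s" "real p - 1 \<le> 2 * real n / real s"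
    unfolding p_def by linarith+
  obtain d where S: "p * d \<le> n" "s < d + (p - 1) * layered_treewidth V E"
    using haven_layers[OF G hv p(1)] unfolding n_def by blast
  have "real p * real (d) \<le> real n" using S(1) by (metis of_nat_le_iff of_nat_mult)
  moreover have "2 * real n \<le> real p * real s" using p(2) \<open>s > 0\<close> by (simp add: field_simps)
  ultimately have "real p * (2 * real (d)) \<le> real p * real s" by linarith
  then have "2 * real (d) \<le> real s" using p(1) by simp
  moreover have "real s < real (d) + (real p - 1) * real (layered_treewidth V E)"
  proof -
    have "real (d + (p - 1) * layered_treewidth V E) > real s" using S(2) of_nat_less_iff by blast
    moreover have "real (p - 1) = real p - 1" using p(1) by (simp add: of_nat_diff)
    ultimately show ?thesis by simp
  qed
  ultimately have "real s < 2 * ((real p - 1) * real (layered_treewidth V E))" by linarith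
  also have "\<dots> \<le> 2 * (2 * real n / real s * real (layered_treewidth V E))"
    by (intro mult_left_mono mult_right_mono p(3)) auto
  finally have "real s * real s \<le> real s * (2 * (2 * real n / real s * real (layered_treewidth V E)))"
    by (intro mult_left_mono) auto
  also have "\<dots> = 4 * real n * real (layered_treewidth V E)" using \<open>s > 0\<close> by simp
  finally show ?thesis by (simp add: n_def power2_eq_square)
qed

section \<open>Parallel lines on a sphere with cross-caps\<close>

abbreviation surface_point :: "nat \<Rightarrow> complex \<Rightarrow> complex option set" where
  "surface_point c \<zeta> \<equiv> crosscap_rel c `` {Some \<zeta>}"

definition off_holes :: "nat \<Rightarrow> complex set" where
  "off_holes c = {\<zeta>. \<forall>j<c. 1 \<le> cmod (\<zeta> - hole_centre j)}"

text \<open>Of two antipodal points on the boundary of a hole, the left one is the canonical one.\<close>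

definition canonical_points :: "nat \<Rightarrow> complex set" where
  "canonical_points c =
     {\<zeta>. \<forall>j<c. 1 \<le> cmod (\<zeta> - hole_centre j) \<and>
        (cmod (\<zeta> - hole_centre j) = 1 \<longrightarrow> Re \<zeta> < 4 * real j)}"

lemma canonical_off_holes: "canonical_points c \<subseteq> off_holes c"
  by (auto simp: canonical_points_def off_holes_def)

lemma Some_off_holes: "\<zeta> \<in> off_holes c \<longleftrightarrow> Some \<zeta> \<in> topspace (holed_sphere c)"
  by (auto simp: topspace_holed_sphere off_holes_def dist_norm norm_minus_commute image_iff simp flip: not_less)

lemma hole_centre_eq: "hole_centre j = complex_of_real (4 * real j)"
  by (simp add: hole_centre_def)

lemma surface_point_in_topspace:
  "\<zeta> \<in> off_holes c \<Longrightarrow> surface_point c \<zeta> \<in> topspace (sphere_with_crosscaps c)"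
  by (simp add: sphere_with_crosscaps_def Some_off_holes quotientI)

lemma continuous_map_surface_point:
  assumes "continuous_on S f" "f ` S \<subseteq> off_holes c"
  shows "continuous_map (top_of_set S) (sphere_with_crosscaps c) (\<lambda>x. surface_point c (f x))"
proof -
  have "continuous_map (top_of_set S) euclidean f"
    using assms(1) by simp
  then have "continuous_map (top_of_set S) (Alexandroff_compactification euclidean) (Some \<circ> f)"
    by (rule continuous_map_compose[OF _ continuous_map_Some])
  moreover have "(Some \<circ> f) ` S \<subseteq> topspace (holed_sphere c)"
    using assms(2) Some_off_holes by auto
  ultimately have "continuous_map (top_of_set S) (holed_sphere c) (Some \<circ> f)"
    unfolding topspace_holed_sphere unfolding holed_sphere_def
    by (intro continuous_map_into_subtopology) (simp_all add: image_subset_iff Pi_iff)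
  then have "continuous_map (top_of_set S) (sphere_with_crosscaps c) ((\<lambda>p. crosscap_rel c `` {p}) \<circ> (Some \<circ> f))"
    unfolding sphere_with_crosscaps_def
    by (rule continuous_map_compose)
      (rule quotient_imp_continuous_map[OF quotient_map_quotient_topology])
  then show ?thesis by (simp add: comp_def)
qed

lemma surface_point_antipodal:
  assumes "j < c" "cmod z = 1"
  shows "surface_point c (hole_centre j + z) = surface_point c (hole_centre j - z)"
proof -
  have "hole_centre j + z' \<in> off_holes c" if z': "cmod z' = 1" for z'
    unfolding off_holes_def
  proof (clarsimp)
    fix i assume "i < c"
    show "1 \<le> cmod (hole_centre j + z' - hole_centre i)"
    proof (cases "i = j")
      case False
      then have "4 \<le> cmod (hole_centre j - hole_centre i)"
        using hole_centre_dist[of j i] by (simp add: dist_norm)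
      also have "hole_centre j - hole_centre i = (hole_centre j + z' - hole_centre i) - z'" by simp
      finally show ?thesis
        using norm_triangle_ineq4[of "hole_centre j + z' - hole_centre i" z'] z' by linarith
    qed (use z' in simp)
  qed
  from this[of z] this[of "- z"] assms(2)
  have "(Some (hole_centre j + z), Some (hole_centre j - z)) \<in> crosscap_rel c"
    unfolding crosscap_rel_def using assms by (auto simp: Some_off_holes)
  then show ?thesis
    using equiv_class_eq[OF equiv_crosscap_rel] by blast
qed

text \<open>Two distinct identified points are antipodal on a boundary circle, so their real parts
  have mean \<open>4 * j\<close> and cannot both be smaller. Distinctness on the surface thereby
  reduces to distinctness in the plane.\<close>

lemma inj_on_surface_point: "inj_on (surface_point c) (canonical_points c)"
proof (rule inj_onI)
  fix \<zeta> \<xi> assume *: "\<zeta> \<in> canonical_points c" "\<xi> \<in> canonical_points c"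
    and eq: "surface_point c \<zeta> = surface_point c \<xi>"
  have "Some \<xi> \<in> topspace (holed_sphere c)"
    using * canonical_off_holes Some_off_holes by blast
  then have "(Some \<zeta>, Some \<xi>) \<in> crosscap_rel c"
    using eq_equiv_class[OF eq equiv_crosscap_rel] by blast
  moreover have False
    if "j < c" "cmod z = 1" "{Some \<zeta>, Some \<xi>} = {Some (hole_centre j + z), Some (hole_centre j - z)}" for j z
  proof -
    have **: "\<zeta> = hole_centre j + z \<and> \<xi> = hole_centre j - z \<or> \<zeta> = hole_centre j - z \<and> \<xi> = hole_centre j + z"
      using that(3) by (auto simp: doubleton_eq_iff)
    then have "cmod (\<zeta> - hole_centre j) = 1" "cmod (\<xi> - hole_centre j) = 1"
      using that(2) by auto
    then have "Re \<zeta> < 4 * real j" "Re \<xi> < 4 * real j"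
      using * that(1) by (auto simp: canonical_points_def)
    then show False using ** by (auto simp: hole_centre_eq)
  qed
  ultimately show "\<zeta> = \<xi>" unfolding crosscap_rel_def by blast
qed

section \<open>Coordinates of a line between two holes\<close>

lemma cmod_ge_1_iff: "1 \<le> cmod (\<zeta> - hole_centre j) \<longleftrightarrow> 1 \<le> (Re \<zeta> - 4 * real j)\<^sup>2 + (Im \<zeta>)\<^sup>2"
  by (simp add: cmod_def hole_centre_eq)

lemma cmod_eq_1_iff: "cmod (\<zeta> - hole_centre j) = 1 \<longleftrightarrow> (Re \<zeta> - 4 * real j)\<^sup>2 + (Im \<zeta>)\<^sup>2 = 1"
  by (simp add: cmod_def hole_centre_eq)

text \<open>Moves \<open>0\<close> to \<open>w\<close>, fixes everything from \<open>3 / 2\<close>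
  on and has slope at least \<open>1 / 3\<close> for \<open>0 \<le> w \<le> 1\<close>. Measured from
  the centre of a hole, it pushes the end of a line out to the boundary circle.\<close>

definition stretch :: "real \<Rightarrow> real \<Rightarrow> real" where
  "stretch w u = u + w * max 0 (1 - 2 * u / 3)"

lemma stretch_strict_mono:
  assumes "0 \<le> w" "w \<le> 1" "u < v"
  shows "stretch w u < stretch w v"
proof -
  have "max 0 (1 - 2 * u / 3) - max 0 (1 - 2 * v / 3) \<le> 2 / 3 * (v - u)"
    using assms(3) by (simp add: max_def field_simps)
  then have "w * (max 0 (1 - 2 * u / 3) - max 0 (1 - 2 * v / 3)) \<le> w * (2 / 3 * (v - u))"
    using assms(1) by (intro mult_left_mono)
  also have "\<dots> \<le> 1 * (2 / 3 * (v - u))"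
    using assms by (intro mult_right_mono) auto
  also have "\<dots> < v - u" using assms(3) by simp
  finally show ?thesis by (simp add: stretch_def algebra_simps)
qed

lemma stretch_ge_eq: "3 / 2 \<le> u \<Longrightarrow> stretch w u = u"
  by (simp add: stretch_def)

lemma stretch_0 [simp]: "stretch w 0 = w"
  by (simp add: stretch_def)

text \<open>
  In the gap \<open>[4 i - 4, 4 i]\<close> between two holes, the line \<open>l\<close> has position \<open>P i l\<close>.  Close to the hole
  with centre \<open>4 j\<close>, lines are horizontal; exactly those with positions in \<open>[a (j + 1), b (j + 1))\<close> run
  into the hole.  They leave it at the antipodal points, so their order is reversed.
\<close>

locale line_arrangement =
  fixes c L :: nat and a b :: "nat \<Rightarrow> nat" and P :: "nat \<Rightarrow> nat \<Rightarrow> nat"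
  assumes ab: "a j < b j"
    and P_inj: "i \<le> c \<Longrightarrow> inj_on (P i) {..<L}"
    and P_Suc: "i < c \<Longrightarrow> l < L \<Longrightarrow> P (Suc i) l =
      (if P i l \<in> {a (Suc i)..<b (Suc i)} then a (Suc i) + b (Suc i) - 1 - P i l else P i l)"
begin

text \<open>The midpoint \<open>p + 1 / 2\<close> of slot \<open>p\<close>, with
  \<open>[a j, b j]\<close> rescaled to \<open>[-1, 1]\<close>. Midpoints are never sent to
  \<open>1\<close> or \<open>-1\<close>, so no line touches the hole at its top or bottom, and
  reversing the interval becomes a change of sign.\<close>

definition height :: "nat \<Rightarrow> nat \<Rightarrow> real" where
  "height j p = (2 * real p + 1 - real (a j) - real (b j)) / (real (b j) - real (a j))"

text \<open>Half the length of the horizontal chord that the line cuts from the unit disc;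
  \<open>max\<close> yields \<open>0\<close> for a line passing above or below.\<close>

definition chord :: "nat \<Rightarrow> nat \<Rightarrow> real" where
  "chord j p = sqrt (max 0 (1 - (height j p)\<^sup>2))"

lemma height_strict_mono: "p < q \<Longrightarrow> height j p < height j q"
  using ab[of j] by (simp add: height_def divide_strict_right_mono)

lemma height_inside: "\<bar>height j p\<bar> < 1 \<longleftrightarrow> p \<in> {a j..<b j}"
proof -
  have "\<bar>height j p\<bar> < 1 \<longleftrightarrow> \<bar>2 * int p + 1 - int (a j) - int (b j)\<bar> < int (b j) - int (a j)"
    using ab[of j] by (simp add: height_def abs_if field_simps) linarith
  then show ?thesis using ab[of j] by auto
qed

lemma height_not_1: "(height j p)\<^sup>2 \<noteq> 1"
proof
  assume "(height j p)\<^sup>2 = 1"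
  then have "height j p = 1 \<or> height j p = -1" by (simp add: power2_eq_1_iff)
  then have "2 * real p + 1 - real (a j) - real (b j) = real (b j) - real (a j) \<or>
     2 * real p + 1 - real (a j) - real (b j) = - (real (b j) - real (a j))"
    using ab[of j] by (auto simp: height_def field_simps)
  then have "2 * int p + 1 = 2 * int (b j) \<or> 2 * int p + 1 = 2 * int (a j)"
    by linarith
  then show False by presburger
qed

lemma chord_bounds: "0 \<le> chord j p" "chord j p \<le> 1"
  by (auto simp: chord_def)

lemma chord_sq: "(chord j p)\<^sup>2 = max 0 (1 - (height j p)\<^sup>2)"
  by (simp add: chord_def)

lemma chord_outside: "p \<notin> {a j..<b j} \<Longrightarrow> chord j p = 0 \<and> 1 < (height j p)\<^sup>2"
  using height_inside[of j p] height_not_1[of j p] abs_square_less_1[of "height j p"]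
  by (auto simp: chord_def not_less)

lemma chord_height_ge_1: "chord j p \<le> d \<Longrightarrow> 1 \<le> d\<^sup>2 + (height j p)\<^sup>2"
  using power_mono[OF _ chord_bounds(1), of j p d 2] chord_sq[of j p] by linarith

lemma chord_height_gt_1: "chord j p < d \<Longrightarrow> 1 < d\<^sup>2 + (height j p)\<^sup>2"
  using power_strict_mono[OF _ chord_bounds(1), of j p d 2] chord_sq[of j p] by linarith

text \<open>In gap \<open>i\<close> the parameter of every line runs over
  \<open>[4 i - 4, 4 i]\<close>, but the abscissa only from circle to circle. On the middle part
  \<open>[4 i - 5 / 2, 4 i - 3 / 2]\<close>, where the columns stand, the two agree.\<close>

definition xi :: "nat \<Rightarrow> nat \<Rightarrow> real \<Rightarrow> real" where
  "xi i p x = (if x \<le> 4 * real i - 2 then 4 * real i - 4 + stretch (chord i p) (x - (4 * real i - 4))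
     else 4 * real i - stretch (chord (Suc i) p) (4 * real i - x))"

text \<open>Heights are scaled for the left hole near it and for the right hole near that one, with
  interpolation in the middle. The argument is the abscissa, not the parameter, so that at every
  abscissa the lines appear in the order of their positions.\<close>

definition eta :: "nat \<Rightarrow> nat \<Rightarrow> real \<Rightarrow> real" where
  "eta i p u = height i p + (height (Suc i) p - height i p) * max 0 (min 1 (u - (4 * real i - 5 / 2)))"

definition rep :: "nat \<Rightarrow> nat \<Rightarrow> real \<Rightarrow> complex" where
  "rep i p x = Complex (xi i p x) (eta i p (xi i p x))"

lemma xi_left: "x \<le> 4 * real i - 3 / 2 \<Longrightarrow> xi i p x = 4 * real i - 4 + stretch (chord i p) (x - (4 * real i - 4))"
  and xi_right: "4 * real i - 5 / 2 \<le> x \<Longrightarrow> xi i p x = 4 * real i - stretch (chord (Suc i) p) (4 * real i - x)"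
  by (simp_all add: xi_def stretch_ge_eq)

lemma xi_middle: "4 * real i - 5 / 2 \<le> x \<Longrightarrow> x \<le> 4 * real i - 3 / 2 \<Longrightarrow> xi i p x = x"
  by (simp add: xi_left stretch_ge_eq)

lemma xi_strict_mono:
  assumes "x < y"
  shows "xi i p x < xi i p y"
proof -
  let ?m = "4 * real i - 2"
  have left: "xi i p u < xi i p v" if "u < v" "v \<le> ?m" for u v
    using that stretch_strict_mono[OF chord_bounds, of "u - (4 * real i - 4)" "v - (4 * real i - 4)" i p]
    by (simp add: xi_left)
  have right: "xi i p u < xi i p v" if "u < v" "?m \<le> u" for u v
    using that stretch_strict_mono[OF chord_bounds, of "4 * real i - v" "4 * real i - u" "Suc i" p]
    by (simp add: xi_right)
  show ?thesis
    using left[of x y] right[of x y] left[of x ?m] right[of ?m y] assms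
    by (cases "y \<le> ?m"; cases "?m \<le> x") (auto simp: not_le intro: less_trans)
qed

lemma xi_inj: "xi i p x = xi i p y \<longleftrightarrow> x = y"
  using xi_strict_mono[of x y i p] xi_strict_mono[of y x i p] by (metis less_irrefl linorder_less_linear)

lemma xi_at_left: "xi i p (4 * real i - 4) = 4 * real i - 4 + chord i p"
  and xi_at_right: "xi i p (4 * real i) = 4 * real i - chord (Suc i) p"
  by (simp_all add: xi_left xi_right)

lemma xi_range:
  assumes "4 * real i - 4 \<le> x" "x \<le> 4 * real i"
  shows "4 * real i - 4 + chord i p \<le> xi i p x" "xi i p x \<le> 4 * real i - chord (Suc i) p"
  using xi_strict_mono[of "4 * real i - 4" x i p] xi_strict_mono[of x "4 * real i" i p] assms
    xi_at_left[of i p] xi_at_right[of i p] by (auto simp: less_eq_real_def)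

lemma continuous_on_xi: "continuous_on S (xi i p)"
proof -
  have "continuous_on UNIV (xi i p)"
    unfolding xi_def[abs_def]
  proof (rule continuous_on_cases_le)
    show "continuous_on {t \<in> UNIV. t \<le> 4 * real i - 2} (\<lambda>x. 4 * real i - 4 + stretch (chord i p) (x - (4 * real i - 4)))"
      and "continuous_on {t \<in> UNIV. 4 * real i - 2 \<le> t} (\<lambda>x. 4 * real i - stretch (chord (Suc i) p) (4 * real i - x))"
      unfolding stretch_def by (intro continuous_intros; simp)+
    show "continuous_on UNIV (\<lambda>x::real. x)" by simp
    show "4 * real i - 4 + stretch (chord i p) (t - (4 * real i - 4)) = 4 * real i - stretch (chord (Suc i) p) (4 * real i - t)"
      if "t = 4 * real i - 2" for t
      using that by (simp add: stretch_ge_eq)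
  qed
  then show ?thesis by (rule continuous_on_subset) simp
qed

lemma continuous_on_rep: "continuous_on S (rep i p)"
proof -
  have "rep i p = (\<lambda>x. complex_of_real (xi i p x) + \<i> * complex_of_real (eta i p (xi i p x)))"
    by (simp add: rep_def complex_eq fun_eq_iff complex_eq_iff)
  then show ?thesis
    unfolding eta_def by (auto intro!: continuous_intros continuous_on_xi)
qed

lemma eta_left: "u \<le> 4 * real i - 5 / 2 \<Longrightarrow> eta i p u = height i p"
  and eta_right: "4 * real i - 3 / 2 \<le> u \<Longrightarrow> eta i p u = height (Suc i) p"
  by (simp_all add: eta_def)

lemma eta_strict_mono:
  assumes "p < q"
  shows "eta i p u < eta i q u"
proof -
  define t where "t = max 0 (min 1 (u - (4 * real i - 5 / 2)))"
  have t: "0 \<le> t" "t \<le> 1" by (auto simp: t_def)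
  have *: "eta i r u = (1 - t) * height i r + t * height (Suc i) r" for r
    by (simp add: eta_def t_def algebra_simps)
  show ?thesis
  proof (cases "t = 0")
    case False
    then have "t * height (Suc i) p < t * height (Suc i) q"
      using t height_strict_mono[OF assms] by simp
    moreover have "(1 - t) * height i p \<le> (1 - t) * height i q"
      using t height_strict_mono[OF assms, of i] by (intro mult_left_mono) auto
    ultimately show ?thesis by (simp add: *)
  qed (simp add: * height_strict_mono[OF assms])
qed

lemma eta_less_iff: "eta i p u < eta i q u \<longleftrightarrow> p < q"
  using eta_strict_mono[of p q i u] eta_strict_mono[of q p i u]
  by (metis less_asym' linorder_neqE_nat)

lemma eta_eq_iff: "eta i p u = eta i q u \<longleftrightarrow> p = q"
  using eta_less_iff[of i p u q] eta_less_iff[of i q u p] by (metis less_irrefl linorder_neqE_nat)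

text \<open>Only the two holes bounding the gap can be within horizontal distance \<open>1\<close>;
  beside them the line is horizontal and ends at the chord. After the start of the gap the one
  possible contact is with the left half of the right-hand circle, as a canonical point
  requires.\<close>

lemma rep_off_hole:
  assumes "4 * real i - 4 \<le> x" "x \<le> 4 * real i"
  shows "1 \<le> cmod (rep i p x - hole_centre j)"
    and "4 * real i - 4 < x \<Longrightarrow> cmod (rep i p x - hole_centre j) = 1 \<Longrightarrow> xi i p x < 4 * real j"
proof -
  let ?r = "xi i p x" and ?y = "eta i p (xi i p x)"
  note range = xi_range[OF assms, of p] chord_bounds[of i p] chord_bounds[of "Suc i" p]
  have far: "1 < (?r - 4 * real j)\<^sup>2 + ?y\<^sup>2" if "1 < \<bar>?r - 4 * real j\<bar>"
  proof -
    have "1 < (?r - 4 * real j)\<^sup>2" using that by (simp add: abs_square_less_1 flip: not_le abs_square_le_1)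
    then show ?thesis using zero_le_power2[of ?y] by linarith
  qed
  consider "4 * real j = 4 * real i" | "4 * real j = 4 * real i - 4" | "1 < \<bar>?r - 4 * real j\<bar>"
  proof -
    have "4 * int j = 4 * int i \<or> 4 * int j = 4 * int i - 4 \<or> 4 * int j \<ge> 4 * int i + 4 \<or> 4 * int j \<le> 4 * int i - 8"
      by presburger
    then have "4 * real j = 4 * real i \<or> 4 * real j = 4 * real i - 4 \<or> 4 * real j \<ge> 4 * real i + 4 \<or> 4 * real j \<le> 4 * real i - 8"
      by linarith
    then show ?thesis using that range by (smt (verit))
  qed
  then have "1 \<le> (?r - 4 * real j)\<^sup>2 + ?y\<^sup>2 \<and>
    (4 * real i - 4 < x \<and> (?r - 4 * real j)\<^sup>2 + ?y\<^sup>2 = 1 \<longrightarrow> ?r < 4 * real j)"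
  proof cases
    case 1
    show ?thesis
    proof (cases "4 * real i - 3 / 2 \<le> ?r")
      case True
      have y: "?y = height (Suc i) p" using True by (rule eta_right)
      have "chord (Suc i) p \<le> 4 * real i - ?r" using range by simp
      from chord_height_ge_1[OF this] have "1 \<le> (?r - 4 * real j)\<^sup>2 + ?y\<^sup>2"
        using 1 y by (simp add: power2_commute)
      moreover have "?r < 4 * real j" if "(?r - 4 * real j)\<^sup>2 + ?y\<^sup>2 = 1"
      proof (rule ccontr)
        assume "\<not> ?r < 4 * real j"
        then have "?r = 4 * real j" using range 1 by linarith
        then show False using that y height_not_1 by simp
      qed
      ultimately show ?thesis by blast
    next
      case False
      then have "1 < \<bar>?r - 4 * real j\<bar>" using 1 by linarith
      then show ?thesis using far by fastforce
    qed
  next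
    case 2
    show ?thesis
    proof (cases "?r \<le> 4 * real i - 5 / 2")
      case True
      have y: "?y = height i p" using True by (rule eta_left)
      have "chord i p \<le> ?r - 4 * real j" using range 2 by simp
      from chord_height_ge_1[OF this] have "1 \<le> (?r - 4 * real j)\<^sup>2 + ?y\<^sup>2"
        using y by simp
      moreover have "1 < (?r - 4 * real j)\<^sup>2 + ?y\<^sup>2" if "4 * real i - 4 < x"
      proof -
        have "chord i p < ?r - 4 * real j"
          using xi_strict_mono[OF that, of i p] 2 by (simp add: xi_at_left)
        from chord_height_gt_1[OF this] show ?thesis using y by simp
      qed
      ultimately show ?thesis by fastforce
    next
      case False
      then have "1 < \<bar>?r - 4 * real j\<bar>" using 2 by linarith
      then show ?thesis using far by fastforce
    qed
  next
    case 3
    then show ?thesis using far by fastforce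
  qed
  then show "1 \<le> cmod (rep i p x - hole_centre j)"
    and "4 * real i - 4 < x \<Longrightarrow> cmod (rep i p x - hole_centre j) = 1 \<Longrightarrow> xi i p x < 4 * real j"
    unfolding cmod_ge_1_iff cmod_eq_1_iff rep_def by auto
qed

lemma rep_canonical:
  "4 * real i - 4 < x \<Longrightarrow> x \<le> 4 * real i \<Longrightarrow> rep i p x \<in> canonical_points c"
  using rep_off_hole[of i x p] by (auto simp: canonical_points_def rep_def)

text \<open>For a line that enters the hole, the reversal negates the height and keeps the chord, so
  the two ends are antipodal. Any other line has chord \<open>0\<close> there, and both ends are the
  same point of the plane.\<close>

lemma glue:
  assumes "i < c" "l < L"
  shows "surface_point c (rep i (P i l) (4 * real i)) = surface_point c (rep (Suc i) (P (Suc i) l) (4 * real i))"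
proof -
  let ?p = "P i l" and ?q = "P (Suc i) l"
  define y where "y = height (Suc i) ?p"
  define w where "w = chord (Suc i) ?p"
  have w1: "w \<le> 1" using chord_bounds by (simp add: w_def)
  have left: "rep i ?p (4 * real i) = Complex (4 * real i - w) y"
    using w1 by (simp add: rep_def xi_at_right eta_right w_def y_def)
  have right: "rep (Suc i) ?q (4 * real i) = Complex (4 * real i + chord (Suc i) ?q) (height (Suc i) ?q)"
    using xi_at_left[of "Suc i" ?q] chord_bounds[of "Suc i" ?q] by (simp add: rep_def eta_left)
  show ?thesis
  proof (cases "?p \<in> {a (Suc i)..<b (Suc i)}")
    case True
    then have q: "?q = a (Suc i) + b (Suc i) - 1 - ?p" using P_Suc assms by simp
    then have "real ?q = real (a (Suc i)) + real (b (Suc i)) - 1 - real ?p" using True by (auto simp: of_nat_diff)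
    then have "height (Suc i) ?q = - y"
      unfolding height_def y_def by (simp add: minus_divide_left)
    moreover from this have "chord (Suc i) ?q = w" by (simp add: chord_def w_def y_def)
    moreover have "w\<^sup>2 + y\<^sup>2 = 1"
      using True height_inside[of "Suc i" ?p] abs_square_less_1[of y] by (simp add: w_def chord_sq y_def)
    then have "cmod (Complex (- w) y) = 1" by (simp add: cmod_def)
    from surface_point_antipodal[OF assms(1) this]
    have "surface_point c (Complex (4 * real i - w) y) = surface_point c (Complex (4 * real i + w) (- y))"
    proof -
      have "hole_centre i + Complex (- w) y = Complex (4 * real i - w) y"
        "hole_centre i - Complex (- w) y = Complex (4 * real i + w) (- y)"
        by (simp_all add: complex_eq_iff hole_centre_eq)
      then show ?thesis using \<open>surface_point c (hole_centre i + _) = _\<close> by simp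
    qed
    ultimately show ?thesis by (simp add: left right)
  next
    case False
    then have "?q = ?p" "w = 0" using P_Suc assms chord_outside by (auto simp: w_def)
    then show ?thesis unfolding left right by (simp add: w_def y_def)
  qed
qed

text \<open>Rounding up makes the gaps half-open, \<open>(4 i - 4, 4 i]\<close>: at a hole the
  representative is the entry point on the left, which is canonical, and never the exit
  point.\<close>

definition gap_index :: "real \<Rightarrow> nat" where
  "gap_index x = nat \<lceil>x / 4\<rceil>"

definition line :: "nat \<Rightarrow> real \<Rightarrow> complex" where
  "line l x = rep (gap_index x) (P (gap_index x) l) x"

text \<open>The lines start in the middle part of gap \<open>0\<close> and stop in that of gap
  \<open>c\<close>, because no hole of the surface bounds these gaps on the outside.\<close>

definition span :: "real set" where
  "span = {- 5 / 2..4 * real c - 3 / 2}"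

lemma gap_index_bounds: "-4 < x \<Longrightarrow> 4 * real (gap_index x) - 4 < x \<and> x \<le> 4 * real (gap_index x)"
  unfolding gap_index_def by (cases "0 \<le> \<lceil>x / 4\<rceil>"; simp; linarith)

lemma gap_index_eq: "4 * real i - 4 < x \<Longrightarrow> x \<le> 4 * real i \<Longrightarrow> gap_index x = i"
  unfolding gap_index_def by (subst ceiling_unique[of "int i"]) (simp_all add: field_simps)

lemma gap_index_le: "x \<in> span \<Longrightarrow> gap_index x \<le> c"
  using gap_index_bounds[of x] by (simp add: span_def)

lemma line_canonical: "x \<in> span \<Longrightarrow> line l x \<in> canonical_points c"
  unfolding line_def using gap_index_bounds[of x] by (intro rep_canonical) (auto simp: span_def)

text \<open>In the plane \<open>line l\<close> jumps across each hole it enters; only its image on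
  the surface is continuous. It is pasted from the closed gaps, which overlap in the parameters
  \<open>4 * i\<close> treated by \<open>glue\<close>.\<close>

lemma continuous_map_line:
  assumes "l < L" "S \<subseteq> span"
  shows "continuous_map (top_of_set S) (sphere_with_crosscaps c) (\<lambda>x. surface_point c (line l x))"
proof -
  let ?T = "\<lambda>i::nat. span \<inter> {4 * real i - 4..4 * real i}"
  have "continuous_map (top_of_set span) (sphere_with_crosscaps c) (\<lambda>x. surface_point c (line l x))"
  proof (rule pasting_lemma_closed[where I = "{..c}" and T = ?T and f = "\<lambda>i x. surface_point c (rep i (P i l) x)"])
    show "closedin (top_of_set span) (?T i)" for i
      by (rule closedin_closed_Int) simp
    show "continuous_map (subtopology (top_of_set span) (?T i)) (sphere_with_crosscaps c)
        (\<lambda>x. surface_point c (rep i (P i l) x))" for i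
    proof -
      have "rep i (P i l) ` (span \<inter> ?T i) \<subseteq> off_holes c"
        using rep_off_hole(1) by (auto simp: off_holes_def)
      then show ?thesis
        unfolding subtopology_subtopology by (rule continuous_map_surface_point[OF continuous_on_rep])
    qed
    fix x
    show "\<exists>j. j \<in> {..c} \<and> x \<in> ?T j \<and> surface_point c (line l x) = surface_point c (rep j (P j l) x)"
      if "x \<in> topspace (top_of_set span)"
    proof (intro exI conjI)
      have x: "x \<in> span" using that by simp
      show "gap_index x \<in> {..c}" using gap_index_le[OF x] by simp
      show "x \<in> ?T (gap_index x)" using gap_index_bounds[of x] x by (auto simp: span_def)
    qed (simp add: line_def)
    have step: "surface_point c (rep i (P i l) x) = surface_point c (rep j (P j l) x)"
      if "i < j" "j \<le> c" "x \<in> ?T i" "x \<in> ?T j" for i j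
    proof -
      have "real j \<le> real i + 1" using that by auto
      then have "j = Suc i" using \<open>i < j\<close> by linarith
      then have "x = 4 * real i" using that by auto
      then show ?thesis using glue[of i l] \<open>j = Suc i\<close> that assms(1) by simp
    qed
    show "surface_point c (rep i (P i l) x) = surface_point c (rep j (P j l) x)"
      if "i \<in> {..c}" "j \<in> {..c}" "x \<in> topspace (top_of_set span) \<inter> ?T i \<inter> ?T j" for i j
    proof (cases i j rule: linorder_cases)
      case less
      then show ?thesis using that by (intro step) simp_all
    next
      case greater
      then show ?thesis using that by (intro step[symmetric]) simp_all
    qed simp
  qed simp
  then show ?thesis using assms(2) by (rule continuous_map_from_subtopology_mono)
qed

lemma Re_line: "x \<in> span \<Longrightarrow> gap_index (Re (line l x)) = gap_index x"
proof (rule gap_index_eq)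
  assume "x \<in> span"
  then have x: "4 * real (gap_index x) - 4 < x" "x \<le> 4 * real (gap_index x)"
    using gap_index_bounds[of x] by (auto simp: span_def)
  show "4 * real (gap_index x) - 4 < Re (line l x)" "Re (line l x) \<le> 4 * real (gap_index x)"
    using xi_strict_mono[OF x(1), of "gap_index x" "P (gap_index x) l"] xi_range[OF less_imp_le[OF x(1)] x(2)]
      chord_bounds[of "gap_index x"] chord_bounds[of "Suc (gap_index x)"]
    by (auto simp: line_def rep_def xi_at_left intro: order_trans add_increasing2 le_less_trans) (smt (verit))+
qed

text \<open>The abscissa determines the gap, the height there determines the position, and the
  position determines the line.\<close>

lemma line_inj:
  assumes "x \<in> span" "x' \<in> span" "l < L" "l' < L" "line l x = line l' x'"
  shows "l = l' \<and> x = x'"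
proof -
  define i where "i = gap_index x"
  have i': "gap_index x' = i"
    using Re_line assms(1,2,5) by (metis i_def)
  then have eq: "rep i (P i l) x = rep i (P i l') x'"
    using assms(5) by (simp add: line_def i_def)
  then have "P i l = P i l'"
    by (auto simp: rep_def eta_eq_iff)
  moreover have "i \<le> c" using gap_index_le assms(1) by (simp add: i_def)
  ultimately have "l = l'" using P_inj assms(3,4) by (auto dest: inj_onD)
  then show ?thesis using eq by (auto simp: rep_def xi_inj)
qed

lemma line_middle:
  assumes "4 * real i - 5 / 2 \<le> x" "x \<le> 4 * real i - 3 / 2"
  shows "line l x = Complex x (eta i (P i l) x)"
proof -
  have "gap_index x = i" using assms by (intro gap_index_eq) auto
  then show ?thesis using xi_middle[OF assms] by (simp add: line_def rep_def)
qed

lemma middle_canonical: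
  assumes "4 * real i - 5 / 2 \<le> x" "x \<le> 4 * real i - 3 / 2"
  shows "Complex x y \<in> canonical_points c"
proof -
  have "1 < cmod (Complex x y - hole_centre j)" for j
  proof -
    have "4 * int j \<ge> 4 * int i \<or> 4 * int j \<le> 4 * int i - 4"
      by presburger
    then have "4 * real j \<ge> 4 * real i \<or> 4 * real j \<le> 4 * real i - 4"
      by linarith
    then have "1 < \<bar>Re (Complex x y - hole_centre j)\<bar>"
      using assms by (auto simp: hole_centre_eq)
    then show ?thesis using abs_Re_le_cmod less_le_trans by blast
  qed
  then show ?thesis unfolding canonical_points_def by (simp add: less_imp_le less_imp_neq[THEN not_sym])
qed

lemma line_meets_middle:
  assumes "4 * real i - 5 / 2 \<le> u" "u \<le> 4 * real i - 3 / 2" "x \<in> span" "line l x = Complex u y"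
  shows "x = u \<and> y = eta i (P i l) u"
proof -
  have "gap_index u = i" using assms by (intro gap_index_eq) auto
  then have "gap_index x = i" using Re_line[OF assms(3), of l] assms(4) by simp
  then have "xi i (P i l) x = u" "y = eta i (P i l) u"
    using assms(4) by (auto simp: line_def rep_def)
  then show ?thesis using xi_middle[OF assms(1,2), of "P i l"] xi_inj by metis
qed

end

section \<open>Drawing rows and columns\<close>

text \<open>Zero cross-caps do not count as a non-orientable surface; that case is the sphere, where
  both gluing relations are the identity.\<close>

lemma surface_of_euler_genus_crosscaps: "surface_of_euler_genus (sphere_with_crosscaps c) c"
proof (cases "c = 0")
  case True
  have "sphere_with_handles 0 = sphere_with_crosscaps 0"
    by (simp add: sphere_with_handles_def sphere_with_crosscaps_def handle_rel_def crosscap_rel_def)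
  then show ?thesis
    using True homeomorphic_space_refl unfolding surface_of_euler_genus_def by (metis mult_0_right)
next
  case False
  then show ?thesis
    using homeomorphic_space_refl unfolding surface_of_euler_genus_def by (metis One_nat_def Suc_leI neq0_conv)
qed

lemma affine_image_open_interval:
  fixes x y :: real
  assumes "x < y"
  shows "(\<lambda>t. x + t * (y - x)) ` {0<..<1} = {x<..<y}"
proof
  have "x + t * (y - x) < y" if "t < 1" for t
  proof -
    have "t * (y - x) < 1 * (y - x)" using that assms by (intro mult_strict_right_mono) auto
    then show ?thesis by simp
  qed
  then show "(\<lambda>t. x + t * (y - x)) ` {0<..<1} \<subseteq> {x<..<y}"
    using assms by auto
  show "{x<..<y} \<subseteq> (\<lambda>t. x + t * (y - x)) ` {0<..<1}"
  proof
    fix z assume "z \<in> {x<..<y}"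
    then show "z \<in> (\<lambda>t. x + t * (y - x)) ` {0<..<1}"
      using assms by (intro image_eqI[of _ _ "(z - x) / (y - x)"]) (auto simp: divide_simps)
  qed
qed

lemma affine_closed_interval:
  fixes x y :: real
  assumes "x \<le> y" "t \<in> {0..1}"
  shows "x + t * (y - x) \<in> {x..y}"
  using mult_right_mono[of t 1 "y - x"] assms by auto

text \<open>\<open>f\<close> names the row or column of a vertex and \<open>g\<close> its place
  along it, so that one notion serves both directions.\<close>

definition consecutive :: "'a set \<Rightarrow> ('a \<Rightarrow> nat) \<Rightarrow> ('a \<Rightarrow> nat) \<Rightarrow> 'a \<Rightarrow> 'a \<Rightarrow> bool" where
  "consecutive V f g v w \<longleftrightarrow> v \<in> V \<and> w \<in> V \<and> f v = f w \<and> g v < g w \<and>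
     (\<forall>u\<in>V. f u = f v \<longrightarrow> \<not> (g v < g u \<and> g u < g w))"

text \<open>
  The vertex \<open>v\<close> is the intersection of the line \<open>v mod L\<close> with the vertical column \<open>v div L\<close>, which
  is placed in the gap \<open>gp (v div L)\<close>.
\<close>

locale line_drawing = line_arrangement +
  fixes M :: nat and gp :: "nat \<Rightarrow> nat" and V :: "nat set"
  assumes L_pos: "0 < L"
    and gp_mono: "i \<le> j \<Longrightarrow> gp i \<le> gp j" and gp_le: "i < M \<Longrightarrow> gp i \<le> c"
    and V_sub: "V \<subseteq> {..<M * L}"
begin

definition ht :: "nat \<Rightarrow> nat" where
  "ht v = P (gp (v div L)) (v mod L)"

abbreviation "row_step \<equiv> consecutive V (\<lambda>v. v mod L) (\<lambda>v. v div L)"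
abbreviation "col_step \<equiv> consecutive V (\<lambda>v. v div L) ht"

definition edges :: "nat set set" where
  "edges = {{v, w} | v w. row_step v w \<or> col_step v w}"

text \<open>For \<open>i < M\<close> the last summand lies strictly between \<open>0\<close> and
  \<open>1\<close>; it separates the columns that share the middle part of one gap.\<close>

definition col_x :: "nat \<Rightarrow> real" where
  "col_x i = 4 * real (gp i) - 5 / 2 + (real i + 1) / (real M + 1)"

definition vertex_y :: "nat \<Rightarrow> real" where
  "vertex_y v = eta (gp (v div L)) (ht v) (col_x (v div L))"

definition vertex_pt :: "nat \<Rightarrow> complex" where
  "vertex_pt v = Complex (col_x (v div L)) (vertex_y v)"

text \<open>An edge is an unordered set, so \<open>Min\<close> and \<open>Max\<close> choose its
  direction. Along a row this is left to right, since the column is the leading digit of a vertex;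
  along a column either direction may occur.\<close>

definition edge_pt :: "nat set \<Rightarrow> real \<Rightarrow> complex" where
  "edge_pt e t = (let v = Min e; w = Max e in
     if v div L = w div L then Complex (col_x (v div L)) (vertex_y v + t * (vertex_y w - vertex_y v))
     else line (v mod L) (col_x (v div L) + t * (col_x (w div L) - col_x (v div L))))"

lemma finite_V: "finite V"
  using V_sub finite_subset by blast

lemma col_less: "v \<in> V \<Longrightarrow> v div L < M"
  using V_sub L_pos by (auto simp: less_mult_imp_div_less)

lemma row_less: "v mod L < L"
  using L_pos by simp

lemma col_x_bounds: "i < M \<Longrightarrow> 4 * real (gp i) - 5 / 2 \<le> col_x i \<and> col_x i \<le> 4 * real (gp i) - 3 / 2"
proof -
  assume "i < M"
  then have "(real i + 1) / (real M + 1) \<le> 1" "0 \<le> (real i + 1) / (real M + 1)" by simp_all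
  then show ?thesis unfolding col_x_def by linarith
qed

lemma col_x_span: "i < M \<Longrightarrow> col_x i \<in> span"
proof -
  assume "i < M"
  then have "real (gp i) \<le> real c" using gp_le by simp
  then show ?thesis using col_x_bounds[OF \<open>i < M\<close>] by (simp add: span_def)
qed

lemma col_x_strict_mono: "i < j \<Longrightarrow> col_x i < col_x j"
proof -
  assume "i < j"
  then have "real (gp i) \<le> real (gp j)" "(real i + 1) / (real M + 1) < (real j + 1) / (real M + 1)"
    using gp_mono[of i j] by (auto simp: divide_strict_right_mono)
  then show ?thesis by (simp add: col_x_def)
qed

lemma col_x_less_iff: "col_x i < col_x j \<longleftrightarrow> i < j"
  using col_x_strict_mono[of i j] col_x_strict_mono[of j i] by (metis less_asym' linorder_neqE_nat)

lemma col_x_eq_iff: "col_x i = col_x j \<longleftrightarrow> i = j"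
  using col_x_less_iff[of i j] col_x_less_iff[of j i] by (metis less_irrefl linorder_neqE_nat)

lemma vertex_y_less_iff: "v div L = w div L \<Longrightarrow> vertex_y v < vertex_y w \<longleftrightarrow> ht v < ht w"
  by (simp add: vertex_y_def eta_less_iff)

lemma col_pt_canonical: "i < M \<Longrightarrow> Complex (col_x i) y \<in> canonical_points c"
  using col_x_bounds[of i] middle_canonical by blast

lemma vertex_pt_line: "v \<in> V \<Longrightarrow> vertex_pt v = line (v mod L) (col_x (v div L))"
  using line_middle[of "gp (v div L)" "col_x (v div L)" "v mod L"] col_x_bounds[OF col_less]
  by (simp add: vertex_pt_def vertex_y_def ht_def)

lemma vertex_pt_canonical: "v \<in> V \<Longrightarrow> vertex_pt v \<in> canonical_points c"
  unfolding vertex_pt_def using col_pt_canonical col_less by blast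

lemma line_meets_col:
  assumes "i < M" "x \<in> span" "line l x = Complex (col_x i) y"
  shows "x = col_x i \<and> y = eta (gp i) (P (gp i) l) (col_x i)"
  using line_meets_middle[of "gp i" "col_x i" x l y] col_x_bounds[OF assms(1)] assms by blast

lemma line_meets_vertex:
  assumes "v \<in> V" "x \<in> span" "l < L" "line l x = vertex_pt v"
  shows "l = v mod L \<and> x = col_x (v div L)"
  using line_inj[OF assms(2) col_x_span[OF col_less[OF assms(1)]] assms(3) row_less, of v] assms(1,4)
  by (simp add: vertex_pt_line)

lemma vertex_eqI: "v mod L = w mod L \<Longrightarrow> v div L = w div L \<Longrightarrow> v = w" for v w :: nat
  by (metis div_mult_mod_eq)

lemma inj_on_vertex_pt: "inj_on vertex_pt V"
proof (rule inj_onI)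
  fix v w assume *: "v \<in> V" "w \<in> V" "vertex_pt v = vertex_pt w"
  then have "line (v mod L) (col_x (v div L)) = vertex_pt w"
    using vertex_pt_line by simp
  then have "v mod L = w mod L \<and> col_x (v div L) = col_x (w div L)"
    by (rule line_meets_vertex[OF *(2) col_x_span[OF col_less[OF *(1)]] row_less])
  then show "v = w" using vertex_eqI[of v w] by (simp add: col_x_eq_iff)
qed

section \<open>Disjointness of row and column edges in the plane\<close>

definition row_pts :: "nat \<Rightarrow> nat \<Rightarrow> complex set" where
  "row_pts v w = line (v mod L) ` {col_x (v div L)<..<col_x (w div L)}"

definition col_pts :: "nat \<Rightarrow> nat \<Rightarrow> complex set" where
  "col_pts v w = Complex (col_x (v div L)) ` {vertex_y v<..<vertex_y w}"

lemma row_step_min_max: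
  assumes "row_step v w"
  shows "Min {v, w} = v" "Max {v, w} = w" "v div L \<noteq> w div L"
proof -
  have "v < w"
    using assms unfolding consecutive_def by (meson div_le_mono not_less)
  then show "Min {v, w} = v" "Max {v, w} = w" by auto
  show "v div L \<noteq> w div L" using assms by (simp add: consecutive_def)
qed

lemma edge_pt_row:
  assumes "row_step v w"
  shows "edge_pt {v, w} t = line (v mod L) (col_x (v div L) + t * (col_x (w div L) - col_x (v div L)))"
  using row_step_min_max[OF assms] by (simp add: edge_pt_def Let_def)

lemma edge_pt_col:
  assumes "col_step v w"
  obtains "\<And>t. edge_pt {v, w} t = Complex (col_x (v div L)) (vertex_y v + t * (vertex_y w - vertex_y v))"
  | "\<And>t. edge_pt {v, w} t = Complex (col_x (v div L)) (vertex_y w + t * (vertex_y v - vertex_y w))"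
proof -
  have "v div L = w div L" using assms by (simp add: consecutive_def)
  then show ?thesis
    using that by (cases "v \<le> w") (simp_all add: edge_pt_def Let_def)
qed

lemma edge_pt_row_interior:
  assumes "row_step v w"
  shows "edge_pt {v, w} ` {0<..<1} = row_pts v w"
proof -
  have "col_x (v div L) < col_x (w div L)"
    using assms by (simp add: consecutive_def col_x_less_iff)
  from affine_image_open_interval[OF this] show ?thesis
    unfolding row_pts_def edge_pt_row[OF assms] by (metis image_image)
qed

lemma col_step_y: "col_step v w \<Longrightarrow> v div L = w div L \<and> vertex_y v < vertex_y w"
  using vertex_y_less_iff by (auto simp: consecutive_def)

lemma edge_pt_col_interior:
  assumes "col_step v w"
  shows "edge_pt {v, w} ` {0<..<1} = col_pts v w"
proof -
  have y: "vertex_y v < vertex_y w" using col_step_y[OF assms] by blast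
  have rev: "(\<lambda>t. vertex_y w + t * (vertex_y v - vertex_y w)) ` {0<..<1} = {vertex_y v<..<vertex_y w}"
  proof -
    have "(\<lambda>t. vertex_y w + t * (vertex_y v - vertex_y w)) ` {0<..<1}
        = (\<lambda>t. vertex_y v + t * (vertex_y w - vertex_y v)) ` ((\<lambda>t. 1 - t) ` {0<..<1})"
      by (simp add: image_image algebra_simps)
    also have "(\<lambda>t. 1 - t :: real) ` {0<..<1} = {0<..<1}"
      by (auto intro!: image_eqI[of _ _ "1 - _"])
    finally show ?thesis using affine_image_open_interval[OF y] by simp
  qed
  from assms show ?thesis
  proof (cases rule: edge_pt_col)
    case 1
    then show ?thesis using affine_image_open_interval[OF y] unfolding col_pts_def 1 by (metis image_image)
  next
    case 2
    then show ?thesis using rev unfolding col_pts_def 2 by (metis image_image)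
  qed
qed

lemma row_step_span:
  assumes "row_step v w"
  shows "{col_x (v div L)..col_x (w div L)} \<subseteq> span"
  using assms col_x_span[OF col_less, of v] col_x_span[OF col_less, of w]
  by (auto simp: consecutive_def span_def)

lemma row_pts_canonical: "row_step v w \<Longrightarrow> row_pts v w \<subseteq> canonical_points c"
proof -
  assume "row_step v w"
  then have "{col_x (v div L)<..<col_x (w div L)} \<subseteq> span"
    using row_step_span[of v w] greaterThanLessThan_subseteq_atLeastAtMost_iff by (meson order_refl subset_trans)
  then show ?thesis using line_canonical by (auto simp: row_pts_def)
qed

lemma col_pts_canonical: "col_step v w \<Longrightarrow> col_pts v w \<subseteq> canonical_points c"
  using col_pt_canonical col_less by (auto simp: col_pts_def consecutive_def)

lemma row_pts_no_vertex:
  assumes "row_step v w"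
  shows "row_pts v w \<inter> vertex_pt ` V = {}"
proof (rule ccontr)
  assume "row_pts v w \<inter> vertex_pt ` V \<noteq> {}"
  then obtain u x where u: "u \<in> V" "x \<in> {col_x (v div L)<..<col_x (w div L)}" "line (v mod L) x = vertex_pt u"
    unfolding row_pts_def by blast
  moreover have "x \<in> span" using u(2) row_step_span[OF assms] by auto
  ultimately have "v mod L = u mod L" "x = col_x (u div L)"
    using line_meets_vertex[of u x "v mod L"] row_less by blast+
  then show False using u assms by (auto simp: consecutive_def col_x_less_iff)
qed

lemma col_pts_no_vertex:
  assumes "col_step v w"
  shows "col_pts v w \<inter> vertex_pt ` V = {}"
proof (rule ccontr)
  assume "col_pts v w \<inter> vertex_pt ` V \<noteq> {}"
  then obtain u where u0: "u \<in> V" "vertex_pt u \<in> col_pts v w" by blast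
  then have u: "u \<in> V" "col_x (v div L) = col_x (u div L)" "vertex_y v < vertex_y u" "vertex_y u < vertex_y w"
    by (auto simp: col_pts_def vertex_pt_def)
  then have "v div L = u div L" "w div L = u div L"
    using assms by (auto simp: col_x_eq_iff consecutive_def)
  then show False
    using u assms vertex_y_less_iff[of v u] vertex_y_less_iff[of u w] by (auto simp: consecutive_def)
qed

text \<open>Equal points lie on the same line at the same parameter, and overlapping intervals
  between consecutive vertices coincide.\<close>

lemma row_pts_disjoint:
  assumes "row_step v w" "row_step v' w'" "\<zeta> \<in> row_pts v w" "\<zeta> \<in> row_pts v' w'"
  shows "v = v' \<and> w = w'"
proof -
  obtain x x' where x: "x \<in> {col_x (v div L)<..<col_x (w div L)}" "x' \<in> {col_x (v' div L)<..<col_x (w' div L)}"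
    "\<zeta> = line (v mod L) x" "\<zeta> = line (v' mod L) x'"
    using assms(3,4) by (auto simp: row_pts_def)
  then have "x \<in> span" "x' \<in> span"
    using row_step_span[OF assms(1)] row_step_span[OF assms(2)] by auto
  then have eq: "v mod L = v' mod L" "x = x'"
    using line_inj[of x x' "v mod L" "v' mod L"] row_less x by auto
  have "v div L < w' div L" "v' div L < w div L"
    using x eq unfolding col_x_less_iff[symmetric] by auto
  then have "\<not> (v div L < v' div L)" "\<not> (v' div L < v div L)" "\<not> (w div L < w' div L)" "\<not> (w' div L < w div L)"
    using assms(1,2) eq(1) unfolding consecutive_def by metis+
  then have "v div L = v' div L" "w div L = w' div L" by linarith+
  moreover from this have "v = v'" "w = w'"
    using eq(1) assms(1,2) vertex_eqI[of v v'] vertex_eqI[of w w'] by (simp_all add: consecutive_def)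
  ultimately show ?thesis by blast
qed

lemma P_inj_gp: "i < M \<Longrightarrow> inj_on (P (gp i)) {..<L}"
  using P_inj gp_le by blast

lemma col_vertex_eqI: "v \<in> V \<Longrightarrow> v div L = w div L \<Longrightarrow> ht v = ht w \<Longrightarrow> v = w"
  using P_inj_gp[OF col_less] row_less unfolding ht_def by (metis inj_onD lessThan_iff vertex_eqI)

lemma col_pts_disjoint:
  assumes "col_step v w" "col_step v' w'" "\<zeta> \<in> col_pts v w" "\<zeta> \<in> col_pts v' w'"
  shows "v = v' \<and> w = w'"
proof -
  obtain y where y: "y \<in> {vertex_y v<..<vertex_y w}" "y \<in> {vertex_y v'<..<vertex_y w'}"
    "col_x (v div L) = col_x (v' div L)"
    using assms(3,4) by (auto simp: col_pts_def)
  have V: "v \<in> V" "w \<in> V" "v' \<in> V" "w' \<in> V" using assms(1,2) by (auto simp: consecutive_def)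
  have col: "w div L = v div L" "v' div L = v div L" "w' div L = v div L"
    using y(3) assms(1,2) by (auto simp: consecutive_def col_x_eq_iff)
  have "vertex_y v < vertex_y w'" "vertex_y v' < vertex_y w" using y by auto
  then have "ht v < ht w'" "ht v' < ht w"
    using vertex_y_less_iff[of v w'] vertex_y_less_iff[of v' w] col by simp_all
  then have "\<not> (ht v < ht v')" "\<not> (ht v' < ht v)" "\<not> (ht w < ht w')" "\<not> (ht w' < ht w)"
    using assms(1,2) col unfolding consecutive_def by metis+
  then have "ht v = ht v'" "ht w = ht w'" by linarith+
  moreover have "v div L = v' div L" "w div L = w' div L" using col by simp_all
  ultimately show ?thesis using V(1,2) by (blast intro: col_vertex_eqI)
qed

text \<open>A line passes a column at one parameter, at the height given by its position. A crossing
  is thus determined by the column on a given row edge, and by the position on a given column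
  edge.\<close>

lemma row_pts_col_pts:
  assumes "row_step v w" "col_step v' w'" "\<zeta> \<in> row_pts v w" "\<zeta> \<in> col_pts v' w'"
  shows "v div L < v' div L" "v' div L < w div L"
    and "ht v' < P (gp (v' div L)) (v mod L)" "P (gp (v' div L)) (v mod L) < ht w'"
    and "\<zeta> = line (v mod L) (col_x (v' div L))"
    and "\<zeta> = Complex (col_x (v' div L)) (eta (gp (v' div L)) (P (gp (v' div L)) (v mod L)) (col_x (v' div L)))"
proof -
  let ?i = "v' div L"
  obtain x y where xy: "x \<in> {col_x (v div L)<..<col_x (w div L)}" "y \<in> {vertex_y v'<..<vertex_y w'}"
    "\<zeta> = line (v mod L) x" "\<zeta> = Complex (col_x ?i) y"
    using assms(3,4) by (auto simp: row_pts_def col_pts_def)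
  have "x \<in> span" using row_step_span[OF assms(1)] xy(1) by auto
  moreover have i: "?i < M" "w' div L = ?i" using assms(2) col_less by (auto simp: consecutive_def)
  ultimately have *: "x = col_x ?i" "y = eta (gp ?i) (P (gp ?i) (v mod L)) (col_x ?i)"
    using line_meets_col[of ?i x "v mod L" y] xy(3,4) by auto
  then show "v div L < ?i" "?i < w div L" using xy(1) by (auto simp: col_x_less_iff)
  show "ht v' < P (gp (v' div L)) (v mod L)" "P (gp (v' div L)) (v mod L) < ht w'"
    using xy(2) * i by (auto simp: vertex_y_def eta_less_iff)
  show "\<zeta> = line (v mod L) (col_x ?i)"
    "\<zeta> = Complex (col_x ?i) (eta (gp ?i) (P (gp ?i) (v mod L)) (col_x ?i))"
    using xy(3,4) * by auto
qed

lemma edgesE: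
  assumes "e \<in> edges"
  obtains v w where "e = {v, w}" "row_step v w" | v w where "e = {v, w}" "col_step v w"
  using assms by (auto simp: edges_def)

lemma edge_pt_interior_canonical: "e \<in> edges \<Longrightarrow> edge_pt e ` {0<..<1} \<subseteq> canonical_points c"
  by (erule edgesE) (simp_all add: edge_pt_row_interior row_pts_canonical edge_pt_col_interior col_pts_canonical)

section \<open>The drawing on the surface and its crossings\<close>

definition curve :: "nat set \<Rightarrow> real \<Rightarrow> complex option set" where
  "curve e t = surface_point c (edge_pt e t)"

lemma curve_interior: "curve e ` S = surface_point c ` edge_pt e ` S"
  by (auto simp: curve_def)

lemma edge_curve:
  assumes "e \<in> edges"
  shows "pathin (sphere_with_crosscaps c) (curve e)" "inj_on (curve e) {0..1}"
    "{curve e 0, curve e 1} = (\<lambda>v. surface_point c (vertex_pt v)) ` e"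
proof -
  have "pathin (sphere_with_crosscaps c) (curve e) \<and> inj_on (edge_pt e) {0..1} \<and>
      edge_pt e ` {0..1} \<subseteq> canonical_points c \<and> {edge_pt e 0, edge_pt e 1} = vertex_pt ` e"
    using assms
  proof (cases rule: edgesE)
    case (1 v w)
    let ?x = "col_x (v div L)" and ?x' = "col_x (w div L)"
    have x: "?x < ?x'" and V: "v \<in> V" "w \<in> V" "v mod L = w mod L"
      using 1(2) by (auto simp: consecutive_def col_x_less_iff)
    have e: "edge_pt e = (\<lambda>t. line (v mod L) (?x + t * (?x' - ?x)))"
      using edge_pt_row[OF 1(2)] 1(1) by auto
    have into: "(\<lambda>t. ?x + t * (?x' - ?x)) ` {0..1} \<subseteq> span"
      using affine_closed_interval[of ?x ?x'] x row_step_span[OF 1(2)] by force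
    have "continuous_map (top_of_set {0..1}) (top_of_set span) (\<lambda>t. ?x + t * (?x' - ?x))"
      using into by (simp add: continuous_map_in_subtopology image_subset_iff continuous_intros)
    from continuous_map_compose[OF this continuous_map_line[OF row_less subset_refl, of v]]
    have "pathin (sphere_with_crosscaps c) (curve e)"
      by (simp add: pathin_def curve_def[abs_def] e comp_def)
    moreover have "inj_on (edge_pt e) {0..1}"
    proof (rule inj_onI)
      fix s t :: real assume "s \<in> {0..1}" "t \<in> {0..1}" "edge_pt e s = edge_pt e t"
      then show "s = t"
        using line_inj[of "?x + s * (?x' - ?x)" "?x + t * (?x' - ?x)" "v mod L" "v mod L"] into row_less x
        by (simp add: e image_subset_iff)
    qed
    moreover have "edge_pt e ` {0..1} \<subseteq> canonical_points c"
      using line_canonical into by (auto simp: e image_subset_iff)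
    moreover have "{edge_pt e 0, edge_pt e 1} = vertex_pt ` e"
    proof -
      have "edge_pt e 0 = vertex_pt v" by (simp add: e vertex_pt_line[OF V(1)])
      moreover have "edge_pt e 1 = vertex_pt w" by (simp add: e vertex_pt_line[OF V(2)] V(3))
      ultimately show ?thesis using 1(1) by simp
    qed
    ultimately show ?thesis by blast
  next
    case (2 v w)
    let ?x = "col_x (v div L)"
    have y: "vertex_y v < vertex_y w" and V: "v \<in> V" "w \<in> V" "w div L = v div L"
      using 2(2) col_step_y[OF 2(2)] by (simp_all add: consecutive_def)
    obtain r s where rs: "r = v \<and> s = w \<or> r = w \<and> s = v"
      and e: "edge_pt e = (\<lambda>t. Complex ?x (vertex_y r + t * (vertex_y s - vertex_y r)))"
    proof (cases rule: edge_pt_col[OF 2(2)])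
      case 1
      then show ?thesis using that[of v w] 2(1) by auto
    next
      case 2
      then show ?thesis using that[of w v] \<open>e = {v, w}\<close> by auto
    qed
    have can: "edge_pt e ` S \<subseteq> canonical_points c" for S
      using col_pt_canonical[OF col_less[OF V(1)]] by (auto simp: e)
    have "edge_pt e = (\<lambda>t. complex_of_real ?x + \<i> * complex_of_real (vertex_y r + t * (vertex_y s - vertex_y r)))"
      by (simp add: e complex_eq_iff fun_eq_iff)
    then have "continuous_on {0..1} (edge_pt e)" by (simp add: continuous_intros)
    moreover have "edge_pt e ` {0..1} \<subseteq> off_holes c" using can canonical_off_holes by blast
    ultimately have "pathin (sphere_with_crosscaps c) (curve e)"
      unfolding pathin_def curve_def[abs_def] by (rule continuous_map_surface_point)
    moreover have "inj_on (edge_pt e) {0..1}"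
      using y rs by (auto simp: e inj_on_def)
    moreover have "{edge_pt e 0, edge_pt e 1} = vertex_pt ` e"
    proof -
      have "edge_pt e 0 = Complex ?x (vertex_y r)" "edge_pt e 1 = Complex ?x (vertex_y s)" by (simp_all add: e)
      moreover have "vertex_pt v = Complex ?x (vertex_y v)" "vertex_pt w = Complex ?x (vertex_y w)"
        using V(3) by (simp_all add: vertex_pt_def)
      ultimately show ?thesis using rs 2(1) by auto
    qed
    ultimately show ?thesis using can by blast
  qed
  then have path: "pathin (sphere_with_crosscaps c) (curve e)" and inj: "inj_on (edge_pt e) {0..1}"
    and can: "edge_pt e ` {0..1} \<subseteq> canonical_points c" and ends: "{edge_pt e 0, edge_pt e 1} = vertex_pt ` e"
    by blast+
  show "pathin (sphere_with_crosscaps c) (curve e)" by (fact path)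
  show "inj_on (curve e) {0..1}"
    using comp_inj_on[OF inj inj_on_subset[OF inj_on_surface_point can]]
    by (simp add: curve_def[abs_def] comp_def)
  have "{curve e 0, curve e 1} = surface_point c ` {edge_pt e 0, edge_pt e 1}"
    unfolding curve_def by blast
  then show "{curve e 0, curve e 1} = (\<lambda>v. surface_point c (vertex_pt v)) ` e"
    unfolding ends image_image .
qed

lemma edges_simple: "simple_graph V edges"
proof -
  have "{v, w} \<subseteq> V \<and> card {v, w} = 2" if "row_step v w \<or> col_step v w" for v w
    using that by (cases "v = w") (auto simp: consecutive_def)
  then show ?thesis
    using finite_V unfolding simple_graph_def edges_def by blast
qed

lemma surface_points_Int:
  assumes "S \<subseteq> canonical_points c" "T \<subseteq> canonical_points c"
  shows "surface_point c ` S \<inter> surface_point c ` T = surface_point c ` (S \<inter> T)"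
  using inj_on_image_Int[OF inj_on_surface_point assms] by simp

lemma drawing_curve:
  "drawing (sphere_with_crosscaps c) V edges (\<lambda>v. surface_point c (vertex_pt v)) curve"
  unfolding drawing_def
proof (intro conjI ballI impI)
  let ?pos = "\<lambda>v. surface_point c (vertex_pt v)"
  have can: "vertex_pt ` V \<subseteq> canonical_points c" using vertex_pt_canonical by blast
  show "?pos ` V \<subseteq> topspace (sphere_with_crosscaps c)"
    using can canonical_off_holes surface_point_in_topspace by blast
  show "inj_on ?pos V"
    using comp_inj_on[OF inj_on_vertex_pt inj_on_subset[OF inj_on_surface_point can]] by (simp add: comp_def)
  fix e assume e: "e \<in> edges"
  show "pathin (sphere_with_crosscaps c) (curve e)" "inj_on (curve e) {0..1}" "{curve e 0, curve e 1} = ?pos ` e"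
    using edge_curve[OF e] by auto
  have "edge_pt e ` {0<..<1} \<inter> vertex_pt ` V = {}"
    using e by (cases rule: edgesE)
      (simp_all add: edge_pt_row_interior row_pts_no_vertex edge_pt_col_interior col_pts_no_vertex)
  then show "curve e ` {0<..<1} \<inter> ?pos ` V = {}"
    using surface_points_Int[OF edge_pt_interior_canonical[OF e] can] by (simp add: curve_interior image_image)
next
  fix e1 e2 e3 assume E: "e1 \<in> edges" "e2 \<in> edges" "e3 \<in> edges" and dist: "distinct [e1, e2, e3]"
  \<comment> \<open>Of three edges, two are both row edges or both column edges, and such edges have
    disjoint interiors.\<close>
  define R where "R e \<longleftrightarrow> (\<exists>v w. e = {v, w} \<and> row_step v w)" for e
  define C where "C e \<longleftrightarrow> (\<exists>v w. e = {v, w} \<and> col_step v w)" for e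
  have same_row: "e = f" if "R e" "R f" "\<zeta> \<in> edge_pt e ` {0<..<1}" "\<zeta> \<in> edge_pt f ` {0<..<1}" for e f \<zeta>
  proof -
    obtain v w v' w' where "e = {v, w}" "row_step v w" "f = {v', w'}" "row_step v' w'"
      using \<open>R e\<close> \<open>R f\<close> unfolding R_def by blast
    then show ?thesis
      using that(3,4) row_pts_disjoint[of v w v' w' \<zeta>] by (simp add: edge_pt_row_interior)
  qed
  have same_col: "e = f" if "C e" "C f" "\<zeta> \<in> edge_pt e ` {0<..<1}" "\<zeta> \<in> edge_pt f ` {0<..<1}" for e f \<zeta>
  proof -
    obtain v w v' w' where "e = {v, w}" "col_step v w" "f = {v', w'}" "col_step v' w'"
      using \<open>C e\<close> \<open>C f\<close> unfolding C_def by blast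
    then show ?thesis
      using that(3,4) col_pts_disjoint[of v w v' w' \<zeta>] by (simp add: edge_pt_col_interior)
  qed
  have "R e \<or> C e" if "e \<in> edges" for e
    using that unfolding R_def C_def by (auto simp: edges_def)
  then have kinds: "R e1 \<or> C e1" "R e2 \<or> C e2" "R e3 \<or> C e3" using E by blast+
  have "edge_pt e1 ` {0<..<1} \<inter> edge_pt e2 ` {0<..<1} \<inter> edge_pt e3 ` {0<..<1} = {}"
  proof (rule ccontr)
    assume "\<not> ?thesis"
    then obtain \<zeta> where \<zeta>: "\<zeta> \<in> edge_pt e1 ` {0<..<1}" "\<zeta> \<in> edge_pt e2 ` {0<..<1}" "\<zeta> \<in> edge_pt e3 ` {0<..<1}"
      by blast
    have "e1 \<noteq> e2" "e1 \<noteq> e3" "e2 \<noteq> e3" using dist by auto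
    then show False
      using kinds same_row[OF _ _ \<zeta>(1,2)] same_row[OF _ _ \<zeta>(1,3)] same_row[OF _ _ \<zeta>(2,3)]
        same_col[OF _ _ \<zeta>(1,2)] same_col[OF _ _ \<zeta>(1,3)] same_col[OF _ _ \<zeta>(2,3)] by blast
  qed
  then show "curve e1 ` {0<..<1} \<inter> curve e2 ` {0<..<1} \<inter> curve e3 ` {0<..<1} = {}"
    using E edge_pt_interior_canonical by (simp add: curve_interior surface_points_Int le_infI1)
qed

lemma crossings_curve:
  assumes e: "e \<in> edges"
  shows "crossings edges curve e =
    surface_point c ` {\<zeta> \<in> edge_pt e ` {0<..<1}. \<exists>f\<in>edges - {e}. \<zeta> \<in> edge_pt f ` {0<..<1}}"
proof -
  let ?I = "\<lambda>e. edge_pt e ` {0<..<1}"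
  have "crossings edges curve e = (\<Union>f\<in>edges - {e}. surface_point c ` ?I e \<inter> surface_point c ` ?I f)"
    unfolding crossings_def curve_interior by blast
  also have "\<dots> = (\<Union>f\<in>edges - {e}. surface_point c ` (?I e \<inter> ?I f))"
    using surface_points_Int[OF edge_pt_interior_canonical edge_pt_interior_canonical] e by simp
  also have "\<dots> = surface_point c ` {\<zeta> \<in> ?I e. \<exists>f\<in>edges - {e}. \<zeta> \<in> ?I f}"
    by blast
  finally show ?thesis .
qed

text \<open>On a row edge each column contributes at most one crossing, on a column edge each
  position strictly between its ends; a difference of \<open>Suc k\<close> leaves \<open>k\<close>
  such positions.\<close>

lemma gk_planar_edges:
  assumes row: "\<And>v w. row_step v w \<Longrightarrow>
      card {i. v div L < i \<and> i < w div L \<and>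
        (\<exists>v' w'. col_step v' w' \<and> v' div L = i \<and> ht v' < P (gp i) (v mod L) \<and> P (gp i) (v mod L) < ht w')} \<le> k"
    and col: "\<And>v w. col_step v w \<Longrightarrow> ht w \<le> ht v + Suc k"
    and "c \<le> g"
  shows "gk_planar g k V edges"
proof -
  have "finite (crossings edges curve e) \<and> card (crossings edges curve e) \<le> k" if e: "e \<in> edges" for e
  proof -
    \<comment> \<open>\<open>A\<close> labels the possible crossings by columns or positions, and
      \<open>h\<close> turns a label into its point.\<close>
    have bound: ?thesis if "finite A" "card A \<le> k"
      "{\<zeta> \<in> edge_pt e ` {0<..<1}. \<exists>f\<in>edges - {e}. \<zeta> \<in> edge_pt f ` {0<..<1}} \<subseteq> h ` A" for A :: "nat set" and h
    proof -
      have sub: "crossings edges curve e \<subseteq> (\<lambda>i. surface_point c (h i)) ` A"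
        using image_mono[OF that(3), of "surface_point c"] by (simp add: crossings_curve[OF e] image_image)
      moreover have "card ((\<lambda>i. surface_point c (h i)) ` A) \<le> k"
        using card_image_le[OF that(1)] that(2) le_trans by blast
      ultimately show ?thesis
        using that(1) by (meson card_mono finite_imageI finite_subset le_trans)
    qed
    from e show ?thesis
    proof (cases rule: edgesE)
      case (1 v w)
      let ?A = "{i. v div L < i \<and> i < w div L \<and>
        (\<exists>v' w'. col_step v' w' \<and> v' div L = i \<and> ht v' < P (gp i) (v mod L) \<and> P (gp i) (v mod L) < ht w')}"
      show ?thesis
      proof (rule bound[of ?A "\<lambda>i. line (v mod L) (col_x i)"])
        show "finite ?A" by (rule finite_subset[of _ "{..<w div L}"]) auto
        show "card ?A \<le> k" by (rule row[OF 1(2)])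
        show "{\<zeta> \<in> edge_pt e ` {0<..<1}. \<exists>f\<in>edges - {e}. \<zeta> \<in> edge_pt f ` {0<..<1}} \<subseteq> (\<lambda>i. line (v mod L) (col_x i)) ` ?A"
        proof (rule subsetI)
          fix \<zeta> assume "\<zeta> \<in> {\<zeta> \<in> edge_pt e ` {0<..<1}. \<exists>f\<in>edges - {e}. \<zeta> \<in> edge_pt f ` {0<..<1}}"
          then obtain f where t: "\<zeta> \<in> edge_pt e ` {0<..<1}"
            and f: "f \<in> edges" "\<zeta> \<in> edge_pt f ` {0<..<1}" "f \<noteq> e" by blast
          have \<zeta>: "\<zeta> \<in> row_pts v w" using edge_pt_row_interior[OF 1(2)] 1(1) t by simp
          from f(1) show "\<zeta> \<in> (\<lambda>i. line (v mod L) (col_x i)) ` ?A"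
          proof (cases rule: edgesE)
            case (1 v' w')
            then have "\<zeta> \<in> row_pts v' w'" using f edge_pt_row_interior by blast
            then show ?thesis using row_pts_disjoint[OF \<open>row_step v w\<close> 1(2) \<zeta>] f(3) 1(1) \<open>e = {v, w}\<close> by blast
          next
            case (2 v' w')
            then have "\<zeta> \<in> col_pts v' w'" using f edge_pt_col_interior by blast
            from row_pts_col_pts[OF 1(2) 2(2) \<zeta> this] show ?thesis using 2(2) by blast
          qed
        qed
      qed
    next
      case (2 v w)
      let ?i = "v div L"
      show ?thesis
      proof (rule bound[of "{ht v<..<ht w}" "\<lambda>p. Complex (col_x ?i) (eta (gp ?i) p (col_x ?i))"])
        show "card {ht v<..<ht w} \<le> k" using col[OF 2(2)] by simp
        show "{\<zeta> \<in> edge_pt e ` {0<..<1}. \<exists>f\<in>edges - {e}. \<zeta> \<in> edge_pt f ` {0<..<1}}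
            \<subseteq> (\<lambda>p. Complex (col_x ?i) (eta (gp ?i) p (col_x ?i))) ` {ht v<..<ht w}"
        proof (rule subsetI)
          fix \<zeta> assume "\<zeta> \<in> {\<zeta> \<in> edge_pt e ` {0<..<1}. \<exists>f\<in>edges - {e}. \<zeta> \<in> edge_pt f ` {0<..<1}}"
          then obtain f where t: "\<zeta> \<in> edge_pt e ` {0<..<1}"
            and f: "f \<in> edges" "\<zeta> \<in> edge_pt f ` {0<..<1}" "f \<noteq> e" by blast
          have \<zeta>: "\<zeta> \<in> col_pts v w" using edge_pt_col_interior[OF 2(2)] 2(1) t by simp
          from f(1) show "\<zeta> \<in> (\<lambda>p. Complex (col_x ?i) (eta (gp ?i) p (col_x ?i))) ` {ht v<..<ht w}"
          proof (cases rule: edgesE)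
            case (1 v' w')
            then have "\<zeta> \<in> row_pts v' w'" using f edge_pt_row_interior by blast
            from row_pts_col_pts(3,4,6)[OF 1(2) 2(2) this \<zeta>] show ?thesis
              by (intro image_eqI[of _ _ "P (gp ?i) (v' mod L)"]) (assumption, simp)
          next
            case (2 v' w')
            then have "\<zeta> \<in> col_pts v' w'" using f edge_pt_col_interior by blast
            then show ?thesis using col_pts_disjoint[OF \<open>col_step v w\<close> 2(2) \<zeta>] f(3) 2(1) \<open>e = {v, w}\<close> by blast
          qed
        qed
      qed simp
    qed
  qed
  then show ?thesis
    unfolding gk_planar_def
    using edges_simple drawing_curve surface_of_euler_genus_crosscaps assms(3) by blast
qed

end

section \<open>Expanding pairs and connected parts\<close>

text \<open>Double counting of incidences: if every point lay in too few sets, the sum of their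
  sizes would be too small.\<close>

lemma exists_popular_point:
  assumes fin: "finite \<Omega>" "\<Omega> \<noteq> {}" "finite \<F>"
    and sub: "\<And>S. S \<in> \<F> \<Longrightarrow> S \<subseteq> \<Omega>" and large: "\<And>S. S \<in> \<F> \<Longrightarrow> card \<Omega> \<le> K * card S"
  shows "\<exists>\<omega>\<in>\<Omega>. card \<F> \<le> K * card {S \<in> \<F>. \<omega> \<in> S}"
proof (rule ccontr)
  assume neg: "\<not> ?thesis"
  have "card \<F> * card \<Omega> = (\<Sum>S\<in>\<F>. card \<Omega>)" by simp
  also have "\<dots> \<le> (\<Sum>S\<in>\<F>. K * card S)" by (rule sum_mono) (rule large)
  also have "\<dots> = (\<Sum>S\<in>\<F>. \<Sum>\<omega>\<in>\<Omega>. if \<omega> \<in> S then K else 0)"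
  proof (rule sum.cong)
    fix S assume "S \<in> \<F>"
    then have "{\<omega> \<in> \<Omega>. \<omega> \<in> S} = S" using sub by blast
    then show "K * card S = (\<Sum>\<omega>\<in>\<Omega>. if \<omega> \<in> S then K else 0)"
      using fin(1) by (simp flip: sum.inter_filter)
  qed simp
  also have "\<dots> = (\<Sum>\<omega>\<in>\<Omega>. \<Sum>S\<in>\<F>. if \<omega> \<in> S then K else 0)" by (rule sum.swap)
  also have "\<dots> = (\<Sum>\<omega>\<in>\<Omega>. K * card {S \<in> \<F>. \<omega> \<in> S})"
    using fin(3) by (intro sum.cong) (simp_all flip: sum.inter_filter)
  also have "\<dots> < (\<Sum>\<omega>\<in>\<Omega>. card \<F>)"
    using neg fin by (intro sum_strict_mono) (auto simp: not_le)
  finally show False by (simp add: mult.commute)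
qed

text \<open>Each new point is chosen popular among the sets not yet hit, which leaves at most the
  fraction \<open>K / (K + 1)\<close> of them.\<close>

lemma greedy_hitting:
  assumes fin: "finite \<Omega>" "\<Omega> \<noteq> {}" "finite \<F>"
    and sub: "\<And>S. S \<in> \<F> \<Longrightarrow> S \<subseteq> \<Omega>" and large: "\<And>S. S \<in> \<F> \<Longrightarrow> card \<Omega> \<le> Suc K * card S"
  shows "\<exists>f. (\<forall>i. f i \<in> \<Omega>) \<and> Suc K ^ n * card {S \<in> \<F>. \<forall>i<n. f i \<notin> S} \<le> K ^ n * card \<F>"
proof (induction n)
  case 0
  then show ?case using fin(2) by auto
next
  case (Suc n)
  then obtain f where f: "\<forall>i. f i \<in> \<Omega>"
    "Suc K ^ n * card {S \<in> \<F>. \<forall>i<n. f i \<notin> S} \<le> K ^ n * card \<F>" by blast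
  define R where "R = {S \<in> \<F>. \<forall>i<n. f i \<notin> S}"
  have "finite R" using fin by (simp add: R_def)
  then obtain \<omega> where \<omega>: "\<omega> \<in> \<Omega>" "card R \<le> Suc K * card {S \<in> R. \<omega> \<in> S}"
    using exists_popular_point[OF fin(1,2), of R "Suc K"] sub large unfolding R_def by blast
  have eq: "{S \<in> \<F>. \<forall>i<Suc n. (f(n := \<omega>)) i \<notin> S} = {S \<in> R. \<omega> \<notin> S}"
    by (auto simp: R_def less_Suc_eq)
  have "R = {S \<in> R. \<omega> \<in> S} \<union> {S \<in> R. \<omega> \<notin> S}" by blast
  then have "card R = card {S \<in> R. \<omega> \<in> S} + card {S \<in> R. \<omega> \<notin> S}"
    using \<open>finite R\<close> by (metis (no_types, lifting) card_Un_disjoint disjoint_iff finite_Un mem_Collect_eq)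
  then have "Suc K * card {S \<in> R. \<omega> \<notin> S} \<le> K * card R"
    using \<omega>(2) by (simp add: algebra_simps)
  then have "Suc K ^ n * (Suc K * card {S \<in> R. \<omega> \<notin> S}) \<le> Suc K ^ n * (K * card R)"
    by (rule mult_le_mono2)
  also have "\<dots> \<le> K * (K ^ n * card \<F>)"
    using f(2) by (simp add: R_def algebra_simps)
  finally have "Suc K ^ Suc n * card {S \<in> \<F>. \<forall>i<Suc n. (f(n := \<omega>)) i \<notin> S} \<le> K ^ Suc n * card \<F>"
    unfolding eq by (simp add: algebra_simps)
  moreover have "\<forall>i. (f(n := \<omega>)) i \<in> \<Omega>" using f(1) \<omega>(1) by simp
  ultimately show ?case by blast
qed

text \<open>By Bernoulli \<open>(256 / 255) ^ 256 > 2\<close>. This is why \<open>512 * N\<close>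
  greedy choices beat \<open>4 ^ N\<close> sets of density \<open>1 / 256\<close>.\<close>

lemma four_times_255_power: "4 * 255 ^ 512 < (256 :: nat) ^ 512"
proof -
  have "1 + real 256 * (1 / 255) \<le> (1 + 1 / 255) ^ 256"
    by (rule Bernoulli_inequality) simp
  then have "2 < (256 / 255 :: real) ^ 256" by simp
  then have "2\<^sup>2 < ((256 / 255 :: real) ^ 256)\<^sup>2" by (rule power_strict_mono) auto
  then have "4 < (256 / 255 :: real) ^ 512" by (simp flip: power_mult)
  then have "4 * 255 ^ 512 < (256 :: real) ^ 512"
    unfolding power_divide by (simp only: pos_less_divide_eq zero_less_power zero_less_numeral)
  then have "real (4 * 255 ^ 512) < real (256 ^ 512)" by (simp only: of_nat_mult of_nat_power of_nat_numeral)
  then show ?thesis by (simp only: of_nat_less_iff)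
qed

text \<open>A pair also counts if one of its ends lies in both \<open>A\<close> and
  \<open>B\<close>; only for disjoint sets is an edge between them demanded.\<close>

definition expanding_pairs :: "nat \<Rightarrow> nat \<Rightarrow> (nat \<Rightarrow> nat) \<Rightarrow> (nat \<Rightarrow> nat) \<Rightarrow> bool" where
  "expanding_pairs N c U W \<longleftrightarrow>
     (\<forall>A B. A \<subseteq> {..<N} \<longrightarrow> B \<subseteq> {..<N} \<longrightarrow> N \<le> 16 * card A \<longrightarrow> N \<le> 16 * card B \<longrightarrow>
        (\<exists>i\<le>c. {U i, W i} \<inter> A \<noteq> {} \<and> {U i, W i} \<inter> B \<noteq> {}))"

text \<open>
  The pair number \<open>0\<close> is kept free for two strands that are adjacent before the first cross-cap.
\<close>

lemma expanding_pairs_exist: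
  assumes "2 \<le> N"
  shows "\<exists>U W. expanding_pairs N (512 * N) U W \<and> (\<forall>i. U i < N \<and> W i < N \<and> U i \<noteq> W i) \<and> U 0 = 0 \<and> W 0 = 1"
proof -
  define \<Omega> where "\<Omega> = {..<N} \<times> {..<N}"
  define \<A> where "\<A> = {A. A \<subseteq> {..<N} \<and> N \<le> 16 * card A}"
  \<comment> \<open>The rectangles to be hit by pairs: each fills at least \<open>1 / 256\<close> of
    the square \<open>\<Omega>\<close>, and there are at most \<open>4 ^ N\<close>.\<close>
  define \<F> where "\<F> = (\<lambda>(A, B). A \<times> B) ` (\<A> \<times> \<A>)"
  have \<A>: "finite \<A>" "card \<A> \<le> 2 ^ N"
  proof -
    have "\<A> \<subseteq> Pow {..<N}" by (auto simp: \<A>_def)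
    then show "finite \<A>" "card \<A> \<le> 2 ^ N"
      using finite_subset card_mono[of "Pow {..<N}" \<A>] by (auto simp: card_Pow)
  qed
  have "card \<F> \<le> card (\<A> \<times> \<A>)" unfolding \<F>_def by (rule card_image_le) (simp add: \<A>)
  also have "\<dots> \<le> 2 ^ N * 2 ^ N" using \<A>(2) by (simp add: card_cartesian_product mult_le_mono)
  finally have card_F: "card \<F> \<le> 4 ^ N" by (simp flip: power_mult_distrib)
  have fin: "finite \<Omega>" "\<Omega> \<noteq> {}" "finite \<F>" using assms \<A> by (auto simp: \<Omega>_def \<F>_def lessThan_empty_iff)
  have sub: "S \<subseteq> \<Omega>" if "S \<in> \<F>" for S using that by (auto simp: \<F>_def \<A>_def \<Omega>_def)
  have large: "card \<Omega> \<le> Suc 255 * card S" if S: "S \<in> \<F>" for S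
  proof -
    obtain A B where AB: "S = A \<times> B" "N \<le> 16 * card A" "N \<le> 16 * card B" using S by (auto simp: \<F>_def \<A>_def)
    then have "N * N \<le> (16 * card A) * (16 * card B)" by (intro mult_le_mono)
    then show ?thesis by (simp add: AB(1) \<Omega>_def card_cartesian_product)
  qed
  obtain f where f: "\<And>i. f i \<in> \<Omega>"
    "256 ^ (512 * N) * card {S \<in> \<F>. \<forall>i<512 * N. f i \<notin> S} \<le> 255 ^ (512 * N) * card \<F>"
    using greedy_hitting[OF fin sub large, of "512 * N"] by auto
  have hit: "\<exists>i<512 * N. f i \<in> S" if S: "S \<in> \<F>" for S
  proof (rule ccontr)
    assume "\<not> ?thesis"
    then have "{S \<in> \<F>. \<forall>i<512 * N. f i \<notin> S} \<noteq> {}" using S by blast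
    then have "1 \<le> card {S \<in> \<F>. \<forall>i<512 * N. f i \<notin> S}" using fin(3) by (simp add: Suc_leI card_gt_0_iff)
    from mult_le_mono2[OF this, of "256 ^ (512 * N)"]
    have "256 ^ (512 * N) \<le> 256 ^ (512 * N) * card {S \<in> \<F>. \<forall>i<512 * N. f i \<notin> S}" by (simp only: mult_1_right)
    also have "\<dots> \<le> 255 ^ (512 * N) * card \<F>" by (rule f(2))
    also have "\<dots> \<le> 255 ^ (512 * N) * 4 ^ N" using card_F by (rule mult_le_mono2)
    also have "\<dots> = (4 * 255 ^ 512) ^ N"
      unfolding power_mult power_mult_distrib by (rule mult.commute)
    also have "\<dots> < (256 ^ 512) ^ N"
    proof (rule power_strict_mono[OF four_times_255_power])
      show "0 < N" using assms by linarith
    qed (rule zero_le)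
    also have "\<dots> = 256 ^ (512 * N)" by (rule power_mult[symmetric])
    finally show False by (simp only: less_irrefl)
  qed
  define U where "U i = (if i = 0 then 0 else fst (f (i - 1)))" for i
  \<comment> \<open>A diagonal choice \<open>(x, x)\<close> only hits rectangles with
    \<open>x\<close> in both sides, so any other strand may serve as the second end.\<close>
  define W where "W i = (if i = 0 then 1 else if fst (f (i - 1)) \<noteq> snd (f (i - 1)) then snd (f (i - 1))
    else if fst (f (i - 1)) = 0 then 1 else 0)" for i
  have "fst (f i) < N \<and> snd (f i) < N" for i using f(1)[of i] by (auto simp: \<Omega>_def)
  then have "U i < N \<and> W i < N \<and> U i \<noteq> W i" for i using assms by (auto simp: U_def W_def)
  moreover have "expanding_pairs N (512 * N) U W"
    unfolding expanding_pairs_def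
  proof (intro allI impI)
    fix A B assume "A \<subseteq> {..<N}" "B \<subseteq> {..<N}" "N \<le> 16 * card A" "N \<le> 16 * card B"
    then have "(A, B) \<in> \<A> \<times> \<A>" by (simp add: \<A>_def)
    then have "A \<times> B \<in> \<F>" unfolding \<F>_def by (rule rev_image_eqI) simp
    from hit[OF this] obtain i where i: "i < 512 * N" "f i \<in> A \<times> B" by (elim exE conjE)
    obtain x y where xy: "f i = (x, y)" by fastforce
    then have "x \<in> A" "y \<in> B" using i(2) by auto
    moreover have "U (Suc i) = x" "y = x \<or> W (Suc i) = y" by (simp_all add: U_def W_def xy)
    ultimately have "{U (Suc i), W (Suc i)} \<inter> A \<noteq> {} \<and> {U (Suc i), W (Suc i)} \<inter> B \<noteq> {}"
      by blast
    then show "\<exists>i\<le>512 * N. {U i, W i} \<inter> A \<noteq> {} \<and> {U i, W i} \<inter> B \<noteq> {}"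
      using i(1) by (intro exI[of _ "Suc i"]) auto
  qed
  moreover have "U 0 = 0" "W 0 = 1" by (simp_all add: U_def W_def)
  ultimately show ?thesis by blast
qed

lemma expanding_pairs_two: "expanding_pairs 2 0 (\<lambda>_. 0) (\<lambda>_. 1)"
proof -
  have "{0, 1} \<inter> A \<noteq> {}" if "A \<subseteq> {..<2}" "2 \<le> 16 * card A" for A :: "nat set"
  proof -
    have "A \<noteq> {}" using that(2) by auto
    then show ?thesis using that(1) by (auto simp: subset_iff less_2_cases_iff)
  qed
  then show ?thesis by (auto simp: expanding_pairs_def)
qed

text \<open>The unions of components of the subgraph induced by \<open>H\<close>, described without
  mentioning components.\<close>

definition closed_in :: "'a set set \<Rightarrow> 'a set \<Rightarrow> 'a set \<Rightarrow> bool" where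
  "closed_in E H A \<longleftrightarrow> A \<subseteq> H \<and> (\<forall>u\<in>A. \<forall>w\<in>H. {u, w} \<in> E \<longrightarrow> w \<in> A)"

lemma closed_in_Diff: "closed_in E H A \<Longrightarrow> closed_in E H B \<Longrightarrow> closed_in E H (A - B)"
  unfolding closed_in_def by (metis DiffD1 DiffD2 DiffI insert_commute subset_iff)

lemma closed_in_self: "closed_in E H H"
  by (simp add: closed_in_def)

text \<open>Take a smallest closed set of weight more than \<open>\<alpha>\<close>; by
  \<open>cut\<close> it misses at most \<open>\<alpha>\<close> of the weight. If disconnected, it
  would split into two smaller closed sets, each of weight at most \<open>\<alpha>\<close>, and
  \<open>f H\<close> would be at most \<open>3 * \<alpha>\<close>.\<close>

lemma connected_heavy_part:
  fixes f :: "'a set \<Rightarrow> nat"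
  assumes fin: "finite H"
    and add: "\<And>A B. closed_in E H A \<Longrightarrow> closed_in E H B \<Longrightarrow> B \<subseteq> A \<Longrightarrow> f A = f B + f (A - B)"
    and cut: "\<And>A. closed_in E H A \<Longrightarrow> f A \<le> \<alpha> \<or> f (H - A) \<le> \<alpha>"
    and big: "3 * \<alpha> < f H"
  shows "\<exists>A. closed_in E H A \<and> induces_connected A E \<and> f H \<le> f A + \<alpha>"
proof -
  define P where "P A \<longleftrightarrow> closed_in E H A \<and> \<alpha> < f A" for A
  have "P H" using closed_in_self big by (simp add: P_def)
  then obtain A where A: "P A" and min: "\<And>B. P B \<Longrightarrow> card A \<le> card B"
    using exists_least_iff[of "\<lambda>n. \<exists>A. P A \<and> card A = n"] by (metis not_le)
  have clo: "closed_in E H A" and "\<alpha> < f A" using A by (auto simp: P_def)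
  have AH: "A \<subseteq> H" using clo by (simp add: closed_in_def)
  then have finA: "finite A" using fin finite_subset by blast
  have fH: "f H = f A + f (H - A)" by (rule add[OF closed_in_self clo AH])
  then have heavy: "f H \<le> f A + \<alpha>" using cut[OF clo] \<open>\<alpha> < f A\<close> by linarith
  have "induces_connected A E"
  proof (rule ccontr)
    assume "\<not> induces_connected A E"
    moreover have "f {} = 0" using add[of "{}" "{}"] by (simp add: closed_in_def)
    then have "A \<noteq> {}" using \<open>\<alpha> < f A\<close> by auto
    ultimately obtain u v where uv: "u \<in> A" "v \<in> A" "(u, v) \<notin> {(x, y). x \<in> A \<and> y \<in> A \<and> {x, y} \<in> E}\<^sup>*"
      by (auto simp: induces_connected_def)
    let ?r = "{(x, y). x \<in> A \<and> y \<in> A \<and> {x, y} \<in> E}"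
    define B where "B = {w \<in> A. (u, w) \<in> ?r\<^sup>*}"
    have B: "closed_in E H B"
      unfolding closed_in_def
    proof (intro conjI ballI impI)
      show "B \<subseteq> H" using AH by (auto simp: B_def)
      fix x y assume xy: "x \<in> B" "y \<in> H" "{x, y} \<in> E"
      then have "x \<in> A" "(u, x) \<in> ?r\<^sup>*" by (auto simp: B_def)
      moreover have "y \<in> A" using clo xy(2,3) \<open>x \<in> A\<close> by (auto simp: closed_in_def)
      ultimately show "y \<in> B" using xy(3) by (auto simp: B_def intro: rtrancl_into_rtrancl)
    qed
    have "B \<subset> A" "A - B \<subset> A" using uv by (auto simp: B_def)
    then have "card B < card A" "card (A - B) < card A" using finA psubset_card_mono by blast+
    then have "\<not> P B" "\<not> P (A - B)" using min not_le by blast+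
    then have "f B \<le> \<alpha>" "f (A - B) \<le> \<alpha>" using B closed_in_Diff[OF clo B] by (auto simp: P_def)
    then have "f A \<le> 2 * \<alpha>" using add[OF clo B] \<open>B \<subset> A\<close> by auto
    then show False using heavy big by linarith
  qed
  then show ?thesis using clo heavy by blast
qed

lemma consecutive_constant:
  assumes inj: "\<And>v w. v \<in> V \<Longrightarrow> w \<in> V \<Longrightarrow> f v = f w \<Longrightarrow> g v = g w \<Longrightarrow> v = w"
    and step: "\<And>v w. consecutive V f g v w \<Longrightarrow> f v = l \<Longrightarrow> Q v = Q w"
    and "v \<in> V" "w \<in> V" "f v = l" "f w = l"
  shows "Q v = Q w"
proof -
  have *: "Q v = Q w" if "v \<in> V" "w \<in> V" "f v = l" "f w = l" "g v < g w" for v w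
    using that
  proof (induction "g w - g v" arbitrary: v w rule: less_induct)
    case less
    show ?case
    proof (cases "consecutive V f g v w")
      case True
      then show ?thesis using step less.prems by blast
    next
      case False
      then obtain u where "u \<in> V" "f u = l" "g v < g u" "g u < g w"
        using less.prems unfolding consecutive_def by auto
      then have "Q v = Q u" "Q u = Q w" using less.prems by (auto intro!: less.hyps)
      then show ?thesis by simp
    qed
  qed
  then show ?thesis
    using assms(3-) inj[of v w] by (cases "g v" "g w" rule: linorder_cases) (metis, metis, metis)
qed

section \<open>Routing strands through cross-caps\<close>

definition flip :: "nat \<Rightarrow> nat \<Rightarrow> nat \<Rightarrow> nat" where
  "flip lo hi p = (if p \<in> {lo..<hi} then lo + hi - 1 - p else p)"

lemma flip_flip [simp]: "flip lo hi (flip lo hi p) = p"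
  by (auto simp: flip_def)

lemma flip_less: "hi \<le> n \<Longrightarrow> p < n \<Longrightarrow> flip lo hi p < n"
  by (auto simp: flip_def)

lemma mult_add_div_mod:
  fixes i j n :: nat
  assumes "j < n"
  shows "(i * n + j) div n = i" "(i * n + j) mod n = j"
  using assms by auto

lemma mod_add_cancel:
  fixes x y k n :: nat
  assumes "(x + k) mod n = (y + k) mod n" "x < n" "y < n"
  shows "x = y"
proof -
  have "x = y" if "(x + k) mod n = (y + k) mod n" "x < n" "y < n" "x \<le> y" for x y
  proof -
    have "n dvd (y + k) - (x + k)" using that by (metis add_le_mono1 mod_eq_dvd_iff_nat)
    then have "n dvd y - x" by simp
    then have "y - x = 0" using that by (metis dvd_imp_le le_less_trans less_imp_diff_less linorder_not_less not_gr_zero)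
    then show ?thesis using that by simp
  qed
  from this[of x y] this[of y x] show ?thesis using assms by (cases "x \<le> y") auto
qed

lemma mod_add_solution:
  fixes x y m :: nat
  assumes "x < m"
  shows "((x + (m - y mod m)) mod m + y) mod m = x"
proof -
  have "((x + (m - y mod m)) mod m + y) mod m = (x + (m - y mod m) + y mod m) mod m"
    by (simp add: mod_add_left_eq mod_add_right_eq)
  also have "x + (m - y mod m) + y mod m = x + m"
    using mod_less_divisor[of m y] assms by linarith
  finally show ?thesis using assms by simp
qed

text \<open>Reversing an interval of whole strands reverses the strands as well as the lines inside
  each; division by \<open>Q\<close> sees only the former.\<close>

lemma flip_div:
  assumes "0 < Q"
  shows "flip (lo * Q) (hi * Q) p div Q = flip lo hi (p div Q)"
proof -
  have iff: "p \<in> {lo * Q..<hi * Q} \<longleftrightarrow> p div Q \<in> {lo..<hi}"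
    using assms by (simp add: less_eq_div_iff_mult_less_eq div_less_iff_less_mult)
  show ?thesis
  proof (cases "p div Q \<in> {lo..<hi}")
    case True
    define x y where "x = p div Q" and "y = p mod Q"
    have p: "p = x * Q + y" and y: "y < Q" and x: "lo \<le> x" "x < hi"
      using assms True by (simp_all add: x_def y_def)
    have "x \<le> lo + hi - 1" using x by linarith
    then obtain d where d: "lo + hi - 1 = x + d" using le_Suc_ex by blast
    then have "lo + hi = Suc (x + d)" using x by linarith
    then have "lo * Q + hi * Q = x * Q + d * Q + Q"
      by (metis add.commute add_mult_distrib mult_Suc)
    then have "lo * Q + hi * Q - 1 - p = d * Q + (Q - 1 - y)"
      using p y by linarith
    then have "(lo * Q + hi * Q - 1 - p) div Q = d" using y mult_add_div_mod(1)[of "Q - 1 - y" Q d] by simp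
    moreover have "lo + hi - 1 - x = d" using d by simp
    ultimately show ?thesis using True iff by (simp add: flip_def x_def)
  next
    case False
    then show ?thesis unfolding flip_def iff by (simp only: if_False)
  qed
qed

text \<open>
  Strand \<open>s\<close> consists of \<open>Q = m q\<close> parallel lines.  Before the pair \<open>U (i + 1), W (i + 1)\<close> is joined by
  the columns in the gap \<open>i + 1\<close>, a cross-cap makes its two strands adjacent by reversing the interval from
  the successor of the first to the second.
\<close>

locale routed_strands =
  fixes N c m q :: nat and U W :: "nat \<Rightarrow> nat"
  assumes m_pos: "0 < m" and q_pos: "0 < q"
    and UW: "U i < N" "W i < N" "U i \<noteq> W i" and UW_0: "U 0 = 0" "W 0 = 1"
begin

abbreviation "Q \<equiv> m * q"
abbreviation "L \<equiv> N * Q"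

primrec ord :: "nat \<Rightarrow> nat \<Rightarrow> nat" where
  "ord 0 s = s"
| "ord (Suc i) s = flip (Suc (min (ord i (U (Suc i))) (ord i (W (Suc i)))))
     (Suc (max (ord i (U (Suc i))) (ord i (W (Suc i))))) (ord i s)"

text \<open>No cross-cap precedes gap \<open>0\<close>; the default interval for
  \<open>j = 0\<close> merely fixes a scale for the heights and has to be nonempty.\<close>

definition lo :: "nat \<Rightarrow> nat" where
  "lo j = (case j of 0 \<Rightarrow> 0 | Suc i \<Rightarrow> Suc (min (ord i (U j)) (ord i (W j))))"

definition hi :: "nat \<Rightarrow> nat" where
  "hi j = (case j of 0 \<Rightarrow> 1 | Suc i \<Rightarrow> Suc (max (ord i (U j)) (ord i (W j))))"

lemma ord_Suc: "ord (Suc i) s = flip (lo (Suc i)) (hi (Suc i)) (ord i s)"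
  by (simp add: lo_def hi_def)

lemma ord_inj: "ord i s = ord i t \<longleftrightarrow> s = t"
proof (induction i)
  case (Suc i)
  then show ?case unfolding ord_Suc by (metis flip_flip)
qed simp

lemma ord_less: "s < N \<Longrightarrow> ord i s < N"
proof (induction i arbitrary: s)
  case (Suc i)
  then have "hi (Suc i) \<le> N" using UW by (simp add: hi_def Suc_le_eq)
  then show ?case unfolding ord_Suc using Suc by (intro flip_less)
qed simp

lemma lo_less_hi: "lo j < hi j"
proof (cases j)
  case (Suc i)
  have "ord i (U j) \<noteq> ord i (W j)" using UW by (simp add: ord_inj)
  then show ?thesis using Suc by (simp add: lo_def hi_def)
qed (simp add: lo_def hi_def)

definition base :: "nat \<Rightarrow> nat" where
  "base i = min (ord i (U i)) (ord i (W i))"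

text \<open>The strand at the smaller place stays put, just outside the reversed interval, while the
  other moves from the last place of the interval to the first. For \<open>i = 0\<close> the two are
  adjacent from the start.\<close>

lemma ord_pair: "{ord i (U i), ord i (W i)} = {base i, Suc (base i)}"
proof (cases i)
  case 0
  then show ?thesis using UW_0 by (auto simp: base_def)
next
  case (Suc j)
  define x y where "x = ord j (U i)" and "y = ord j (W i)"
  have "x \<noteq> y" using UW by (simp add: ord_inj x_def y_def)
  moreover have "lo i = Suc (min x y)" "hi i = Suc (max x y)" by (simp_all add: lo_def hi_def x_def y_def Suc)
  moreover have "ord i (U i) = flip (lo i) (hi i) x" "ord i (W i) = flip (lo i) (hi i) y"
    using ord_Suc by (simp_all add: x_def y_def Suc)
  ultimately show ?thesis by (cases "x < y") (auto simp: base_def flip_def)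
qed

lemma base_less: "Suc (base i) < N"
proof -
  have "Suc (base i) \<in> {ord i (U i), ord i (W i)}" unfolding ord_pair by simp
  then show ?thesis using ord_less UW by auto
qed

primrec pos :: "nat \<Rightarrow> nat \<Rightarrow> nat" where
  "pos 0 l = l"
| "pos (Suc i) l = flip (lo (Suc i) * Q) (hi (Suc i) * Q) (pos i l)"

lemma Q_pos: "0 < Q"
  using m_pos q_pos by simp

lemma L_pos': "0 < L"
  using Q_pos UW(1)[of 0] by simp

lemma pos_div: "pos i l div Q = ord i (l div Q)"
proof (induction i)
  case (Suc i)
  then show ?case unfolding pos.simps ord_Suc flip_div[OF Q_pos] by simp
qed simp

lemma pos_inj: "pos i l = pos i l' \<longleftrightarrow> l = l'"
proof (induction i)
  case (Suc i)
  then show ?case unfolding pos.simps by (metis flip_flip)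
qed simp

lemma pos_less: "l < L \<Longrightarrow> pos i l < L"
proof -
  assume "l < L"
  then have "pos i l div Q < N"
    unfolding pos_div by (intro ord_less less_mult_imp_div_less)
  then show ?thesis using Q_pos div_less_iff_less_mult by blast
qed

lemma pos_surj:
  assumes "p < L"
  obtains l where "l < L" "pos i l = p"
proof -
  have "pos i ` {..<L} = {..<L}"
    by (rule endo_inj_surj) (use pos_less pos_inj in \<open>auto simp: inj_on_def\<close>)
  then show ?thesis using assms that by (metis imageE lessThan_iff)
qed

sublocale line_arrangement c L "\<lambda>j. lo j * Q" "\<lambda>j. hi j * Q" pos
proof
  show "lo j * Q < hi j * Q" for j using lo_less_hi Q_pos by simp
  show "inj_on (pos i) {..<L}" for i using pos_inj by (auto simp: inj_on_def)
qed (simp add: flip_def)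

section \<open>Blocks and the choice of the vertices\<close>

definition in_block :: "nat \<Rightarrow> nat \<Rightarrow> bool" where
  "in_block i l \<longleftrightarrow> base i * Q \<le> pos i l \<and> pos i l < base i * Q + 2 * Q"

definition rel :: "nat \<Rightarrow> nat \<Rightarrow> nat" where
  "rel i l = pos i l - base i * Q"

text \<open>
  Every column meets one row of each band of \<open>m\<close> consecutive rows.  In the even bands all columns
  \<open>t\<close> with the same residue \<open>t mod m\<close> use the same row; in the odd bands the row also depends
  on the window \<open>t div m\<close> of the column.
\<close>

definition pat :: "nat \<Rightarrow> nat \<Rightarrow> bool" where
  "pat t \<rho> \<longleftrightarrow> t mod m = (if even (\<rho> div m) then \<rho> mod m else (\<rho> mod m + t div m) mod m)"

definition verts :: "nat set" where
  "verts = {v. v < (Suc c * Q) * L \<and> in_block (v div L div Q) (v mod L) \<and>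
     pat (v div L mod Q) (rel (v div L div Q) (v mod L))}"

sublocale line_drawing c L "\<lambda>j. lo j * Q" "\<lambda>j. hi j * Q" pos "Suc c * Q" "\<lambda>i. i div Q" verts
proof
  show "0 < L" by (rule L_pos')
  show "i div Q \<le> c" if "i < Suc c * Q" for i
    using less_mult_imp_div_less[OF that] by simp
qed (auto simp: verts_def div_le_mono)

lemma in_block_iff: "in_block i l \<longleftrightarrow> l div Q \<in> {U i, W i}"
proof -
  have "in_block i l \<longleftrightarrow> pos i l div Q \<in> {base i, Suc (base i)}"
  proof -
    have "base i * Q \<le> pos i l \<longleftrightarrow> base i \<le> pos i l div Q"
      using Q_pos by (simp add: less_eq_div_iff_mult_less_eq)
    moreover have "pos i l < base i * Q + 2 * Q \<longleftrightarrow> pos i l div Q < base i + 2"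
      using Q_pos div_less_iff_less_mult[of Q "pos i l" "base i + 2"] unfolding add_mult_distrib by simp
    ultimately show ?thesis unfolding in_block_def by auto
  qed
  also have "\<dots> \<longleftrightarrow> ord i (l div Q) \<in> {ord i (U i), ord i (W i)}"
    unfolding pos_div ord_pair ..
  finally show ?thesis by (simp add: ord_inj)
qed

lemma rel_less: "in_block i l \<Longrightarrow> rel i l < 2 * Q"
  by (auto simp: in_block_def rel_def)

lemma pos_rel: "in_block i l \<Longrightarrow> pos i l = base i * Q + rel i l"
  by (auto simp: in_block_def rel_def)

lemma rel_inj: "in_block i l \<Longrightarrow> in_block i l' \<Longrightarrow> rel i l = rel i l' \<longleftrightarrow> l = l'"
  using pos_rel[of i l] pos_rel[of i l'] pos_inj[of i l l'] by auto

lemma rel_surj: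
  assumes "\<rho> < 2 * Q"
  obtains l where "l < L" "in_block i l" "rel i l = \<rho>"
proof -
  have "(base i + 2) * Q \<le> N * Q" using base_less[of i] by (intro mult_le_mono1) simp
  then have "base i * Q + \<rho> < L" using assms by (simp add: algebra_simps)
  then obtain l where "l < L" "pos i l = base i * Q + \<rho>" using pos_surj by blast
  then show ?thesis using assms that[of l] by (simp add: in_block_def rel_def)
qed

lemma mk_vertex:
  assumes "l < L" "i < Suc c * Q"
  shows "(i * L + l) div L = i" "(i * L + l) mod L = l"
    "i * L + l \<in> verts \<longleftrightarrow> in_block (i div Q) l \<and> pat (i mod Q) (rel (i div Q) l)"
proof -
  show 1: "(i * L + l) div L = i" "(i * L + l) mod L = l" by (rule mult_add_div_mod[OF assms(1)])+
  have "(i + 1) * L \<le> (Suc c * Q) * L" using assms(2) by (intro mult_le_mono1) simp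
  then have "i * L + l < (Suc c * Q) * L" using assms(1) unfolding add_mult_distrib by linarith
  then show "i * L + l \<in> verts \<longleftrightarrow> in_block (i div Q) l \<and> pat (i mod Q) (rel (i div Q) l)"
    unfolding verts_def using 1 by simp
qed

lemma verts_iff:
  "v \<in> verts \<longleftrightarrow> v div L < Suc c * Q \<and> in_block (v div L div Q) (v mod L) \<and>
     pat (v div L mod Q) (rel (v div L div Q) (v mod L))"
  unfolding verts_def using L_pos' by (simp add: div_less_iff_less_mult)

lemma column_index:
  assumes "I < q" "j < m" "i \<le> c"
  shows "(i * q + I) * m + j < Suc c * Q" "((i * q + I) * m + j) div Q = i"
    "((i * q + I) * m + j) mod Q = I * m + j" "((i * q + I) * m + j) div m = i * q + I"
proof -
  let ?t = "(i * q + I) * m + j"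
  show m: "?t div m = i * q + I" using assms by simp
  then show Q: "?t div Q = i" using assms by (simp add: div_mult2_eq)
  show "?t mod Q = I * m + j" using assms m by (simp add: mod_mult2_eq)
  have "?t div Q < Suc c" using Q assms by simp
  then show "?t < Suc c * Q" using Q_pos div_less_iff_less_mult by blast
qed

text \<open>Given the row and the window, \<open>pat\<close> prescribes the residue of the column.
  Hence a row never passes a full window of its block without a vertex.\<close>

lemma row_window:
  assumes "i \<le> c" "l < L" "in_block i l" "I < q"
  obtains t where "t div m = i * q + I" "t * L + l \<in> verts" "t < Suc c * Q"
proof -
  let ?\<rho> = "rel i l"
  define j where "j = (if even (?\<rho> div m) then ?\<rho> mod m else (?\<rho> mod m + I) mod m)"
  have "j < m" using m_pos by (simp add: j_def)
  note t = column_index[OF assms(4) this assms(1)]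
  have "pat (I * m + j) ?\<rho>"
    unfolding pat_def mult_add_div_mod[OF \<open>j < m\<close>] by (simp add: j_def)
  then have "((i * q + I) * m + j) * L + l \<in> verts"
    using mk_vertex(3)[OF assms(2) t(1)] assms(3) t by simp
  then show ?thesis using that t by blast
qed

text \<open>Given the column, \<open>pat\<close> is a congruence for the residue of the row inside
  the band, solved in odd bands by subtracting the window number.\<close>

lemma column_window:
  assumes "t < Suc c * Q" "J < 2 * q"
  obtains l where "l < L" "in_block (t div Q) l" "rel (t div Q) l div m = J" "t * L + l \<in> verts"
proof -
  let ?t = "t mod Q"
  define j where "j = (if even J then ?t mod m else (?t mod m + (m - (?t div m) mod m)) mod m)"
  have j: "j < m" using m_pos by (simp add: j_def)
  have "(J + 1) * m \<le> 2 * q * m" using assms(2) by (intro mult_le_mono1) simp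
  then have "J * m + j < 2 * Q" using j by (simp add: algebra_simps)
  then obtain l where l: "l < L" "in_block (t div Q) l" "rel (t div Q) l = J * m + j"
    using rel_surj by blast
  note Jj = mult_add_div_mod[OF j, of J]
  have "even J \<or> (j + ?t div m) mod m = ?t mod m"
    using mod_add_solution[of "?t mod m" m "?t div m"] m_pos by (simp add: j_def)
  then have "pat ?t (J * m + j)"
    unfolding pat_def Jj by (auto simp: j_def)
  then have "t * L + l \<in> verts" using mk_vertex(3)[OF l(1) assms(1)] l by simp
  then show ?thesis using that l Jj(1) by simp
qed

lemma pat_unique:
  assumes "pat t \<rho>" "pat t \<rho>'" "\<rho> div m = \<rho>' div m"
  shows "\<rho> = \<rho>'"
proof -
  have "\<rho> mod m = \<rho>' mod m"
  proof (cases "even (\<rho> div m)")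
    case False
    then have "(\<rho> mod m + t div m) mod m = (\<rho>' mod m + t div m) mod m"
      using assms by (simp add: pat_def)
    then show ?thesis using mod_add_cancel m_pos by (meson mod_less_divisor)
  qed (use assms in \<open>simp add: pat_def\<close>)
  then show ?thesis using assms(3) by (metis div_mult_mod_eq)
qed

section \<open>Counting crossings and vertices\<close>

lemma ht_vertex: "v \<in> verts \<Longrightarrow> ht v = base (v div L div Q) * Q + rel (v div L div Q) (v mod L)"
  unfolding ht_def using pos_rel by (simp add: verts_iff)

text \<open>The vertices of a column stay within its block, so a crossing needs a block containing
  the row, and there the row has a vertex in every window. So crossings occur only in the windows of
  the two ends, each contributing at most \<open>m - 1\<close> columns.\<close>

lemma row_step_crossings:
  assumes step: "row_step v w"
  shows "card {i. v div L < i \<and> i < w div L \<and>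
    (\<exists>v' w'. col_step v' w' \<and> v' div L = i \<and> ht v' < pos (i div Q) (v mod L) \<and> pos (i div Q) (v mod L) < ht w')} \<le> 2 * m - 2"
    (is "card ?S \<le> _")
proof -
  let ?v = "v div L" and ?w = "w div L" and ?l = "v mod L"
  have "?S \<subseteq> {?v<..<(?v div m + 1) * m} \<union> {?w div m * m..<?w}"
  proof
    fix i assume "i \<in> ?S"
    then obtain v' w' where i: "?v < i" "i < ?w" and c: "col_step v' w'" "v' div L = i"
      "ht v' < pos (i div Q) ?l" "pos (i div Q) ?l < ht w'" by blast
    have V: "v' \<in> verts" "w' \<in> verts" "w' div L = i" using c by (auto simp: consecutive_def)
    have "in_block (i div Q) ?l"
      using c(3,4) ht_vertex[OF V(1)] ht_vertex[OF V(2)] V rel_less[of "i div Q" "w' mod L"] c(2)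
      by (auto simp: in_block_def[of _ ?l] verts_iff)
    have iM: "i div Q \<le> c" using col_less[OF V(1)] c(2) less_mult_imp_div_less[of i "Suc c" Q] by simp
    show "i \<in> {?v<..<(?v div m + 1) * m} \<union> {?w div m * m..<?w}"
    proof (cases "i div m = ?v div m \<or> i div m = ?w div m")
      case True
      have "i < (i div m + 1) * m" "i div m * m \<le> i" using m_pos by (simp_all add: dividend_less_div_times)
      then have "i < (?v div m + 1) * m \<or> ?w div m * m \<le> i" using True by metis
      then show ?thesis using i by auto
    next
      case False
      have "i div m div q = i div Q" by (simp add: div_mult2_eq)
      then have eq: "i div m = i div Q * q + i div m mod q" by (metis div_mult_mod_eq)
      obtain t where t: "t div m = i div m" "t * L + ?l \<in> verts" "t < Suc c * Q"
        using row_window[OF iM row_less \<open>in_block (i div Q) ?l\<close>, of "i div m mod q"] q_pos eq by auto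
      have "?v div m \<le> i div m" "i div m \<le> ?w div m" using i by (simp_all add: div_le_mono)
      then have "?v div m < t div m" "t div m < ?w div m" using False t(1) by auto
      then have "?v < t" "t < ?w" by (meson div_le_mono not_less)+
      then show ?thesis
        using step t mk_vertex(1,2)[OF row_less t(3), of v] unfolding consecutive_def by metis
    qed
  qed
  then have "card ?S \<le> card ({?v<..<(?v div m + 1) * m} \<union> {?w div m * m..<?w})"
    by (intro card_mono) auto
  also have "\<dots> \<le> card {?v<..<(?v div m + 1) * m} + card {?w div m * m..<?w}" by (rule card_Un_le)
  also have "\<dots> \<le> (m - 1) + (m - 1)"
  proof (rule add_mono)
    have "?v div m * m \<le> ?v" by simp
    then show "card {?v<..<(?v div m + 1) * m} \<le> m - 1"
      unfolding card_greaterThanLessThan add_mult_distrib by linarith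
    have "?w - ?w div m * m = ?w mod m" by (metis minus_div_mult_eq_mod)
    then show "card {?w div m * m..<?w} \<le> m - 1"
      unfolding card_atLeastLessThan using mod_less_divisor[OF m_pos, of ?w] by linarith
  qed
  finally show ?thesis by simp
qed

text \<open>A column has a vertex in every band, so consecutive ones lie in the same or in adjacent
  bands, less than \<open>2 * m\<close> rows apart.\<close>

lemma col_step_height:
  assumes step: "col_step v w"
  shows "ht w \<le> ht v + (2 * m - 1)"
proof -
  let ?t = "v div L" and ?i = "v div L div Q"
  have V: "v \<in> verts" "w \<in> verts" "w div L = ?t" using step by (auto simp: consecutive_def)
  let ?x = "rel ?i (v mod L)" and ?y = "rel ?i (w mod L)"
  have ht: "ht v = base ?i * Q + ?x" "ht w = base ?i * Q + ?y"
    using ht_vertex[OF V(1)] ht_vertex[OF V(2)] V(3) by simp_all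
  have "?y div m \<le> ?x div m + 1"
  proof (rule ccontr)
    assume neg: "\<not> ?thesis"
    have "?y < 2 * Q" using rel_less V by (simp add: verts_iff)
    then have "?y div m < 2 * q" using m_pos by (simp add: div_less_iff_less_mult algebra_simps)
    then obtain l where l: "l < L" "in_block ?i l" "rel ?i l div m = ?x div m + 1" "?t * L + l \<in> verts"
      using column_window[of ?t "?x div m + 1"] col_less[OF V(1)] neg by auto
    note mk = mk_vertex(1,2)[OF l(1) col_less[OF V(1)]]
    have "?x < rel ?i l" "rel ?i l < ?y"
      using l(3) neg by (metis add.commute div_le_mono le_add2 less_add_one not_less, metis div_le_mono not_less not_le_imp_less)
    then have "ht v < ht (?t * L + l)" "ht (?t * L + l) < ht w"
      using ht ht_vertex[OF l(4)] mk by simp_all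
    then show False using step l(4) mk unfolding consecutive_def by metis
  qed
  moreover have "?y < (?y div m + 1) * m" "?x div m * m \<le> ?x"
    using m_pos by (simp_all add: dividend_less_div_times)
  ultimately have "?y < (?x div m + 1 + 1) * m" "?x div m * m \<le> ?x"
    using mult_le_mono1[of "?y div m + 1" "?x div m + 1 + 1" m] by linarith+
  then have "?y < ?x + 2 * m" unfolding add_mult_distrib by linarith
  then show ?thesis using ht m_pos by linarith
qed

lemma gk_planar_verts:
  assumes "2 * m - 2 \<le> k" "c \<le> g"
  shows "gk_planar g k verts edges"
proof (rule gk_planar_edges[OF _ _ assms(2)])
  show "ht w \<le> ht v + Suc k" if "col_step v w" for v w
    using col_step_height[OF that] assms(1) m_pos by linarith
qed (use row_step_crossings assms(1) le_trans in blast)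

text \<open>By \<open>pat_unique\<close> a column has at most one vertex in each of the
  \<open>2 * q\<close> bands of its block.\<close>

lemma card_verts: "card verts \<le> (Suc c * Q) * (2 * q)"
proof -
  let ?h = "\<lambda>v. (v div L, rel (v div L div Q) (v mod L) div m)"
  have "inj_on ?h verts"
  proof (rule inj_onI)
    fix v w assume *: "v \<in> verts" "w \<in> verts" "?h v = ?h w"
    let ?i = "v div L div Q"
    have col: "w div L = v div L" using *(3) by simp
    have band: "rel ?i (v mod L) div m = rel ?i (w mod L) div m" using *(3) col by (metis prod.inject)
    have "in_block ?i (v mod L)" "in_block ?i (w mod L)"
      "pat (v div L mod Q) (rel ?i (v mod L))" "pat (v div L mod Q) (rel ?i (w mod L))"
      using *(1,2) col unfolding verts_iff by metis+
    then have "v mod L = w mod L" using pat_unique band rel_inj by metis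
    then show "v = w" using vertex_eqI col by metis
  qed
  moreover have "?h ` verts \<subseteq> {..<Suc c * Q} \<times> {..<2 * q}"
  proof
    fix p assume "p \<in> ?h ` verts"
    then obtain v where v: "v \<in> verts" "p = ?h v" by blast
    have "rel (v div L div Q) (v mod L) < 2 * q * m" using rel_less v(1) by (simp add: verts_iff algebra_simps)
    then show "p \<in> {..<Suc c * Q} \<times> {..<2 * q}"
      using v m_pos by (simp add: verts_iff div_less_iff_less_mult)
  qed
  moreover have "finite ({..<Suc c * Q} \<times> {..<2 * q})" by simp
  ultimately have "card verts \<le> card ({..<Suc c * Q} \<times> {..<2 * q})"
    by (rule card_inj_on_le)
  then show ?thesis by (simp only: card_cartesian_product card_lessThan)
qed

end

section \<open>Connectivity after deleting few vertices\<close>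

lemma closed_in_edge:
  assumes "closed_in E H A" "{v, w} \<in> E" "v \<in> H" "w \<in> H"
  shows "v \<in> A \<longleftrightarrow> w \<in> A"
proof -
  have "{w, v} \<in> E" using assms(2) by (simp add: insert_commute)
  then show ?thesis using assms unfolding closed_in_def by blast
qed

lemma card_fibres_le:
  assumes "finite S" "finite D" "\<And>x. x \<in> D \<Longrightarrow> K \<le> n * card {l \<in> S. f l = x}"
  shows "card D * K \<le> n * card S"
proof -
  have "card D * K = (\<Sum>x\<in>D. K)" by simp
  also have "\<dots> \<le> (\<Sum>x\<in>D. n * card {l \<in> S. f l = x})" by (rule sum_mono) (rule assms(3))
  also have "\<dots> = n * (\<Sum>x\<in>D. card {l \<in> S. f l = x})" by (simp add: sum_distrib_left)
  also have "(\<Sum>x\<in>D. card {l \<in> S. f l = x}) = card (\<Union>x\<in>D. {l \<in> S. f l = x})"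
    by (rule card_UN_disjoint[symmetric]) (use assms in auto)
  also have "n * \<dots> \<le> n * card S" using assms(1) by (intro mult_le_mono2 card_mono) auto
  finally show ?thesis .
qed

text \<open>By \<open>q_eq\<close> the windows of a block run \<open>r\<close> times through all
  shifts modulo \<open>m\<close>; by \<open>q_even\<close> each strand has as many even as odd
  bands. The factor \<open>65536\<close> allows for the losses \<open>16\<close> and
  \<open>1024\<close> at damaged strands and blocks.\<close>

locale expanding_strands = routed_strands +
  fixes r s :: nat
  assumes q_eq: "q = m * r" and q_even: "even q"
    and expanding: "expanding_pairs N c U W"
    and s_le: "65536 * s \<le> L"
begin

section \<open>Expansion within one block\<close>

lemma card_residues:
  assumes "\<And>\<rho>. \<rho> \<in> A \<Longrightarrow> \<rho> < 2 * Q \<and> \<rho> div m mod 2 = \<epsilon>" "Q \<le> 32 * card A"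
  shows "m \<le> 32 * card ((\<lambda>\<rho>. \<rho> mod m) ` A)"
proof -
  let ?E = "(\<lambda>\<rho>. \<rho> mod m) ` A"
  have finA: "finite A" using assms(1) by (intro finite_subset[of A "{..<2 * Q}"]) auto
  \<comment> \<open>A row is determined by its residue and its band, and there are \<open>q\<close>
    bands of parity \<open>\<epsilon>\<close>, so each residue accounts for at most \<open>q\<close>
    rows.\<close>
  have "A \<subseteq> (\<lambda>(y, e). (2 * y + \<epsilon>) * m + e) ` ({..<q} \<times> ?E)"
  proof
    fix \<rho> assume \<rho>: "\<rho> \<in> A"
    have "\<rho> < 2 * q * m" using assms(1)[OF \<rho>] by (simp add: algebra_simps)
    then have "\<rho> div m < 2 * q" using m_pos by (simp add: div_less_iff_less_mult)
    then have "\<rho> div m div 2 < q" by simp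
    moreover have "\<rho> = (2 * (\<rho> div m div 2) + \<epsilon>) * m + \<rho> mod m"
      using assms(1)[OF \<rho>] by (metis div_mult_mod_eq mult.commute)
    ultimately show "\<rho> \<in> (\<lambda>(y, e). (2 * y + \<epsilon>) * m + e) ` ({..<q} \<times> ?E)"
      using \<rho> by (intro image_eqI[of _ _ "(\<rho> div m div 2, \<rho> mod m)"]) auto
  qed
  then have "card A \<le> card ({..<q} \<times> ?E)"
    using finA by (meson card_image_le card_mono finite_SigmaI finite_imageI finite_lessThan le_trans)
  then have "card A \<le> q * card ?E" by (simp only: card_cartesian_product card_lessThan)
  then have "m * q \<le> 32 * (q * card ?E)" using assms(2) by linarith
  then have "q * m \<le> q * (32 * card ?E)" by (simp only: mult.commute mult.left_commute)
  then show ?thesis using q_pos by simp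
qed

text \<open>Rows of residue \<open>e\<close> in an even band and \<open>f\<close> in an odd band
  share the columns of residue \<open>e\<close> in the \<open>r\<close> windows congruent to
  \<open>e - f\<close>. All these columns lie in \<open>K\<close>; there are at least
  \<open>m / 32\<close> values of \<open>e\<close> and of \<open>f\<close>, and
  \<open>m * m * r = Q\<close>.\<close>

lemma even_odd_bands:
  assumes A: "\<And>\<rho>. \<rho> \<in> A \<Longrightarrow> \<rho> < 2 * Q \<and> \<rho> div m mod 2 = 0" "Q \<le> 32 * card A"
    and B: "\<And>\<rho>. \<rho> \<in> B \<Longrightarrow> \<rho> < 2 * Q \<and> \<rho> div m mod 2 = 1" "Q \<le> 32 * card B"
    and K: "finite K" "\<And>t a b. t < Q \<Longrightarrow> t \<notin> K \<Longrightarrow> a \<in> A \<Longrightarrow> b \<in> B \<Longrightarrow> pat t a \<Longrightarrow> pat t b \<Longrightarrow> False"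
  shows "Q \<le> 1024 * card K"
proof -
  define E F where "E = (\<lambda>\<rho>. \<rho> mod m) ` A" and "F = (\<lambda>\<rho>. \<rho> mod m) ` B"
  \<comment> \<open>The \<open>k\<close>-th window congruent to \<open>e - f\<close> modulo
    \<open>m\<close>; adding \<open>m - f\<close> avoids truncated subtraction.\<close>
  define win where "win e f k = k * m + (e + (m - f)) mod m" for e f k
  define h where "h = (\<lambda>(e, f, k). win e f k * m + e)"
  have lt: "e < m" "f < m" if "e \<in> E" "f \<in> F" for e f
    using that m_pos by (auto simp: E_def F_def)
  have solve: "(f + win e f k) mod m = e" if "e < m" "f < m" for e f k
  proof -
    have "f + win e f k = f + (e + (m - f)) mod m + k * m"
      by (simp add: win_def)
    then have "(f + win e f k) mod m = (f + (e + (m - f))) mod m"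
      by (simp only: mod_mult_self1 mod_add_right_eq)
    also have "f + (e + (m - f)) = e + m" using that by simp
    finally show ?thesis using that by simp
  qed
  have inj: "inj_on h (E \<times> F \<times> {..<r})"
  proof (rule inj_onI)
    fix p p' assume "p \<in> E \<times> F \<times> {..<r}" "p' \<in> E \<times> F \<times> {..<r}" and eq: "h p = h p'"
    then obtain e f k e' f' k' where p: "p = (e, f, k)" "p' = (e', f', k')"
      "e \<in> E" "f \<in> F" "e' \<in> E" "f' \<in> F" by auto
    note l = lt[OF p(3,4)] lt[OF p(5,6)]
    have ew: "e = e'" "win e f k = win e' f' k'"
      using eq mult_add_div_mod[OF l(1), of "win e f k"] mult_add_div_mod[OF l(3), of "win e' f' k'"]
      by (simp_all add: h_def p)
    moreover have "(f + win e f k) mod m = (f' + win e f k) mod m"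
      using solve[OF l(1,2), of k] solve[OF l(3,4), of k'] ew by metis
    then have "f = f'" using l(2,4) by (rule mod_add_cancel)
    moreover have "win e f k div m = k" "win e' f' k' div m = k'"
      unfolding win_def by (rule mult_add_div_mod(1)[OF mod_less_divisor[OF m_pos]])+
    then have "k = k'" using ew(2) by metis
    ultimately show "p = p'" using ew(1) unfolding p by blast
  qed
  have sub: "h ` (E \<times> F \<times> {..<r}) \<subseteq> K"
  proof
    fix t assume "t \<in> h ` (E \<times> F \<times> {..<r})"
    then obtain e f k where t: "t = win e f k * m + e" "e \<in> E" "f \<in> F" "k < r" by (auto simp: h_def)
    note l = lt[OF t(2,3)]
    obtain a where a: "a \<in> A" "a mod m = e" using t(2) by (auto simp: E_def)
    obtain b where b: "b \<in> B" "b mod m = f" using t(3) by (auto simp: F_def)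
    have tm: "t div m = win e f k" "t mod m = e" unfolding t(1) using mult_add_div_mod[OF l(1)] by auto
    have "(k + 1) * m \<le> q" using t(4) mult_le_mono2[of "k + 1" r m] by (simp add: q_eq mult.commute)
    moreover have "win e f k < (k + 1) * m"
      using mod_less_divisor[OF m_pos, of "e + (m - f)"] unfolding win_def add_mult_distrib by simp
    ultimately have "t div m < q" using tm by linarith
    then have "t < Q" using m_pos by (simp add: div_less_iff_less_mult mult.commute)
    moreover have "even (a div m)" using A(1)[OF a(1)] by presburger
    then have "pat t a" by (simp add: pat_def tm a)
    moreover have "odd (b div m)" using B(1)[OF b(1)] by presburger
    then have "pat t b" by (simp add: pat_def tm b solve l)
    ultimately show "t \<in> K" using K(2) a(1) b(1) by blast
  qed
  have "card (E \<times> F \<times> {..<r}) \<le> card K"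
    using inj sub K(1) by (rule card_inj_on_le)
  then have K_ge: "card E * (card F * r) \<le> card K" by (simp add: card_cartesian_product)
  have "m \<le> 32 * card E" unfolding E_def by (rule card_residues[OF A])
  moreover have "m \<le> 32 * card F" unfolding F_def by (rule card_residues[OF B])
  ultimately have "m * (m * r) \<le> (32 * card E) * ((32 * card F) * r)"
    by (intro mult_le_mono) auto
  also have "\<dots> = 1024 * (card E * (card F * r))" by simp
  also have "\<dots> \<le> 1024 * card K" using K_ge by simp
  finally show ?thesis by (simp add: q_eq)
qed

text \<open>An even and an odd part are needed for a common column. Each of \<open>A\<close> and
  \<open>B\<close> is large in some parity, and each parity is large in \<open>A\<close> or in
  \<open>B\<close>; this forces one set to be large in the even and the other in the odd
  bands.\<close>

lemma block_expands:
  assumes sub: "A \<subseteq> {..<2 * Q}" "B \<subseteq> {..<2 * Q}" and large: "Q \<le> 16 * card A" "Q \<le> 16 * card B"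
    and par: "\<And>\<epsilon>. \<epsilon> < 2 \<Longrightarrow> Q \<le> 16 * card {\<rho> \<in> A \<union> B. \<rho> div m mod 2 = \<epsilon>}"
    and K: "finite K" "\<And>t a b. t < Q \<Longrightarrow> t \<notin> K \<Longrightarrow> a \<in> A \<Longrightarrow> b \<in> B \<Longrightarrow> pat t a \<Longrightarrow> pat t b \<Longrightarrow> False"
  shows "Q \<le> 1024 * card K"
proof (rule ccontr)
  assume neg: "\<not> ?thesis"
  define P where "P S \<epsilon> = {\<rho> \<in> S. \<rho> div m mod 2 = \<epsilon>}" for S \<epsilon>
  have fin: "finite A" "finite B" using sub finite_subset by blast+
  have split: "card S = card (P S 0) + card (P S 1)" if "finite S" for S
  proof -
    have "card (P S 0 \<union> P S 1) = card (P S 0) + card (P S 1)"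
      using that by (intro card_Un_disjoint) (auto simp: P_def)
    moreover have "P S 0 \<union> P S 1 = S" by (auto simp: P_def)
    ultimately show ?thesis by simp
  qed
  have tot: "Q \<le> 16 * (card (P A \<epsilon>) + card (P B \<epsilon>))" if "\<epsilon> < 2" for \<epsilon>
  proof -
    have "{\<rho> \<in> A \<union> B. \<rho> div m mod 2 = \<epsilon>} = P A \<epsilon> \<union> P B \<epsilon>" by (auto simp: P_def)
    then show ?thesis using par[OF that] card_Un_le[of "P A \<epsilon>" "P B \<epsilon>"] by simp
  qed
  have no: "\<not> (Q \<le> 32 * card (P S 0) \<and> Q \<le> 32 * card (P T 1))"
    if ST: "S \<subseteq> {..<2 * Q}" "T \<subseteq> {..<2 * Q}"
      "\<And>t a b. t < Q \<Longrightarrow> t \<notin> K \<Longrightarrow> a \<in> S \<Longrightarrow> b \<in> T \<Longrightarrow> pat t a \<Longrightarrow> pat t b \<Longrightarrow> False" for S T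
  proof
    assume *: "Q \<le> 32 * card (P S 0) \<and> Q \<le> 32 * card (P T 1)"
    have "Q \<le> 1024 * card K"
    proof (rule even_odd_bands[of "P S 0" "P T 1"])
      show False if "t < Q" "t \<notin> K" "a \<in> P S 0" "b \<in> P T 1" "pat t a" "pat t b" for t a b
        by (rule ST(3)[of t a b]) (use that in \<open>simp_all add: P_def\<close>)
    qed (use * ST(1,2) K(1) in \<open>auto simp: P_def\<close>)
    then show False using neg by blast
  qed
  have "\<not> (Q \<le> 32 * card (P A 0) \<and> Q \<le> 32 * card (P B 1))"
    by (rule no[OF sub K(2)])
  moreover have "\<not> (Q \<le> 32 * card (P B 0) \<and> Q \<le> 32 * card (P A 1))"
    by (rule no[OF sub(2,1)]) (rule K(2))
  moreover have "Q \<le> 16 * (card (P A 0) + card (P B 0))" "Q \<le> 16 * (card (P A 1) + card (P B 1))"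
    using tot by simp_all
  moreover have "Q \<le> 16 * (card (P A 0) + card (P A 1))" "Q \<le> 16 * (card (P B 0) + card (P B 1))"
    using split[OF fin(1)] split[OF fin(2)] large by simp_all
  moreover have "n \<le> 16 * (x + y) \<Longrightarrow> n \<le> 32 * x \<or> n \<le> 32 * y" for n x y :: nat
    by presburger
  ultimately show False by blast
qed

lemma half_band:
  assumes "\<epsilon> < 2"
  shows "Q \<le> 2 * card {\<rho> \<in> {x * Q..<x * Q + Q}. \<rho> div m mod 2 = \<epsilon>}"
proof -
  obtain h where h: "q = 2 * h" using q_even by blast
  let ?f = "\<lambda>(y, j). (x * q + 2 * y + \<epsilon>) * m + j"
  have "inj_on ?f ({..<h} \<times> {..<m})"
  proof (rule inj_onI)
    fix p p' assume "p \<in> {..<h} \<times> {..<m}" "p' \<in> {..<h} \<times> {..<m}" "?f p = ?f p'"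
    then obtain y j y' j' where p: "p = (y, j)" "p' = (y', j')" "j < m" "j' < m"
      "(x * q + 2 * y + \<epsilon>) * m + j = (x * q + 2 * y' + \<epsilon>) * m + j'" by auto
    then have "j = j'" "x * q + 2 * y + \<epsilon> = x * q + 2 * y' + \<epsilon>"
      using mult_add_div_mod by metis+
    then show "p = p'" using p by simp
  qed
  moreover have "?f ` ({..<h} \<times> {..<m}) \<subseteq> {\<rho> \<in> {x * Q..<x * Q + Q}. \<rho> div m mod 2 = \<epsilon>}"
  proof
    fix \<rho> assume "\<rho> \<in> ?f ` ({..<h} \<times> {..<m})"
    then obtain y j where \<rho>: "\<rho> = (x * q + 2 * y + \<epsilon>) * m + j" "y < h" "j < m" by auto
    have d: "\<rho> div m = x * q + 2 * y + \<epsilon>" unfolding \<rho>(1) by (rule mult_add_div_mod(1)[OF \<rho>(3)])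
    then have "\<rho> div m div q = x" "\<rho> div m mod 2 = \<epsilon>"
      using \<rho>(2) assms q_pos h by (simp_all add: add.assoc mod_add_left_eq mult.commute[of x] flip: mod_add_eq)
    moreover from this have "\<rho> div Q = x" by (simp add: div_mult2_eq)
    then have "x * Q \<le> \<rho> \<and> \<rho> < x * Q + Q"
      using Q_pos by (metis add.commute div_mult_mod_eq le_add1 mod_less_divisor nat_add_left_cancel_less add_less_cancel_left)
    ultimately show "\<rho> \<in> {\<rho> \<in> {x * Q..<x * Q + Q}. \<rho> div m mod 2 = \<epsilon>}" by simp
  qed
  ultimately have "card ({..<h} \<times> {..<m}) \<le> card {\<rho> \<in> {x * Q..<x * Q + Q}. \<rho> div m mod 2 = \<epsilon>}"
    by (intro card_inj_on_le) auto
  then have "h * m \<le> card {\<rho> \<in> {x * Q..<x * Q + Q}. \<rho> div m mod 2 = \<epsilon>}"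
    by (simp only: card_cartesian_product card_lessThan)
  moreover have "Q = 2 * (h * m)" by (simp add: h)
  ultimately show ?thesis by linarith
qed

section \<open>Rows and columns after a deletion\<close>

definition row :: "nat \<Rightarrow> nat set" where
  "row l = {v \<in> verts. v mod L = l}"

definition col :: "nat \<Rightarrow> nat set" where
  "col i = {v \<in> verts. v div L = i}"

definition dead_rows :: "nat set \<Rightarrow> nat set" where
  "dead_rows X = (\<lambda>v. v mod L) ` X"

definition dead_cols :: "nat set \<Rightarrow> nat set" where
  "dead_cols X = (\<lambda>v. v div L) ` X"

text \<open>A vertex of \<open>X\<close> spoils its row and its column, so it never qualifies.
  Vertices of a spoiled row are kept if their column is intact, and conversely, so that intact rows
  and columns stay complete.\<close>

definition alive :: "nat set \<Rightarrow> nat set" where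
  "alive X = {v \<in> verts. v mod L \<notin> dead_rows X \<or> v div L \<notin> dead_cols X}"

definition rows :: "nat set \<Rightarrow> nat set \<Rightarrow> nat set" where
  "rows X A = {l. l < L \<and> l \<notin> dead_rows X \<and> row l \<noteq> {} \<and> row l \<subseteq> A}"

lemma finite_rows [simp]: "finite (rows X A)"
  by (rule finite_subset[of _ "{..<L}"]) (auto simp: rows_def)

lemma row_in_closed:
  assumes "closed_in edges (alive X) A" "l \<notin> dead_rows X"
  shows "row l \<subseteq> A \<or> row l \<inter> A = {}"
proof -
  have step: "(v \<in> A) = (w \<in> A)" if "row_step v w" "v mod L = l" for v w
  proof -
    have "{v, w} \<in> edges" using that by (auto simp: edges_def)
    moreover have "v \<in> alive X" "w \<in> alive X" using that assms(2) by (auto simp: alive_def consecutive_def)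
    ultimately show ?thesis by (rule closed_in_edge[OF assms(1)])
  qed
  have "(v \<in> A) = (w \<in> A)" if "v \<in> row l" "w \<in> row l" for v w
  proof (rule consecutive_constant[where V = verts and f = "\<lambda>v. v mod L" and g = "\<lambda>v. v div L" and l = l])
    show "v = w" if "v mod L = w mod L" "v div L = w div L" for v w :: nat
      using that by (rule vertex_eqI)
  qed (use that step in \<open>auto simp: row_def\<close>)
  then show ?thesis by blast
qed

lemma col_in_closed:
  assumes "closed_in edges (alive X) A" "i \<notin> dead_cols X"
  shows "col i \<subseteq> A \<or> col i \<inter> A = {}"
proof -
  have step: "(v \<in> A) = (w \<in> A)" if "col_step v w" "v div L = i" for v w
  proof -
    have "{v, w} \<in> edges" using that by (auto simp: edges_def)
    moreover have "v \<in> alive X" "w \<in> alive X" using that assms(2) by (auto simp: alive_def consecutive_def)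
    ultimately show ?thesis by (rule closed_in_edge[OF assms(1)])
  qed
  have "(v \<in> A) = (w \<in> A)" if "v \<in> col i" "w \<in> col i" for v w
  proof (rule consecutive_constant[where V = verts and f = "\<lambda>v. v div L" and g = ht and l = i])
    show "v = w" if "v \<in> verts" "v div L = w div L" "ht v = ht w" for v w
      using that by (rule col_vertex_eqI)
  qed (use that step in \<open>auto simp: col_def\<close>)
  then show ?thesis by blast
qed

lemma card_rows_add:
  assumes "closed_in edges (alive X) A" "closed_in edges (alive X) B" "B \<subseteq> A"
  shows "card (rows X A) = card (rows X B) + card (rows X (A - B))"
proof -
  have "rows X A = rows X B \<union> rows X (A - B)"
  proof
    show "rows X A \<subseteq> rows X B \<union> rows X (A - B)"
    proof
      fix l assume l: "l \<in> rows X A"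
      then have "row l \<subseteq> B \<or> row l \<inter> B = {}" using row_in_closed[OF assms(2)] by (simp add: rows_def)
      then show "l \<in> rows X B \<union> rows X (A - B)" using l by (auto simp: rows_def)
    qed
    show "rows X B \<union> rows X (A - B) \<subseteq> rows X A" using assms(3) by (auto simp: rows_def)
  qed
  moreover have "rows X B \<inter> rows X (A - B) = {}" by (auto simp: rows_def)
  ultimately show ?thesis by (simp add: card_Un_disjoint)
qed

lemma alive_row: "l \<notin> dead_rows X \<Longrightarrow> row l \<subseteq> alive X"
  by (auto simp: row_def alive_def)

lemma row_nonempty: "i \<le> c \<Longrightarrow> l < L \<Longrightarrow> in_block i l \<Longrightarrow> row l \<noteq> {}"
  using row_window[of i l 0] q_pos mk_vertex(2) unfolding row_def by blast

lemma card_dead: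
  assumes "finite X" "card X \<le> s"
  shows "finite (dead_rows X)" "card (dead_rows X) \<le> s" "finite (dead_cols X)" "card (dead_cols X) \<le> s"
  using assms card_image_le[OF assms(1)] le_trans unfolding dead_rows_def dead_cols_def by blast+

definition bad_blocks :: "nat set \<Rightarrow> nat set" where
  "bad_blocks X = {i \<in> {..c}. Q \<le> 1024 * card {t \<in> dead_cols X. t div Q = i}}"

text \<open>A strand outside this set has few dead rows, and every block it takes part in is good;
  the thresholds are those of \<open>heavy\<close> and \<open>block_expands\<close>.\<close>

definition bad_strands :: "nat set \<Rightarrow> nat set" where
  "bad_strands X = {x \<in> {..<N}. Q \<le> 16 * card {l \<in> dead_rows X. l div Q = x}} \<union> U ` bad_blocks X \<union> W ` bad_blocks X"

lemma card_bad_strands: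
  assumes "finite X" "card X \<le> s"
  shows "finite (bad_strands X)" "16 * card (bad_strands X) \<le> N"
proof -
  note dead = card_dead[OF assms]
  let ?D = "{x \<in> {..<N}. Q \<le> 16 * card {l \<in> dead_rows X. l div Q = x}}"
  have fin: "finite ?D" "finite (bad_blocks X)" by (simp_all add: bad_blocks_def)
  then show "finite (bad_strands X)" by (simp add: bad_strands_def)
  have "card ?D * Q \<le> 16 * card (dead_rows X)" using dead(1) fin(1)
    by (rule card_fibres_le[where f = "\<lambda>l. l div Q"]) simp
  \<comment> \<open>Here \<open>65536 / 16 = 4096\<close>, and for the blocks
    \<open>65536 / 1024 = 64\<close>. A bad block spoils two strands, and
    \<open>1 / 4096 + 2 / 64 < 1 / 16\<close>.\<close>
  then have "(4096 * card ?D) * Q \<le> N * Q" using dead(2) s_le by linarith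
  then have D: "4096 * card ?D \<le> N" using Q_pos by simp
  have "card (bad_blocks X) * Q \<le> 1024 * card (dead_cols X)"
    using dead(3) fin(2) by (rule card_fibres_le[where f = "\<lambda>l. l div Q"]) (simp add: bad_blocks_def)
  then have "(64 * card (bad_blocks X)) * Q \<le> N * Q" using dead(4) s_le by linarith
  then have B: "64 * card (bad_blocks X) \<le> N" using Q_pos by simp
  have "card (bad_strands X) \<le> card ?D + card (U ` bad_blocks X) + card (W ` bad_blocks X)"
    unfolding bad_strands_def by (meson add_le_mono1 card_Un_le le_trans)
  also have "\<dots> \<le> card ?D + card (bad_blocks X) + card (bad_blocks X)"
    using card_image_le[OF fin(2)] by (intro add_mono) auto
  finally show "16 * card (bad_strands X) \<le> N" using D B by linarith
qed

definition heavy :: "nat set \<Rightarrow> nat set \<Rightarrow> nat set" where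
  "heavy X A = {x \<in> {..<N} - bad_strands X. Q \<le> 16 * card {l \<in> rows X A. l div Q = x}}"

text \<open>Heavy strands and bad strands each make up at most a sixteenth of all, and every other
  strand contributes at most a sixteenth of its rows.\<close>

lemma few_heavy:
  assumes "finite X" "card X \<le> s" "16 * card (heavy X A) < N"
  shows "16 * card (rows X A) \<le> 3 * L"
proof -
  let ?F = "\<lambda>x. {l \<in> rows X A. l div Q = x}"
  let ?D = "bad_strands X"
  have F: "card (?F x) \<le> Q" for x
  proof -
    have "?F x \<subseteq> {x * Q..<x * Q + Q}"
    proof
      fix l assume "l \<in> ?F x"
      then have "l div Q = x" by simp
      then show "l \<in> {x * Q..<x * Q + Q}"
        using div_mult_mod_eq[of l Q] mod_less_divisor[OF Q_pos, of l]
        by (metis add_less_cancel_left atLeastLessThan_iff le_add1)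
    qed
    then show ?thesis using card_mono[of "{x * Q..<x * Q + Q}" "?F x"] by simp
  qed
  have "rows X A = (\<Union>x<N. ?F x)"
    by (auto simp: rows_def less_mult_imp_div_less)
  moreover have "card (\<Union>x<N. ?F x) = (\<Sum>x<N. card (?F x))"
    by (rule card_UN_disjoint) auto
  ultimately have "16 * card (rows X A) = (\<Sum>x<N. 16 * card (?F x))" by (simp add: sum_distrib_left)
  also have "\<dots> \<le> (\<Sum>x<N. (if x \<in> heavy X A then 16 * Q else 0) + (if x \<in> ?D then 16 * Q else 0) + Q)"
  proof (rule sum_mono)
    fix x assume "x \<in> {..<N}"
    then show "16 * card (?F x) \<le> (if x \<in> heavy X A then 16 * Q else 0) + (if x \<in> ?D then 16 * Q else 0) + Q"
      using F[of x] by (auto simp: heavy_def)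
  qed
  also have "\<dots> = card ({..<N} \<inter> heavy X A) * (16 * Q) + card ({..<N} \<inter> ?D) * (16 * Q) + N * Q"
    by (simp add: sum.distrib sum.If_cases Int_def)
  also have "\<dots> \<le> card (heavy X A) * (16 * Q) + card ?D * (16 * Q) + N * Q"
  proof -
    have "finite (heavy X A)" by (simp add: heavy_def)
    then show ?thesis
      using card_bad_strands(1)[OF assms(1,2)] by (intro add_mono mult_le_mono1 card_mono) auto
  qed
  also have "\<dots> = (16 * card (heavy X A) + 16 * card ?D + N) * Q" by (simp add: algebra_simps)
  also have "\<dots> \<le> (3 * N) * Q"
    using assms(3) card_bad_strands(2)[OF assms(1,2)] by (intro mult_le_mono1) linarith
  finally show ?thesis by simp
qed

lemma strand_rel:
  assumes "x \<in> {U i, W i}"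
  obtains \<xi> where "\<And>\<rho>. \<rho> \<in> {\<xi> * Q..<\<xi> * Q + Q} \<Longrightarrow> \<exists>l<L. in_block i l \<and> rel i l = \<rho> \<and> l div Q = x"
proof -
  have "ord i x \<in> {base i, Suc (base i)}" using assms ord_pair by blast
  then obtain \<xi> where \<xi>: "ord i x = base i + \<xi>" "\<xi> < 2"
    by (metis add.right_neutral add_Suc_right insertE less_2_cases_iff numeral_1_eq_Suc_0 One_nat_def singletonD)
  have "\<exists>l<L. in_block i l \<and> rel i l = \<rho> \<and> l div Q = x" if \<rho>: "\<rho> \<in> {\<xi> * Q..<\<xi> * Q + Q}" for \<rho>
  proof -
    have "\<xi> * Q \<le> Q" using \<xi>(2) by (cases \<xi>) auto
    moreover have "\<rho> < \<xi> * Q + Q" using \<rho> by simp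
    ultimately have "\<rho> < 2 * Q" by linarith
    then obtain l where l: "l < L" "in_block i l" "rel i l = \<rho>" using rel_surj by blast
    have "pos i l = (base i + \<xi>) * Q + (\<rho> - \<xi> * Q)" using pos_rel[OF l(2)] l(3) \<rho> by (simp add: add_mult_distrib)
    then have "pos i l div Q = base i + \<xi>"
      using mult_add_div_mod(1)[of "\<rho> - \<xi> * Q" Q "base i + \<xi>"] \<rho> by auto
    then have "ord i (l div Q) = ord i x" using pos_div \<xi>(1) by simp
    then show ?thesis using l ord_inj by blast
  qed
  then show ?thesis using that by blast
qed

text \<open>Some pair has a strand heavy for each side. Its block is good, so
  \<open>block_expands\<close> yields an intact column with vertices in rows of both sides, although
  an intact column lies on one side. For the parity condition, strand \<open>x\<close> alone has
  \<open>Q / 2\<close> rows of each parity, and fewer than \<open>Q / 16\<close> of its rows are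
  dead.\<close>

lemma both_heavy_False:
  assumes X: "finite X" "card X \<le> s" and A: "closed_in edges (alive X) A"
    and heavy: "N \<le> 16 * card (heavy X A)" "N \<le> 16 * card (heavy X (alive X - A))"
  shows False
proof -
  let ?B = "alive X - A"
  have B: "closed_in edges (alive X) ?B" using closed_in_Diff[OF closed_in_self A] .
  have "heavy X A \<subseteq> {..<N}" "heavy X ?B \<subseteq> {..<N}" by (auto simp: heavy_def)
  then obtain i where i: "i \<le> c" "{U i, W i} \<inter> heavy X A \<noteq> {}" "{U i, W i} \<inter> heavy X ?B \<noteq> {}"
    using expanding heavy unfolding expanding_pairs_def by blast
  obtain x where x: "x \<in> {U i, W i}" "x \<in> heavy X A" using i(2) by blast
  obtain y where y: "y \<in> {U i, W i}" "y \<in> heavy X ?B" using i(3) by blast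
  have good: "i \<notin> bad_blocks X" "x < N" "16 * card {l \<in> dead_rows X. l div Q = x} < Q"
    using x by (auto simp: heavy_def bad_strands_def)
  define R where "R S = rel i ` {l \<in> rows X S. in_block i l}" for S
  have R_large: "Q \<le> 16 * card (R S)" if "z \<in> {U i, W i}" "z \<in> heavy X S" for z S
  proof -
    have "{l \<in> rows X S. l div Q = z} \<subseteq> {l \<in> rows X S. in_block i l}"
      using that(1) by (auto simp: in_block_iff)
    then have "card {l \<in> rows X S. l div Q = z} \<le> card {l \<in> rows X S. in_block i l}"
      by (intro card_mono) auto
    also have "\<dots> = card (R S)"
      unfolding R_def by (rule card_image[symmetric]) (auto simp: inj_on_def rel_inj)
    finally show ?thesis using that(2) by (simp add: heavy_def)
  qed
  define K where "K = {t \<in> {..<Q}. i * Q + t \<in> dead_cols X}"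
  have "card K \<le> card {t \<in> dead_cols X. t div Q = i}"
  proof (rule card_inj_on_le[of "\<lambda>t. i * Q + t"])
    show "(\<lambda>t. i * Q + t) ` K \<subseteq> {t \<in> dead_cols X. t div Q = i}"
      using mult_add_div_mod(1)[of _ Q i] by (auto simp: K_def)
    show "finite {t \<in> dead_cols X. t div Q = i}" using card_dead(3)[OF X] by simp
  qed (auto simp: inj_on_def)
  then have "1024 * card K < Q" using good(1) i(1) by (simp add: bad_blocks_def)
  moreover have "Q \<le> 1024 * card K"
  proof (rule block_expands[of "R A" "R ?B"])
    show "R A \<subseteq> {..<2 * Q}" "R ?B \<subseteq> {..<2 * Q}" using rel_less by (auto simp: R_def)
    show "Q \<le> 16 * card (R A)" "Q \<le> 16 * card (R ?B)" using R_large x y by blast+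
    show "finite K" by (simp add: K_def)
    show False if t: "t < Q" "t \<notin> K" and ab: "a \<in> R A" "b \<in> R ?B" "pat t a" "pat t b" for t a b
    proof -
      obtain l where l: "l \<in> rows X A" "in_block i l" "a = rel i l" using ab(1) by (auto simp: R_def)
      obtain l' where l': "l' \<in> rows X ?B" "in_block i l'" "b = rel i l'" using ab(2) by (auto simp: R_def)
      let ?k = "i * Q + t"
      have k: "?k div Q = i" "?k mod Q = t" using mult_add_div_mod[OF t(1)] by blast+
      have "(i + 1) * Q \<le> Suc c * Q" using i(1) by (intro mult_le_mono1) simp
      then have kM: "?k < Suc c * Q" using t(1) unfolding add_mult_distrib by linarith
      have "l < L" "l' < L" using l(1) l'(1) by (auto simp: rows_def)
      note mk = mk_vertex[OF this(1) kM] mk_vertex[OF this(2) kM]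
      have v: "?k * L + l \<in> verts" "?k * L + l' \<in> verts"
        unfolding mk(3) mk(6) k using l l' ab by auto
      have "?k * L + l \<in> A" "?k * L + l' \<in> ?B"
        using l(1) l'(1) v mk(2,5) by (auto simp: rows_def row_def)
      moreover have "?k * L + l \<in> col ?k" "?k * L + l' \<in> col ?k"
        using v mk(1,4) by (auto simp: col_def)
      moreover have "?k \<notin> dead_cols X" using t by (simp add: K_def)
      ultimately show False using col_in_closed[OF A, of ?k] by blast
    qed
    show "Q \<le> 16 * card {\<rho> \<in> R A \<union> R ?B. \<rho> div m mod 2 = \<epsilon>}" if "\<epsilon> < 2" for \<epsilon>
    proof -
      let ?T = "{\<rho> \<in> R A \<union> R ?B. \<rho> div m mod 2 = \<epsilon>}"
      let ?Z = "{l \<in> dead_rows X. l div Q = x}"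
      obtain \<xi> where \<xi>: "\<And>\<rho>. \<rho> \<in> {\<xi> * Q..<\<xi> * Q + Q} \<Longrightarrow> \<exists>l<L. in_block i l \<and> rel i l = \<rho> \<and> l div Q = x"
        using strand_rel[OF x(1)] by blast
      have "{\<rho> \<in> {\<xi> * Q..<\<xi> * Q + Q}. \<rho> div m mod 2 = \<epsilon>} \<subseteq> ?T \<union> rel i ` ?Z"
      proof
        fix \<rho> assume \<rho>: "\<rho> \<in> {\<rho> \<in> {\<xi> * Q..<\<xi> * Q + Q}. \<rho> div m mod 2 = \<epsilon>}"
        then obtain l where l: "l < L" "in_block i l" "rel i l = \<rho>" "l div Q = x" using \<xi> by blast
        show "\<rho> \<in> ?T \<union> rel i ` ?Z"
        proof (cases "l \<in> dead_rows X")
          case True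
          then show ?thesis using l by blast
        next
          case False
          then have "row l \<subseteq> A \<or> row l \<subseteq> ?B"
            using row_in_closed[OF A False] alive_row[OF False] by blast
          then have "l \<in> rows X A \<or> l \<in> rows X ?B"
            using False l row_nonempty[OF i(1) l(1,2)] by (auto simp: rows_def)
          then have "\<rho> \<in> R A \<union> R ?B" using l by (auto simp: R_def)
          then show ?thesis using \<rho> by blast
        qed
      qed
      moreover have fin: "finite ?T" "finite ?Z"
        using card_dead(1)[OF X] by (auto simp: R_def)
      ultimately have "card {\<rho> \<in> {\<xi> * Q..<\<xi> * Q + Q}. \<rho> div m mod 2 = \<epsilon>} \<le> card (?T \<union> rel i ` ?Z)"
        by (intro card_mono) auto
      also have "\<dots> \<le> card ?T + card ?Z"
        using card_Un_le[of ?T "rel i ` ?Z"] card_image_le[OF fin(2), of "rel i"] by linarith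
      finally show ?thesis using half_band[OF that, of \<xi>] good(3) by linarith
    qed
  qed
  ultimately show False by linarith
qed

section \<open>A connected part with more than half of the rows\<close>

lemma rows_alive:
  assumes X: "finite X" "card X \<le> s"
  shows "14 * L \<le> 16 * card (rows X (alive X))"
proof -
  \<comment> \<open>Strands in no pair carry no vertices; expansion with \<open>A = B = Y\<close>
    shows that they are fewer than \<open>N / 16\<close>.\<close>
  define Y where "Y = {x \<in> {..<N}. \<forall>i\<le>c. x \<notin> {U i, W i}}"
  have "\<not> N \<le> 16 * card Y"
  proof
    assume "N \<le> 16 * card Y"
    moreover have "Y \<subseteq> {..<N}" by (auto simp: Y_def)
    ultimately obtain i where "i \<le> c" "{U i, W i} \<inter> Y \<noteq> {}"
      using expanding unfolding expanding_pairs_def by blast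
    then show False by (auto simp: Y_def)
  qed
  then have Y: "16 * (card Y * Q) \<le> L" using mult_le_mono1[of "16 * card Y" N Q] by (simp add: mult.assoc)
  let ?S = "(\<lambda>(x, j). x * Q + j) ` (Y \<times> {..<Q})"
  have finY: "finite Y" by (simp add: Y_def)
  have "{..<L} \<subseteq> rows X (alive X) \<union> dead_rows X \<union> ?S"
  proof
    fix l assume l: "l \<in> {..<L}"
    show "l \<in> rows X (alive X) \<union> dead_rows X \<union> ?S"
    proof (cases "l div Q \<in> Y")
      case True
      moreover have "l = l div Q * Q + l mod Q" by (rule div_mult_mod_eq[symmetric])
      moreover have "l mod Q < Q" using Q_pos by (rule mod_less_divisor)
      ultimately have "l \<in> ?S" by (intro image_eqI[of _ _ "(l div Q, l mod Q)"]) auto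
      then show ?thesis by blast
    next
      case False
      moreover have "l div Q < N" using l less_mult_imp_div_less by blast
      ultimately obtain i where "i \<le> c" "in_block i l" by (auto simp: Y_def in_block_iff)
      then have "row l \<noteq> {}" using row_nonempty l by blast
      then show ?thesis using l alive_row by (auto simp: rows_def)
    qed
  qed
  then have "card {..<L} \<le> card (rows X (alive X) \<union> dead_rows X \<union> ?S)"
    using finY card_dead(1)[OF X] by (intro card_mono) auto
  also have "\<dots> \<le> card (rows X (alive X)) + card (dead_rows X) + card ?S"
    by (meson add_le_mono1 card_Un_le le_trans)
  also have "card ?S \<le> card Y * Q"
    using card_image_le[of "Y \<times> {..<Q}" "\<lambda>(x, j). x * Q + j"] finY by (simp add: card_cartesian_product)
  finally have "L \<le> card (rows X (alive X)) + card (dead_rows X) + card Y * Q" by simp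
  then show ?thesis using Y card_dead(2)[OF X] s_le by linarith
qed

lemma connected_part:
  assumes X: "finite X" "card X \<le> s"
  shows "\<exists>A. A \<subseteq> verts - X \<and> induces_connected A edges \<and> L < 2 * card (rows X A)"
proof -
  \<comment> \<open>The bound of \<open>few_heavy\<close>. In sixteenths of \<open>L\<close>, at
    least \<open>14\<close> are alive: \<open>3 * 3 < 14\<close> is what
    \<open>connected_heavy_part\<close> asks for, and \<open>14 - 3 = 11\<close> remain, more than
    half.\<close>
  let ?\<alpha> = "3 * L div 16"
  have "\<exists>A. closed_in edges (alive X) A \<and> induces_connected A edges \<and> card (rows X (alive X)) \<le> card (rows X A) + ?\<alpha>"
  proof (rule connected_heavy_part)
    show "finite (alive X)" using finite_V by (simp add: alive_def)
    show "card (rows X A) \<le> ?\<alpha> \<or> card (rows X (alive X - A)) \<le> ?\<alpha>" if "closed_in edges (alive X) A" for A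
    proof -
      have "16 * card (heavy X A) < N \<or> 16 * card (heavy X (alive X - A)) < N"
        using both_heavy_False[OF X that] not_le by blast
      then have "16 * card (rows X A) \<le> 3 * L \<or> 16 * card (rows X (alive X - A)) \<le> 3 * L"
        using few_heavy[OF X] by blast
      then show ?thesis by linarith
    qed
    show "3 * ?\<alpha> < card (rows X (alive X))" using rows_alive[OF X] L_pos' by linarith
  qed (rule card_rows_add)
  then obtain A where A: "closed_in edges (alive X) A" "induces_connected A edges"
    "card (rows X (alive X)) \<le> card (rows X A) + ?\<alpha>" by blast
  have "A \<subseteq> verts - X" using A(1) by (auto simp: closed_in_def alive_def dead_rows_def dead_cols_def)
  moreover have "L < 2 * card (rows X A)" using A(3) rows_alive[OF X] L_pos' by linarith
  ultimately show ?thesis using A(2) by blast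
qed

text \<open>Two sets containing more than half of the \<open>L\<close> rows share a row, and by the
  definition of \<open>rows\<close> it has a vertex.\<close>

lemma haven_verts: "\<exists>C. haven verts edges s C"
proof -
  define C where "C X = (SOME A. A \<subseteq> verts - X \<and> induces_connected A edges \<and> L < 2 * card (rows X A))" for X
  have C: "C X \<subseteq> verts - X \<and> induces_connected (C X) edges \<and> L < 2 * card (rows X (C X))"
    if "X \<subseteq> verts" "card X \<le> s" for X
    unfolding C_def by (rule someI_ex, rule connected_part) (use that finite_V finite_subset in auto)
  have "C X \<inter> C Y \<noteq> {}" if "X \<subseteq> verts" "card X \<le> s" "Y \<subseteq> verts" "card Y \<le> s" for X Y
  proof -
    have "rows X (C X) \<inter> rows Y (C Y) \<noteq> {}"
    proof
      assume "rows X (C X) \<inter> rows Y (C Y) = {}"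
      then have "card (rows X (C X) \<union> rows Y (C Y)) = card (rows X (C X)) + card (rows Y (C Y))"
        by (intro card_Un_disjoint) auto
      moreover have "card (rows X (C X) \<union> rows Y (C Y)) \<le> card {..<L}"
        by (intro card_mono) (auto simp: rows_def)
      ultimately show False using C[OF that(1,2)] C[OF that(3,4)] by simp
    qed
    then show ?thesis by (fastforce simp: rows_def)
  qed
  then have "haven verts edges s C" using C by (auto simp: haven_def)
  then show ?thesis by blast
qed

end

section \<open>The lower bounds\<close>

text \<open>Otherwise \<open>C V\<close> would be a nonempty set of vertices avoiding
  \<open>V\<close>. This is what makes the number of vertices exceed any bound.\<close>

lemma haven_less_card:
  assumes "haven V E s C"
  shows "s < card V"
proof (rule ccontr)
  assume "\<not> s < card V"
  then have "C V \<subseteq> V - V" "C V \<noteq> {}"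
    using assms unfolding haven_def induces_connected_def by auto
  then show False by simp
qed

text \<open>Below \<open>1024\<close> two strands on the sphere are enough, the genus being absorbed
  by the constant. From there on, \<open>g div 512\<close> strands with \<open>512\<close>
  cross-caps each fit into Euler genus \<open>g\<close>, and there are at least two strands.\<close>

lemma expanding_parameters:
  obtains N c U W where "c \<le> g" "Suc c \<le> 513 * N" "g + 1 \<le> 1024 * N" "2 \<le> N" "expanding_pairs N c U W"
    "\<And>i. U i < N \<and> W i < N \<and> U i \<noteq> W i" "U 0 = 0" "W 0 = 1"
proof (cases "g < 1024")
  case True
  then show ?thesis
    by (intro that[OF _ _ _ _ expanding_pairs_two]) auto
next
  case False
  define N where "N = g div 512"
  have N: "2 \<le> N" "512 * N \<le> g" "g < 512 * (N + 1)"
    using False by (auto simp: N_def)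
  obtain U W where "expanding_pairs N (512 * N) U W" "\<And>i. U i < N \<and> W i < N \<and> U i \<noteq> W i" "U 0 = 0" "W 0 = 1"
    using expanding_pairs_exist[OF N(1)] by blast
  with N show ?thesis by (intro that[of "512 * N" N U W]) auto
qed

theorem theorem15:
  shows "\<exists>c>0::real. \<forall>g k :: nat.
    infinite {n. \<exists>(V :: nat set) E.
      card V = n \<and> gk_planar g k V E \<and>
      real_of_int (treewidth V E) \<ge> c * sqrt ((real g + 1) * (real k + 1) * real n) \<and>
      real (layered_treewidth V E) \<ge> c * (real g + 1) * (real k + 1)}"
proof (intro exI[of _ "1 / 2 ^ 60"] conjI allI)
  fix g k :: nat
  obtain N c U W where c: "c \<le> g" "Suc c \<le> 513 * N" and g: "g + 1 \<le> 1024 * N" and N: "2 \<le> N"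
    and exp: "expanding_pairs N c U W" "\<And>i. U i < N \<and> W i < N \<and> U i \<noteq> W i" "U 0 = 0" "W 0 = 1"
    using expanding_parameters[of g] by metis
  \<comment> \<open>The largest \<open>m\<close> with \<open>2 * m - 2 \<le> k\<close>, the number
    of crossings allowed on an edge.\<close>
  define m where "m = k div 2 + 1"
  have m: "k + 1 \<le> 2 * m" "2 * m - 2 \<le> k" by (auto simp: m_def)
  show "infinite {n. \<exists>(V :: nat set) E.
      card V = n \<and> gk_planar g k V E \<and>
      real_of_int (treewidth V E) \<ge> 1 / 2 ^ 60 * sqrt ((real g + 1) * (real k + 1) * real n) \<and>
      real (layered_treewidth V E) \<ge> 1 / 2 ^ 60 * (real g + 1) * (real k + 1)}"
    unfolding infinite_nat_iff_unbounded
  proof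
    fix b :: nat
    \<comment> \<open>The factor \<open>2\<close> makes \<open>q\<close> even, \<open>65536\<close>
      makes \<open>L = 65536 * s\<close> exact, and \<open>b + 1\<close> pushes \<open>s\<close>,
      and with it the number of vertices, beyond \<open>b\<close>.\<close>
    define r where "r = 2 * (65536 * (b + 1))"
    define q where "q = m * r"
    define L where "L = N * (m * q)"
    define s where "s = N * m * m * 2 * (b + 1)"
    have L: "L = 65536 * s" by (simp add: L_def s_def q_def r_def algebra_simps)
    have "1 \<le> m" by (simp add: m_def)
    then have "1 * 1 * 1 * 1 * (b + 1) \<le> N * m * m * 2 * (b + 1)"
      using N by (intro mult_le_mono) auto
    then have s: "b < s" by (simp add: s_def)
    interpret expanding_strands N c m q U W r s
    proof
      show "0 < q" "even q" by (simp_all add: q_def r_def m_def)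
      show "65536 * s \<le> N * (m * q)" using L by (simp add: L_def)
    qed (use exp in \<open>simp_all add: m_def q_def\<close>)
    obtain C where C: "haven verts edges s C" using haven_verts by blast
    let ?n = "card verts" and ?tw = "treewidth verts edges" and ?ltw = "layered_treewidth verts edges"
    have "(g + 1) * (k + 1) * ?n \<le> (1024 * N) * (2 * m) * ((513 * N * (m * q)) * (2 * q))"
      using card_verts mult_le_mono1[OF mult_le_mono1[OF c(2)], of "m * q" "2 * q"]
      by (intro mult_le_mono g m(1)) linarith
    also have "\<dots> = 2101248 * L ^ 2" by (simp add: L_def power2_eq_square algebra_simps)
    \<comment> \<open>\<open>1024 * 2 * 513 * 2 = 2101248 < 2 ^ 22\<close>, and
      \<open>L ^ 2 = 2 ^ 32 * s ^ 2\<close>.\<close>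
    also have "\<dots> \<le> 2 ^ 54 * s ^ 2" by (simp add: L power_mult_distrib)
    finally have "real ((g + 1) * (k + 1) * ?n) \<le> real (2 ^ 54 * s ^ 2)" by (rule of_nat_mono)
    then have bound: "(real g + 1) * (real k + 1) * real ?n \<le> 2 ^ 54 * real s ^ 2" by (simp add: algebra_simps)
    have tw: "1 / 2 ^ 60 * sqrt ((real g + 1) * (real k + 1) * real ?n) \<le> real_of_int ?tw"
    proof -
      have "sqrt ((real g + 1) * (real k + 1) * real ?n) \<le> sqrt ((2 ^ 27 * real s) ^ 2)"
        using bound by (intro real_sqrt_le_mono) (simp add: power_mult_distrib)
      also have "\<dots> = 2 ^ 27 * real s" by (subst real_sqrt_abs) simp
      finally have "1 / 2 ^ 60 * sqrt ((real g + 1) * (real k + 1) * real ?n) \<le> real s" by simp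
      also have "real s \<le> real_of_int ?tw"
        using haven_treewidth[OF edges_simple C] by linarith
      finally show ?thesis .
    qed
    \<comment> \<open>\<open>s ^ 2 \<le> 4 * n * ltw\<close> and \<open>bound\<close> both contain
      the number of vertices, which cancels; \<open>2 ^ 54 * 4 = 2 ^ 56\<close>.\<close>
    have ltw: "1 / 2 ^ 60 * (real g + 1) * (real k + 1) \<le> real ?ltw"
    proof -
      have "0 < s" using s by simp
      then have "real s ^ 2 \<le> 4 * real ?n * real ?ltw" by (rule haven_layered_treewidth[OF edges_simple C])
      then have "2 ^ 54 * real s ^ 2 \<le> 2 ^ 54 * (4 * real ?n * real ?ltw)" by (intro mult_left_mono) auto
      also have "\<dots> = 2 ^ 56 * real ?ltw * real ?n" by simp
      finally have "(real g + 1) * (real k + 1) * real ?n \<le> 2 ^ 56 * real ?ltw * real ?n"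
        by (rule order_trans[OF bound])
      moreover have "0 < real ?n" using haven_less_card[OF C] by simp
      ultimately have "(real g + 1) * (real k + 1) \<le> 2 ^ 56 * real ?ltw" by (simp only: mult_le_cancel_right_pos)
      then show ?thesis by simp
    qed
    have "b < ?n" using s haven_less_card[OF C] by linarith
    then show "\<exists>n>b. n \<in> {n. \<exists>(V :: nat set) E.
      card V = n \<and> gk_planar g k V E \<and>
      real_of_int (treewidth V E) \<ge> 1 / 2 ^ 60 * sqrt ((real g + 1) * (real k + 1) * real n) \<and>
      real (layered_treewidth V E) \<ge> 1 / 2 ^ 60 * (real g + 1) * (real k + 1)}"
      using gk_planar_verts[OF m(2) c(1)] tw ltw by blast
  qed
qed simp

end
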